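(* Let $G$ be a real Lie group with Lie algebra $\mathfrak g$ and let $X$ be a $G$-manifold. The following three categories are isomorphic: (1) The category $\mathrm{Vect}_{TG}^{\mathrm{aff}}(X)$ of affine actions of $TG$ over $X$. (2) The category of pairs $(E,\rho_{\mathfrak g})$: the objects are pairs $(E,\rho_{\mathfrak g})$, where $E$ is a $G$-equivariant vector bundle over $X$ and $\rho_{\mathfrak g}:\mathfrak g\to\Gamma(E)$ is a $G$-equivariant linear map; the morphisms $(E,\rho_{\mathfrak g})\to(E',\rho'_{\mathfrak g})$ are the morphisms $\psi:E\to E'$ of $G$-equivariant vector bundles over $X$ such that $\Gamma(\psi)\circ\rho_{\mathfrak g}=\rho'_{\mathfrak g}$; composition is composition of morphisms of vector bundles over $X$. (3) The slice category $\mathfrak g_X\backslash\mathrm{Vect}_G(X)$.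
   Context: All manifolds are smooth, finite-dimensional and real, maps are smooth, and vector bundles are real of finite rank. A $G$-manifold is a manifold $X$ with a smooth left action $t:G\times X\to X$, written $t(g,x)=g\cdot x$. A morphism of vector bundles over $X$ is a fibrewise linear smooth map covering $\mathrm{id}_X$; $\Gamma(\psi)$ denotes the induced linear map on sections. A $G$-equivariant vector bundle over $X$ is a vector bundle $E\to X$ with a left action $G\times E\to E$ covering $t$ and fibrewise linear; morphisms are $G$-equivariant morphisms of vector bundles over $X$; the category is $\mathrm{Vect}_G(X)$. $G$ acts on $\Gamma(E)$ by $(g\cdot\xi)_x=g\cdot\xi_{g^{-1}\cdot x}$ and on $\mathfrak g=T_eG$ by the adjoint representation. $\mathfrak g_X$ is the trivial bundle $X\times\mathfrak g$ with $G$-action $g\cdot(x,\alpha)=(g\cdot x,\mathrm{Ad}_g\alpha)$. The tangent bundle $TG$ is a Lie group with multiplication the derivative of the multiplication of $G$: $v_g\bullet w_h=(L_g)_*w_h+(R_h)_*v_g$ for $v_g\in T_gG$, $w_h\in T_hG$. An affine action of $TG$ on a vector bundle $E\to X$ is a left action $\mu:TG\times E\to E$ of the Lie group $TG$ on the total space of $E$ that is a vector bundle morphism covering $t:G\times X\to X$ (here $TG\times E$ is a vector bundle over $G\times X$ with fibre $T_gG\oplus E_x$ over $(g,x)$). A morphism of affine actions is a $TG$-equivariant morphism of vector bundles over $X$. These form the category $\mathrm{Vect}_{TG}^{\mathrm{aff}}(X)$. For an object $m$ of a category $\mathscr C$, $m\backslash\mathscr C$ is the category whose objects are pairs $(a,f)$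 with $f:m\to a$ a morphism of $\mathscr C$, whose morphisms $(a,f)\to(a',f')$ are the morphisms $\chi:a\to a'$ with $\chi\circ f=f'$, with composition as in $\mathscr C$. *)

theory Defs
  imports "HOL-Analysis.Analysis" "HOL-Algebra.Group"
begin

section \<open>Smooth maps between open subsets of Euclidean spaces\<close>

text \<open>
  The ranks of the vector bundles in one category are not bounded, so dimensions have to be numbers
  rather than types. The space of dimension \<open>n\<close> is \<^term>\<open>Euclidean_space n\<close>, whose points
  are the sequences vanishing from index \<open>n\<close> on.
\<close>

definition partial :: "nat \<Rightarrow> ((nat \<Rightarrow> real) \<Rightarrow> real) \<Rightarrow> (nat \<Rightarrow> real) \<Rightarrow> real" where
  "partial i f x = deriv (\<lambda>s. f (x(i := s))) (x i)"

text \<open>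
  \<open>Ck n U k f\<close>: all partial derivatives of \<open>f\<close> of order at most \<open>k\<close> exist and are continuous on
  the open subset \<open>U\<close> of \<^term>\<open>Euclidean_space n\<close>. The values of \<open>f\<close> outside \<open>U\<close> are irrelevant.
\<close>

primrec Ck :: "nat \<Rightarrow> (nat \<Rightarrow> real) set \<Rightarrow> nat \<Rightarrow> ((nat \<Rightarrow> real) \<Rightarrow> real) \<Rightarrow> bool" where
  "Ck n U 0 f \<longleftrightarrow> continuous_map (subtopology (Euclidean_space n) U) euclideanreal f"
| "Ck n U (Suc k) f \<longleftrightarrow>
     continuous_map (subtopology (Euclidean_space n) U) euclideanreal f \<and>
     (\<forall>i<n. (\<forall>x\<in>U. ((\<lambda>s. f (x(i := s))) has_real_derivative partial i f x) (at (x i))) \<and>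
            Ck n U k (partial i f))"

definition euclid_smooth :: "nat \<Rightarrow> (nat \<Rightarrow> real) set \<Rightarrow> ((nat \<Rightarrow> real) \<Rightarrow> nat \<Rightarrow> real) \<Rightarrow> bool" where
  "euclid_smooth n U f \<longleftrightarrow> (\<forall>j k. Ck n U k (\<lambda>x. f x j))"

text \<open>The value at \<open>u\<close> of the derivative at \<open>x\<close> of a map \<open>f\<close> defined near \<open>x\<close>.\<close>

definition jacobian ::
    "nat \<Rightarrow> ((nat \<Rightarrow> real) \<Rightarrow> nat \<Rightarrow> real) \<Rightarrow> (nat \<Rightarrow> real) \<Rightarrow> (nat \<Rightarrow> real) \<Rightarrow> nat \<Rightarrow> real" where
  "jacobian n f x u = (\<lambda>j. \<Sum>i<n. partial i (\<lambda>y. f y j) x * u i)"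

text \<open>The isomorphism of the product of the spaces of dimensions \<open>m\<close> and \<open>n\<close> with that of dimension \<open>m + n\<close>.\<close>

definition juxtapose :: "nat \<Rightarrow> (nat \<Rightarrow> real) \<Rightarrow> (nat \<Rightarrow> real) \<Rightarrow> nat \<Rightarrow> real" where
  "juxtapose m x y = (\<lambda>i. if i < m then x i else y (i - m))"


section \<open>Smooth manifolds\<close>

text \<open>A chart is a pair of its domain and its coordinate map.\<close>

type_synonym 'a chart = "'a set \<times> ('a \<Rightarrow> nat \<Rightarrow> real)"

definition is_chart :: "'a topology \<Rightarrow> nat \<Rightarrow> 'a chart \<Rightarrow> bool" where
  "is_chart T n c \<longleftrightarrow> (case c of (U, \<phi>) \<Rightarrow>
     openin T U \<and> \<phi> \<in> extensional U \<and> openin (Euclidean_space n) (\<phi> ` U) \<and>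
     homeomorphic_map (subtopology T U) (subtopology (Euclidean_space n) (\<phi> ` U)) \<phi>)"

definition compatible :: "nat \<Rightarrow> 'a chart \<Rightarrow> 'a chart \<Rightarrow> bool" where
  "compatible n c d \<longleftrightarrow> (case (c, d) of ((U, \<phi>), (V, \<psi>)) \<Rightarrow>
     euclid_smooth n (\<phi> ` (U \<inter> V)) (\<psi> \<circ> inv_into U \<phi>) \<and>
     euclid_smooth n (\<psi> ` (U \<inter> V)) (\<phi> \<circ> inv_into V \<psi>))"

definition max_atlas :: "'a topology \<Rightarrow> nat \<Rightarrow> 'a chart set \<Rightarrow> 'a chart set" where
  "max_atlas T n A = {c. is_chart T n c \<and> (\<forall>a\<in>A. compatible n c a)}"

record 'a manifold =
  mtop :: "'a topology"
  mdim :: nat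
  atlas :: "'a chart set"

abbreviation mcarrier :: "'a manifold \<Rightarrow> 'a set" where
  "mcarrier M \<equiv> topspace (mtop M)"

text \<open>The equation for the atlas says that the charts are pairwise compatible and that the atlas is maximal.\<close>

definition smooth_manifold :: "'a manifold \<Rightarrow> bool" where
  "smooth_manifold M \<longleftrightarrow>
     Hausdorff_space (mtop M) \<and> second_countable (mtop M) \<and>
     (\<Union>(U, \<phi>)\<in>atlas M. U) = mcarrier M \<and>
     atlas M = max_atlas (mtop M) (mdim M) (atlas M)"

definition smooth_map :: "'a manifold \<Rightarrow> 'b manifold \<Rightarrow> ('a \<Rightarrow> 'b) \<Rightarrow> bool" where
  "smooth_map M N f \<longleftrightarrow>
     continuous_map (mtop M) (mtop N) f \<and>
     (\<forall>(U, \<phi>)\<in>atlas M. \<forall>(V, \<psi>)\<in>atlas N.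
        euclid_smooth (mdim M) (\<phi> ` (U \<inter> f -` V)) (\<psi> \<circ> f \<circ> inv_into U \<phi>))"

definition diffeomorphism :: "'a manifold \<Rightarrow> 'b manifold \<Rightarrow> ('a \<Rightarrow> 'b) \<Rightarrow> bool" where
  "diffeomorphism M N f \<longleftrightarrow> smooth_map M N f \<and>
     (\<exists>h. smooth_map N M h \<and> (\<forall>x\<in>mcarrier M. h (f x) = x) \<and> (\<forall>y\<in>mcarrier N. f (h y) = y))"

definition manifold_by :: "'a topology \<Rightarrow> nat \<Rightarrow> 'a chart set \<Rightarrow> 'a manifold" where
  "manifold_by T n A = \<lparr>mtop = T, mdim = n, atlas = max_atlas T n A\<rparr>"

text \<open>The manifold with underlying set \<open>S\<close> whose topology is determined by the charts in \<open>A\<close>.\<close>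

definition manifold_of_charts :: "'a set \<Rightarrow> nat \<Rightarrow> 'a chart set \<Rightarrow> 'a manifold" where
  "manifold_of_charts S n A =
     manifold_by
       (topology (\<lambda>W. W \<subseteq> S \<and> (\<forall>(U, \<phi>)\<in>A. openin (Euclidean_space n) (\<phi> ` (W \<inter> U))))) n A"

definition euclid_manifold :: "nat \<Rightarrow> (nat \<Rightarrow> real) manifold" where
  "euclid_manifold n = manifold_by (Euclidean_space n) n
     {(topspace (Euclidean_space n), \<lambda>x\<in>topspace (Euclidean_space n). x)}"

definition open_submanifold :: "'a manifold \<Rightarrow> 'a set \<Rightarrow> 'a manifold" where
  "open_submanifold M S =
     \<lparr>mtop = subtopology (mtop M) S, mdim = mdim M, atlas = {(U, \<phi>)\<in>atlas M. U \<subseteq> S}\<rparr>"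

definition prod_manifold :: "'a manifold \<Rightarrow> 'b manifold \<Rightarrow> ('a \<times> 'b) manifold" where
  "prod_manifold M N = manifold_by (prod_topology (mtop M) (mtop N)) (mdim M + mdim N)
     {(U \<times> V, \<lambda>(x, y)\<in>U \<times> V. juxtapose (mdim M) (\<phi> x) (\<psi> y)) | U \<phi> V \<psi>.
        (U, \<phi>) \<in> atlas M \<and> (V, \<psi>) \<in> atlas N}"

text \<open>The copy of \<open>M\<close> on the image of its underlying set under an injection \<open>\<iota>\<close>.\<close>

definition image_manifold :: "('a \<Rightarrow> 'b) \<Rightarrow> 'a manifold \<Rightarrow> 'b manifold" where
  "image_manifold \<iota> M = manifold_of_charts (\<iota> ` mcarrier M) (mdim M)
     {(\<iota> ` U, \<lambda>y\<in>\<iota> ` U. \<phi> (inv_into (mcarrier M) \<iota> y)) | U \<phi>. (U, \<phi>) \<in> atlas M}"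


section \<open>Tangent vectors\<close>

text \<open>
  A tangent vector at \<open>p\<close> is given by its coordinates in all charts around \<open>p\<close>, subject to the
  transformation rule under changes of charts.
\<close>

type_synonym 'a tangent = "'a \<times> ('a chart \<Rightarrow> nat \<Rightarrow> real)"

definition charts_at :: "'a manifold \<Rightarrow> 'a \<Rightarrow> 'a chart set" where
  "charts_at M p = {(U, \<phi>)\<in>atlas M. p \<in> U}"

definition tangent_space :: "'a manifold \<Rightarrow> 'a \<Rightarrow> 'a tangent set" where
  "tangent_space M p = {(p, v) | v.
     v \<in> charts_at M p \<rightarrow>\<^sub>E topspace (Euclidean_space (mdim M)) \<and>
     (\<forall>(U, \<phi>)\<in>charts_at M p. \<forall>(V, \<psi>)\<in>charts_at M p.
        v (V, \<psi>) = jacobian (mdim M) (\<psi> \<circ> inv_into U \<phi>) (\<phi> p) (v (U, \<phi>)))}"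

definition tangent_zero :: "'a manifold \<Rightarrow> 'a \<Rightarrow> 'a tangent" where
  "tangent_zero M p = (p, \<lambda>c\<in>charts_at M p. \<lambda>i. 0)"

definition tangent_add :: "'a manifold \<Rightarrow> 'a tangent \<Rightarrow> 'a tangent \<Rightarrow> 'a tangent" where
  "tangent_add M v w = (fst v, \<lambda>c\<in>charts_at M (fst v). \<lambda>i. snd v c i + snd w c i)"

definition tangent_scale :: "'a manifold \<Rightarrow> real \<Rightarrow> 'a tangent \<Rightarrow> 'a tangent" where
  "tangent_scale M r v = (fst v, \<lambda>c\<in>charts_at M (fst v). \<lambda>i. r * snd v c i)"

text \<open>By the chain rule the result does not depend on the choice of the chart \<open>(U, \<phi>)\<close>.\<close>

definition pushforward :: "'a manifold \<Rightarrow> 'b manifold \<Rightarrow> ('a \<Rightarrow> 'b) \<Rightarrow> 'a tangent \<Rightarrow> 'b tangent" where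
  "pushforward M N f v =
     (let p = fst v; (U, \<phi>) = (SOME c. c \<in> charts_at M p)
      in (f p, \<lambda>(V, \<psi>)\<in>charts_at N (f p).
                 jacobian (mdim M) (\<psi> \<circ> f \<circ> inv_into U \<phi>) (\<phi> p) (snd v (U, \<phi>))))"

definition tangent_manifold :: "'a manifold \<Rightarrow> 'a tangent manifold" where
  "tangent_manifold M =
     manifold_of_charts (\<Union>p\<in>mcarrier M. tangent_space M p) (mdim M + mdim M)
       {(\<Union>p\<in>U. tangent_space M p,
         \<lambda>v\<in>(\<Union>p\<in>U. tangent_space M p). juxtapose (mdim M) (\<phi> (fst v)) (snd v (U, \<phi>))) | U \<phi>.
          (U, \<phi>) \<in> atlas M}"

definition tangent_space_manifold :: "'a manifold \<Rightarrow> 'a \<Rightarrow> 'a tangent manifold" where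
  "tangent_space_manifold M p =
     manifold_of_charts (tangent_space M p) (mdim M)
       {(tangent_space M p, \<lambda>v\<in>tangent_space M p. snd v c) | c. c \<in> charts_at M p}"


section \<open>Vector bundles\<close>

record ('e, 'x) vbundle =
  total :: "'e manifold"
  proj :: "'e \<Rightarrow> 'x"
  vadd :: "'e \<Rightarrow> 'e \<Rightarrow> 'e"
  vscale :: "real \<Rightarrow> 'e \<Rightarrow> 'e"

abbreviation tcarrier :: "('e, 'x) vbundle \<Rightarrow> 'e set" where
  "tcarrier E \<equiv> mcarrier (total E)"

text \<open>The operations are made \<^const>\<open>undefined\<close> where they have no meaning, so that equal bundles are equal records.\<close>

definition make_bundle ::
    "'e manifold \<Rightarrow> ('e \<Rightarrow> 'x) \<Rightarrow> ('e \<Rightarrow> 'e \<Rightarrow> 'e) \<Rightarrow> (real \<Rightarrow> 'e \<Rightarrow> 'e) \<Rightarrow> ('e, 'x) vbundle" where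
  "make_bundle M \<pi> a s =
     \<lparr>total = M,
      proj = restrict \<pi> (mcarrier M),
      vadd = (\<lambda>e e'. if e \<in> mcarrier M \<and> e' \<in> mcarrier M \<and> \<pi> e = \<pi> e' then a e e' else undefined),
      vscale = (\<lambda>r. restrict (s r) (mcarrier M))\<rparr>"

definition fibrewise_linear :: "('e, 'x) vbundle \<Rightarrow> ('f, 'y) vbundle \<Rightarrow> ('e \<Rightarrow> 'f) \<Rightarrow> bool" where
  "fibrewise_linear E F \<psi> \<longleftrightarrow>
     (\<forall>e\<in>tcarrier E. \<forall>e'\<in>tcarrier E. proj E e = proj E e' \<longrightarrow>
        \<psi> (vadd E e e') = vadd F (\<psi> e) (\<psi> e')) \<and>
     (\<forall>r. \<forall>e\<in>tcarrier E. \<psi> (vscale E r e) = vscale F r (\<psi> e))"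

definition local_trivialization ::
    "'x manifold \<Rightarrow> ('e, 'x) vbundle \<Rightarrow> nat \<Rightarrow> 'x set \<Rightarrow> ('e \<Rightarrow> 'x \<times> (nat \<Rightarrow> real)) \<Rightarrow> bool" where
  "local_trivialization X E r U \<Phi> \<longleftrightarrow>
     (let P = {e \<in> tcarrier E. proj E e \<in> U} in
        diffeomorphism (open_submanifold (total E) P)
          (prod_manifold (open_submanifold X U) (euclid_manifold r)) \<Phi> \<and>
        (\<forall>e\<in>P. fst (\<Phi> e) = proj E e) \<and>
        (\<forall>e\<in>P. \<forall>e'\<in>P. proj E e = proj E e' \<longrightarrow>
           vadd E e e' \<in> P \<and> \<Phi> (vadd E e e') = (proj E e, \<lambda>i. snd (\<Phi> e) i + snd (\<Phi> e') i)) \<and>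
        (\<forall>s. \<forall>e\<in>P.
           vscale E s e \<in> P \<and> \<Phi> (vscale E s e) = (proj E e, \<lambda>i. s * snd (\<Phi> e) i)))"

text \<open>
  The vector space axioms for the operations on the fibres need not be listed: a local
  trivialization restricts to a bijection of each fibre with a Euclidean space that carries the
  operations to the usual ones.
\<close>

definition vector_bundle :: "'x manifold \<Rightarrow> ('e, 'x) vbundle \<Rightarrow> bool" where
  "vector_bundle X E \<longleftrightarrow>
     smooth_manifold X \<and> smooth_manifold (total E) \<and> smooth_map (total E) X (proj E) \<and>
     E = make_bundle (total E) (proj E) (vadd E) (vscale E) \<and>
     (\<exists>r. \<forall>x\<in>mcarrier X. \<exists>U \<Phi>. x \<in> U \<and> openin (mtop X) U \<and> local_trivialization X E r U \<Phi>)"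

definition bundle_map_over ::
    "('x \<Rightarrow> 'y) \<Rightarrow> ('e, 'x) vbundle \<Rightarrow> ('f, 'y) vbundle \<Rightarrow> ('e \<Rightarrow> 'f) \<Rightarrow> bool" where
  "bundle_map_over f E F \<psi> \<longleftrightarrow>
     smooth_map (total E) (total F) \<psi> \<and>
     (\<forall>e\<in>tcarrier E. proj F (\<psi> e) = f (proj E e)) \<and>
     fibrewise_linear E F \<psi>"

definition bundle_hom :: "('e, 'x) vbundle \<Rightarrow> ('f, 'x) vbundle \<Rightarrow> ('e \<Rightarrow> 'f) set" where
  "bundle_hom E F = {\<psi> \<in> extensional (tcarrier E). bundle_map_over id E F \<psi>}"

definition tangent_bundle :: "'a manifold \<Rightarrow> ('a tangent, 'a) vbundle" where
  "tangent_bundle M = make_bundle (tangent_manifold M) fst (tangent_add M) (tangent_scale M)"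

text \<open>The vector bundle over the product of the bases whose fibre over \<open>(x, y)\<close> is the direct sum of the fibres.\<close>

definition external_sum :: "('e, 'x) vbundle \<Rightarrow> ('f, 'y) vbundle \<Rightarrow> ('e \<times> 'f, 'x \<times> 'y) vbundle" where
  "external_sum E F = make_bundle (prod_manifold (total E) (total F))
     (\<lambda>(e, f). (proj E e, proj F f))
     (\<lambda>(e, f) (e', f'). (vadd E e e', vadd F f f'))
     (\<lambda>r (e, f). (vscale E r e, vscale F r f))"

definition image_bundle :: "('e \<Rightarrow> 'f) \<Rightarrow> ('e, 'x) vbundle \<Rightarrow> ('f, 'x) vbundle" where
  "image_bundle \<iota> E = (let \<kappa> = inv_into (tcarrier E) \<iota> in
     make_bundle (image_manifold \<iota> (total E))
       (\<lambda>y. proj E (\<kappa> y))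
       (\<lambda>y y'. \<iota> (vadd E (\<kappa> y) (\<kappa> y')))
       (\<lambda>r y. \<iota> (vscale E r (\<kappa> y))))"

definition sections :: "'x manifold \<Rightarrow> ('e, 'x) vbundle \<Rightarrow> ('x \<Rightarrow> 'e) set" where
  "sections X E = {\<xi> \<in> extensional (mcarrier X).
     smooth_map X (total E) \<xi> \<and> (\<forall>x\<in>mcarrier X. proj E (\<xi> x) = x)}"

definition section_add :: "'x manifold \<Rightarrow> ('e, 'x) vbundle \<Rightarrow> ('x \<Rightarrow> 'e) \<Rightarrow> ('x \<Rightarrow> 'e) \<Rightarrow> 'x \<Rightarrow> 'e" where
  "section_add X E \<xi> \<eta> = (\<lambda>x\<in>mcarrier X. vadd E (\<xi> x) (\<eta> x))"

definition section_scale :: "'x manifold \<Rightarrow> ('e, 'x) vbundle \<Rightarrow> real \<Rightarrow> ('x \<Rightarrow> 'e) \<Rightarrow> 'x \<Rightarrow> 'e" where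
  "section_scale X E r \<xi> = (\<lambda>x\<in>mcarrier X. vscale E r (\<xi> x))"

definition section_map :: "'x manifold \<Rightarrow> ('e \<Rightarrow> 'f) \<Rightarrow> ('x \<Rightarrow> 'e) \<Rightarrow> 'x \<Rightarrow> 'f" where
  "section_map X \<psi> \<xi> = (\<lambda>x\<in>mcarrier X. \<psi> (\<xi> x))"


section \<open>Lie groups and their actions\<close>

record 'g lie_group = "'g monoid" +
  mfd :: "'g manifold"

definition is_lie_group :: "'g lie_group \<Rightarrow> bool" where
  "is_lie_group G \<longleftrightarrow>
     group G \<and> smooth_manifold (mfd G) \<and> carrier G = mcarrier (mfd G) \<and>
     smooth_map (prod_manifold (mfd G) (mfd G)) (mfd G) (\<lambda>(g, h). g \<otimes>\<^bsub>G\<^esub> h) \<and>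
     smooth_map (mfd G) (mfd G) (\<lambda>g. inv\<^bsub>G\<^esub> g)"

definition lie_action :: "'g lie_group \<Rightarrow> 'y manifold \<Rightarrow> ('g \<times> 'y \<Rightarrow> 'y) \<Rightarrow> bool" where
  "lie_action G Y a \<longleftrightarrow>
     smooth_map (prod_manifold (mfd G) Y) Y a \<and>
     (\<forall>y\<in>mcarrier Y. a (\<one>\<^bsub>G\<^esub>, y) = y) \<and>
     (\<forall>g\<in>carrier G. \<forall>h\<in>carrier G. \<forall>y\<in>mcarrier Y. a (g, a (h, y)) = a (g \<otimes>\<^bsub>G\<^esub> h, y))"

abbreviation lie_algebra :: "'g lie_group \<Rightarrow> 'g tangent set" where
  "lie_algebra G \<equiv> tangent_space (mfd G) \<one>\<^bsub>G\<^esub>"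

definition Ad :: "'g lie_group \<Rightarrow> 'g \<Rightarrow> 'g tangent \<Rightarrow> 'g tangent" where
  "Ad G g = pushforward (mfd G) (mfd G) (\<lambda>h. g \<otimes>\<^bsub>G\<^esub> h \<otimes>\<^bsub>G\<^esub> inv\<^bsub>G\<^esub> g)"

definition tangent_mult :: "'g lie_group \<Rightarrow> 'g tangent \<Rightarrow> 'g tangent \<Rightarrow> 'g tangent" where
  "tangent_mult G v w =
     tangent_add (mfd G)
       (pushforward (mfd G) (mfd G) (\<lambda>h. fst v \<otimes>\<^bsub>G\<^esub> h) w)
       (pushforward (mfd G) (mfd G) (\<lambda>g. g \<otimes>\<^bsub>G\<^esub> fst w) v)"

definition tangent_group :: "'g lie_group \<Rightarrow> 'g tangent lie_group" where
  "tangent_group G =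
     \<lparr>carrier = mcarrier (tangent_manifold (mfd G)),
      mult = tangent_mult G,
      one = tangent_zero (mfd G) \<one>\<^bsub>G\<^esub>,
      mfd = tangent_manifold (mfd G)\<rparr>"


section \<open>Categories\<close>

text \<open>
  Since morphisms are represented by functions, identities and composition take the objects
  involved as arguments: \<open>Comp C a b c\<close> maps \<open>g\<close> in \<open>Hom C b c\<close> and \<open>f\<close> in
  \<open>Hom C a b\<close> to their composite.
\<close>

record ('o, 'm) category =
  Obj :: "'o set"
  Hom :: "'o \<Rightarrow> 'o \<Rightarrow> 'm set"
  Ident :: "'o \<Rightarrow> 'm"
  Comp :: "'o \<Rightarrow> 'o \<Rightarrow> 'o \<Rightarrow> 'm \<Rightarrow> 'm \<Rightarrow> 'm"

definition is_category :: "('o, 'm) category \<Rightarrow> bool" where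
  "is_category C \<longleftrightarrow>
     (\<forall>a\<in>Obj C. Ident C a \<in> Hom C a a) \<and>
     (\<forall>a\<in>Obj C. \<forall>b\<in>Obj C. \<forall>c\<in>Obj C. \<forall>f\<in>Hom C a b. \<forall>g\<in>Hom C b c.
        Comp C a b c g f \<in> Hom C a c) \<and>
     (\<forall>a\<in>Obj C. \<forall>b\<in>Obj C. \<forall>f\<in>Hom C a b.
        Comp C a a b f (Ident C a) = f \<and> Comp C a b b (Ident C b) f = f) \<and>
     (\<forall>a\<in>Obj C. \<forall>b\<in>Obj C. \<forall>c\<in>Obj C. \<forall>d\<in>Obj C.
        \<forall>f\<in>Hom C a b. \<forall>g\<in>Hom C b c. \<forall>h\<in>Hom C c d.
          Comp C a c d h (Comp C a b c g f) = Comp C a b d (Comp C b c d h g) f)"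

definition is_functor ::
    "('o, 'm) category \<Rightarrow> ('p, 'n) category \<Rightarrow> ('o \<Rightarrow> 'p) \<Rightarrow> ('o \<Rightarrow> 'o \<Rightarrow> 'm \<Rightarrow> 'n) \<Rightarrow> bool" where
  "is_functor C D F\<^sub>0 F\<^sub>1 \<longleftrightarrow>
     (\<forall>a\<in>Obj C. F\<^sub>0 a \<in> Obj D) \<and>
     (\<forall>a\<in>Obj C. \<forall>b\<in>Obj C. \<forall>f\<in>Hom C a b. F\<^sub>1 a b f \<in> Hom D (F\<^sub>0 a) (F\<^sub>0 b)) \<and>
     (\<forall>a\<in>Obj C. F\<^sub>1 a a (Ident C a) = Ident D (F\<^sub>0 a)) \<and>
     (\<forall>a\<in>Obj C. \<forall>b\<in>Obj C. \<forall>c\<in>Obj C. \<forall>f\<in>Hom C a b. \<forall>g\<in>Hom C b c.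
        F\<^sub>1 a c (Comp C a b c g f) = Comp D (F\<^sub>0 a) (F\<^sub>0 b) (F\<^sub>0 c) (F\<^sub>1 b c g) (F\<^sub>1 a b f))"

definition inverse_to ::
    "('o, 'm) category \<Rightarrow> ('o \<Rightarrow> 'p) \<Rightarrow> ('o \<Rightarrow> 'o \<Rightarrow> 'm \<Rightarrow> 'n) \<Rightarrow>
      ('p \<Rightarrow> 'o) \<Rightarrow> ('p \<Rightarrow> 'p \<Rightarrow> 'n \<Rightarrow> 'm) \<Rightarrow> bool" where
  "inverse_to C F\<^sub>0 F\<^sub>1 K\<^sub>0 K\<^sub>1 \<longleftrightarrow>
     (\<forall>a\<in>Obj C. K\<^sub>0 (F\<^sub>0 a) = a) \<and>
     (\<forall>a\<in>Obj C. \<forall>b\<in>Obj C. \<forall>f\<in>Hom C a b. K\<^sub>1 (F\<^sub>0 a) (F\<^sub>0 b) (F\<^sub>1 a b f) = f)"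

definition isomorphic_categories :: "('o, 'm) category \<Rightarrow> ('p, 'n) category \<Rightarrow> bool" where
  "isomorphic_categories C D \<longleftrightarrow>
     (\<exists>F\<^sub>0 F\<^sub>1 K\<^sub>0 K\<^sub>1. is_functor C D F\<^sub>0 F\<^sub>1 \<and> is_functor D C K\<^sub>0 K\<^sub>1 \<and>
        inverse_to C F\<^sub>0 F\<^sub>1 K\<^sub>0 K\<^sub>1 \<and> inverse_to D K\<^sub>0 K\<^sub>1 F\<^sub>0 F\<^sub>1)"

definition slice_category :: "'o \<Rightarrow> ('o, 'm) category \<Rightarrow> ('o \<times> 'm, 'm) category" where
  "slice_category m C =
     \<lparr>Obj = {(a, f). a \<in> Obj C \<and> f \<in> Hom C m a},
      Hom = (\<lambda>(a, f) (a', f'). {\<theta> \<in> Hom C a a'. Comp C m a a' \<theta> f = f'}),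
      Ident = (\<lambda>(a, f). Ident C a),
      Comp = (\<lambda>(a, _) (b, _) (c, _). Comp C a b c)\<rparr>"


section \<open>The three categories\<close>

type_synonym ('g, 'e, 'x) equivariant_bundle = "('e, 'x) vbundle \<times> ('g \<times> 'e \<Rightarrow> 'e)"

definition equivariant_bundle ::
    "'g lie_group \<Rightarrow> 'x manifold \<Rightarrow> ('g \<times> 'x \<Rightarrow> 'x) \<Rightarrow> ('g, 'e, 'x) equivariant_bundle \<Rightarrow> bool" where
  "equivariant_bundle G X t A \<longleftrightarrow> (case A of (E, a) \<Rightarrow>
     vector_bundle X E \<and>
     a \<in> extensional (carrier G \<times> tcarrier E) \<and>
     lie_action G (total E) a \<and>
     (\<forall>g\<in>carrier G. \<forall>e\<in>tcarrier E. proj E (a (g, e)) = t (g, proj E e)) \<and>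
     (\<forall>g\<in>carrier G. fibrewise_linear E E (\<lambda>e. a (g, e))))"

definition Vect ::
    "'g lie_group \<Rightarrow> 'x manifold \<Rightarrow> ('g \<times> 'x \<Rightarrow> 'x) \<Rightarrow>
      (('g, 'e, 'x) equivariant_bundle, 'e \<Rightarrow> 'e) category" where
  "Vect G X t =
     \<lparr>Obj = {A. equivariant_bundle G X t A},
      Hom = (\<lambda>(E, a) (E', a'). {\<psi> \<in> bundle_hom E E'.
               \<forall>g\<in>carrier G. \<forall>e\<in>tcarrier E. \<psi> (a (g, e)) = a' (g, \<psi> e)}),
      Ident = (\<lambda>(E, a). \<lambda>e\<in>tcarrier E. e),
      Comp = (\<lambda>(E, _) _ _ \<theta> \<psi>. compose (tcarrier E) \<theta> \<psi>)\<rparr>"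

definition affine_action ::
    "'g lie_group \<Rightarrow> 'x manifold \<Rightarrow> ('g \<times> 'x \<Rightarrow> 'x) \<Rightarrow>
      ('g tangent, 'e, 'x) equivariant_bundle \<Rightarrow> bool" where
  "affine_action G X t A \<longleftrightarrow> (case A of (E, \<mu>) \<Rightarrow>
     vector_bundle X E \<and>
     \<mu> \<in> extensional (carrier (tangent_group G) \<times> tcarrier E) \<and>
     lie_action (tangent_group G) (total E) \<mu> \<and>
     bundle_map_over t (external_sum (tangent_bundle (mfd G)) E) E \<mu>)"

definition Vect_aff ::
    "'g lie_group \<Rightarrow> 'x manifold \<Rightarrow> ('g \<times> 'x \<Rightarrow> 'x) \<Rightarrow>
      (('g tangent, 'e, 'x) equivariant_bundle, 'e \<Rightarrow> 'e) category" where
  "Vect_aff G X t =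
     \<lparr>Obj = {A. affine_action G X t A},
      Hom = (\<lambda>(E, \<mu>) (E', \<mu>'). {\<psi> \<in> bundle_hom E E'.
               \<forall>v\<in>carrier (tangent_group G). \<forall>e\<in>tcarrier E. \<psi> (\<mu> (v, e)) = \<mu>' (v, \<psi> e)}),
      Ident = (\<lambda>(E, \<mu>). \<lambda>e\<in>tcarrier E. e),
      Comp = (\<lambda>(E, _) _ _ \<theta> \<psi>. compose (tcarrier E) \<theta> \<psi>)\<rparr>"

definition section_action ::
    "'g lie_group \<Rightarrow> 'x manifold \<Rightarrow> ('g \<times> 'x \<Rightarrow> 'x) \<Rightarrow> ('g \<times> 'e \<Rightarrow> 'e) \<Rightarrow>
      'g \<Rightarrow> ('x \<Rightarrow> 'e) \<Rightarrow> 'x \<Rightarrow> 'e" where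
  "section_action G X t a g \<xi> = (\<lambda>x\<in>mcarrier X. a (g, \<xi> (t (inv\<^bsub>G\<^esub> g, x))))"

definition equivariant_linear ::
    "'g lie_group \<Rightarrow> 'x manifold \<Rightarrow> ('g \<times> 'x \<Rightarrow> 'x) \<Rightarrow> ('g, 'e, 'x) equivariant_bundle \<Rightarrow>
      ('g tangent \<Rightarrow> 'x \<Rightarrow> 'e) \<Rightarrow> bool" where
  "equivariant_linear G X t A \<rho> \<longleftrightarrow> (case A of (E, a) \<Rightarrow>
     \<rho> \<in> lie_algebra G \<rightarrow>\<^sub>E sections X E \<and>
     (\<forall>\<alpha>\<in>lie_algebra G. \<forall>\<beta>\<in>lie_algebra G.
        \<rho> (tangent_add (mfd G) \<alpha> \<beta>) = section_add X E (\<rho> \<alpha>) (\<rho> \<beta>)) \<and>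
     (\<forall>r. \<forall>\<alpha>\<in>lie_algebra G. \<rho> (tangent_scale (mfd G) r \<alpha>) = section_scale X E r (\<rho> \<alpha>)) \<and>
     (\<forall>g\<in>carrier G. \<forall>\<alpha>\<in>lie_algebra G. \<rho> (Ad G g \<alpha>) = section_action G X t a g (\<rho> \<alpha>)))"

definition Vect_pairs ::
    "'g lie_group \<Rightarrow> 'x manifold \<Rightarrow> ('g \<times> 'x \<Rightarrow> 'x) \<Rightarrow>
      (('g, 'e, 'x) equivariant_bundle \<times> ('g tangent \<Rightarrow> 'x \<Rightarrow> 'e), 'e \<Rightarrow> 'e) category" where
  "Vect_pairs G X t =
     \<lparr>Obj = {(A, \<rho>). A \<in> Obj (Vect G X t) \<and> equivariant_linear G X t A \<rho>},
      Hom = (\<lambda>(A, \<rho>) (A', \<rho>'). {\<psi> \<in> Hom (Vect G X t) A A'.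
               compose (lie_algebra G) (section_map X \<psi>) \<rho> = \<rho>'}),
      Ident = (\<lambda>(A, \<rho>). Ident (Vect G X t) A),
      Comp = (\<lambda>(A, _) (B, _) (C, _). Comp (Vect G X t) A B C)\<rparr>"

definition adjoint_bundle ::
    "'g lie_group \<Rightarrow> 'x manifold \<Rightarrow> ('g \<times> 'x \<Rightarrow> 'x) \<Rightarrow>
      ('g, 'x \<times> 'g tangent, 'x) equivariant_bundle" where
  "adjoint_bundle G X t =
     (let M = prod_manifold X (tangent_space_manifold (mfd G) \<one>\<^bsub>G\<^esub>) in
       (make_bundle M fst
          (\<lambda>(x, \<alpha>) (_, \<beta>). (x, tangent_add (mfd G) \<alpha> \<beta>))
          (\<lambda>r (x, \<alpha>). (x, tangent_scale (mfd G) r \<alpha>)),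
        \<lambda>(g, x, \<alpha>)\<in>carrier G \<times> mcarrier M. (t (g, x), Ad G g \<alpha>)))"

text \<open>
  The total spaces of the objects of \<^const>\<open>Vect\<close> are subsets of one type \<open>'e\<close>. To serve as an
  object, the trivial bundle \<^const>\<open>adjoint_bundle\<close> is copied into \<open>'e\<close> along an injection.
\<close>

definition image_equivariant_bundle ::
    "('e \<Rightarrow> 'f) \<Rightarrow> 'g lie_group \<Rightarrow> ('g, 'e, 'x) equivariant_bundle \<Rightarrow> ('g, 'f, 'x) equivariant_bundle" where
  "image_equivariant_bundle \<iota> G A = (case A of (E, a) \<Rightarrow>
     (image_bundle \<iota> E,
      \<lambda>(g, y)\<in>carrier G \<times> \<iota> ` tcarrier E. \<iota> (a (g, inv_into (tcarrier E) \<iota> y))))"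

end

theory Submission
  imports Defs
begin

text \<open>
  An affine action \<open>\<mu>\<close> is linear on the sum \<open>T\<^sub>gG \<oplus> E\<^sub>x\<close>, so \<open>\<mu>(v, e) = \<mu>(0\<^sub>g, e) + \<mu>(v, 0\<^sub>x)\<close>. The first
  summand is an action \<open>a\<close> of \<open>G\<close>. Since \<open>v = (v g\<^sup>-\<^sup>1) \<bullet> 0\<^sub>g\<close>, the second one is the value at \<open>g x\<close> of the
  section \<open>\<rho>(v g\<^sup>-\<^sup>1)\<close>, where \<open>\<rho>(\<alpha>)(x) = \<mu>(\<alpha>, 0\<^sub>x)\<close> for \<open>\<alpha>\<close> in the Lie algebra. Conversely
  \<open>a(g, e) + \<rho>(v g\<^sup>-\<^sup>1)(g x)\<close> is an action because \<open>(v \<bullet> w) (g h)\<^sup>-\<^sup>1 = v g\<^sup>-\<^sup>1 + Ad\<^sub>g (w h\<^sup>-\<^sup>1)\<close> and \<open>\<rho>\<close> is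
  equivariant; it is smooth because in a basis of the Lie algebra \<open>\<rho>\<close> is given by finitely many
  sections. The same remark turns \<open>\<rho>\<close> into a bundle map \<open>(x, \<alpha>) \<mapsto> \<rho>(\<alpha>)(x)\<close>. All functors
  are the identity on morphisms.
\<close>

subsection \<open>Calculus on open subsets of Euclidean spaces\<close>

text \<open>Equivariance of \<open>\<rho>\<close> comes from evaluating
  \<open>0\<^sub>g \<bullet> \<alpha>\<close> on a zero vector in two ways. Its right trivialization
  is \<open>Ad\<^sub>g \<alpha>\<close>, so it equals
  \<open>(Ad\<^sub>g \<alpha>) \<bullet> 0\<^sub>g\<close>. Joint linearity forces
  \<open>\<mu>(0\<^sub>g, 0\<^sub>x)\<close> to be the zero vector over g x; hence one reading gives
  \<open>\<rho>(Ad\<^sub>g \<alpha>)(g x)\<close>, the other g applied to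
  \<open>\<rho>(\<alpha>)(x)\<close>. The categories are isomorphic and not merely equivalent
  because the underlying bundle is kept and the structures correspond by an equality of functions.
  Actions, sections and families are \<open>extensional\<close>, so agreement on the domain is
  equality. The category laws are checked for affine actions and carried to the other two along
  equal Hom sets. The analytic obstacle is the dependence on the base point:
  \<open>v g\<^sup>-\<^sup>1\<close> is the derivative of a translation that itself varies with the
  foot g of v, so smoothness in v is not that of a single pushforward.\<close>

lemma openin_Euclidean_space_box:
  assumes "openin (Euclidean_space n) U" "x \<in> U"
  obtains d where "d > 0"
    "\<And>y. y \<in> topspace (Euclidean_space n) \<Longrightarrow> (\<And>i. i < n \<Longrightarrow> \<bar>y i - x i\<bar> < d) \<Longrightarrow> y \<in> U"
proof -
  obtain W where W: "openin (powertop_real UNIV) W" and U: "U = W \<inter> {x. \<forall>i\<ge>n. x i = 0}"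
    using assms(1) unfolding Euclidean_space_def openin_subtopology by blast
  have "x \<in> W"
    using assms(2) U by blast
  then obtain B where B: "finite {i. B i \<noteq> (UNIV :: real set)}" "\<And>i. open (B i)"
      "x \<in> Pi\<^sub>E UNIV B" "Pi\<^sub>E UNIV B \<subseteq> W"
    using W by (simp add: openin_product_topology_alt) metis
  have "\<exists>r>0. \<forall>y. \<bar>y - x i\<bar> < r \<longrightarrow> y \<in> B i" for i
  proof -
    have "x i \<in> B i"
      using B(3) by (simp add: PiE_iff)
    then show ?thesis
      using B(2)[of i] by (fastforce simp: open_dist dist_real_def)
  qed
  then obtain r where r: "\<And>i. r i > 0" "\<And>i y. \<bar>y - x i\<bar> < r i \<Longrightarrow> y \<in> B i"
    by metis
  \<comment> \<open>Radii for the first n coordinates are enough, since x and y both vanish from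
    index n on. The extra 1 keeps the set under \<open>Min\<close> nonempty when n = 0.\<close>
  define d where "d = Min (insert 1 (r ` {..<n}))"
  have "d > 0" and dr: "\<And>i. i < n \<Longrightarrow> d \<le> r i"
    using r(1) by (auto simp: d_def)
  moreover have "y \<in> U" if y: "y \<in> topspace (Euclidean_space n)" "\<And>i. i < n \<Longrightarrow> \<bar>y i - x i\<bar> < d" for y
  proof -
    have "y i \<in> B i" for i
    proof (cases "i < n")
      case True
      then show ?thesis
        using r(2) y(2) dr by force
    next
      case False
      then have "y i = x i"
        using y(1) assms U by (auto simp: topspace_Euclidean_space)
      then show ?thesis
        using B(3) by (simp add: PiE_iff)
    qed
    then show ?thesis
      using B(4) y(1) U by (auto simp: topspace_Euclidean_space)
  qed
  ultimately show ?thesis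
    using that by blast
qed

lemma fun_upd_in_Euclidean_space:
  "x \<in> topspace (Euclidean_space n) \<Longrightarrow> i < n \<Longrightarrow> x(i := s) \<in> topspace (Euclidean_space n)"
  by (auto simp: topspace_Euclidean_space)

text \<open>\<open>partial i f x\<close> only looks at f along \<open>x(i := s)\<close> for s near
  \<open>x i\<close>. That this short line stays inside an open U is what makes partial derivatives
  local.\<close>

lemma eventually_fun_upd_in_open:
  assumes "openin (Euclidean_space n) U" "x \<in> U" "i < n"
  shows "eventually (\<lambda>s. x(i := s) \<in> U) (nhds (x i))"
proof -
  obtain d where d: "d > 0"
      "\<And>y. y \<in> topspace (Euclidean_space n) \<Longrightarrow> (\<And>i. i < n \<Longrightarrow> \<bar>y i - x i\<bar> < d) \<Longrightarrow> y \<in> U"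
    using openin_Euclidean_space_box[OF assms(1,2)] by metis
  have "x \<in> topspace (Euclidean_space n)"
    using assms openin_subset by blast
  then have "x(i := s) \<in> U" if "dist s (x i) < d" for s
    using that assms(3) d(1) by (intro d(2) fun_upd_in_Euclidean_space) (auto simp: dist_real_def)
  then show ?thesis
    using d(1) eventually_nhds_metric by blast
qed

lemma partial_cong:
  assumes "openin (Euclidean_space n) U" "x \<in> U" "i < n" "\<And>y. y \<in> U \<Longrightarrow> f y = g y"
  shows "partial i f x = partial i g x"
  unfolding partial_def
  using eventually_fun_upd_in_open[OF assms(1-3)]
  by (intro deriv_cong_ev) (auto elim: eventually_mono simp: assms(4))

lemma has_partial_cong:
  assumes "openin (Euclidean_space n) U" "x \<in> U" "i < n" "\<And>y. y \<in> U \<Longrightarrow> f y = g y"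
  shows "((\<lambda>s. f (x(i := s))) has_real_derivative D) (at (x i)) \<longleftrightarrow>
         ((\<lambda>s. g (x(i := s))) has_real_derivative D) (at (x i))"
proof (rule DERIV_cong_ev)
  show "eventually (\<lambda>s. f (x(i := s)) = g (x(i := s))) (nhds (x i))"
    using eventually_fun_upd_in_open[OF assms(1-3)] by (rule eventually_mono) (simp add: assms(4))
qed auto

section \<open>Classes C^k: locality, sums and products\<close>

lemma Ck_cong:
  assumes "openin (Euclidean_space n) U" "\<And>y. y \<in> U \<Longrightarrow> f y = g y" "Ck n U k f"
  shows "Ck n U k g"
  using assms(2,3)
proof (induction k arbitrary: f g)
  case 0
  then show ?case
    by (auto intro: continuous_map_eq)
next
  case (Suc k)
  have "continuous_map (subtopology (Euclidean_space n) U) euclideanreal g"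
    using Suc.prems by (auto intro: continuous_map_eq)
  moreover have "((\<lambda>s. g (x(i := s))) has_real_derivative partial i g x) (at (x i))"
    if "i < n" "x \<in> U" for i x
  proof -
    have "((\<lambda>s. f (x(i := s))) has_real_derivative partial i f x) (at (x i))"
      using Suc.prems(2) that unfolding Ck.simps by blast
    moreover have "partial i f x = partial i g x"
      by (rule partial_cong[OF assms(1) that(2,1)]) (rule Suc.prems(1))
    ultimately show ?thesis
      using has_partial_cong[OF assms(1) that(2,1), of f g "partial i f x"] Suc.prems(1)
      by (simp del: fun_upd_apply)
  qed
  \<comment> \<open>Off U the partial derivatives of f and g may differ, so they are not rewritten
    into each other; the induction hypothesis is applied to this new pair of functions.\<close>
  moreover have "Ck n U k (partial i g)" if "i < n" for i
  proof (rule Suc.IH[of "partial i f"])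
    show "partial i f y = partial i g y" if "y \<in> U" for y
      by (rule partial_cong[OF assms(1) that \<open>i < n\<close>]) (rule Suc.prems(1))
    show "Ck n U k (partial i f)"
      using Suc.prems(2) that by simp
  qed
  ultimately show ?case
    by simp
qed

lemma Ck_SucD: "Ck n U (Suc k) f \<Longrightarrow> Ck n U k f"
  by (induction k arbitrary: f) auto

lemma Ck_continuous: "Ck n U k f \<Longrightarrow> continuous_map (subtopology (Euclidean_space n) U) euclideanreal f"
  by (cases k) auto

lemma Ck_subset: "Ck n U k f \<Longrightarrow> V \<subseteq> U \<Longrightarrow> Ck n V k f"
proof (induction k arbitrary: f)
  case (Suc k)
  then show ?case
    by (auto intro: continuous_map_from_subtopology_mono)
qed (auto intro: continuous_map_from_subtopology_mono)

text \<open>The conditions on derivatives are pointwise, so at each order only continuity has to be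
  glued from the pieces.\<close>

lemma Ck_local:
  assumes "\<And>x. x \<in> U \<Longrightarrow> \<exists>W. openin (Euclidean_space n) W \<and> x \<in> W \<and> Ck n W k f"
  shows "Ck n U k f"
  using assms
proof (induction k arbitrary: f)
  have cont: "continuous_map (subtopology (Euclidean_space n) U) euclideanreal f"
    if *: "\<And>x. x \<in> U \<Longrightarrow> \<exists>W. openin (Euclidean_space n) W \<and> x \<in> W \<and> Ck n W k f" for k f
  \<comment> \<open>The pieces are indexed by the open sets themselves and all carry the same
    function.\<close>
  proof (rule pasting_lemma[where f = "\<lambda>_. f" and T = "\<lambda>W. U \<inter> W"
        and I = "{W. openin (Euclidean_space n) W \<and> Ck n W k f}"])
    fix W assume W: "W \<in> {W. openin (Euclidean_space n) W \<and> Ck n W k f}"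
    then show "openin (subtopology (Euclidean_space n) U) (U \<inter> W)"
      by (auto simp: openin_subtopology)
    show "continuous_map (subtopology (subtopology (Euclidean_space n) U) (U \<inter> W)) euclideanreal f"
      unfolding subtopology_subtopology
      by (rule continuous_map_from_subtopology_mono[of _ W]) (use W in \<open>auto intro: Ck_continuous\<close>)
  next
    fix x assume "x \<in> topspace (subtopology (Euclidean_space n) U)"
    then show "\<exists>W. W \<in> {W. openin (Euclidean_space n) W \<and> Ck n W k f} \<and> x \<in> U \<inter> W \<and> f x = f x"
      using * by auto
  qed auto
  {
    case 0
    then show ?case
      using cont[OF 0] by simp
  next
    case (Suc k)
    have "((\<lambda>s. f (x(i := s))) has_real_derivative partial i f x) (at (x i))" if "i < n" "x \<in> U" for i x
      using Suc.prems[OF that(2)] that(1) unfolding Ck.simps by blast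
    moreover have "Ck n U k (partial i f)" if "i < n" for i
    proof (rule Suc.IH)
      show "\<exists>W. openin (Euclidean_space n) W \<and> x \<in> W \<and> Ck n W k (partial i f)" if "x \<in> U" for x
        using Suc.prems[OF that] \<open>i < n\<close> unfolding Ck.simps by blast
    qed
    ultimately show ?case
      using cont[OF Suc.prems] unfolding Ck.simps by blast
  }
qed

lemma Ck_const: "Ck n U k (\<lambda>x. c)"
proof (induction k arbitrary: c)
  case (Suc k)
  have "partial i (\<lambda>x. c) = (\<lambda>x. 0)" for i
    by (simp add: partial_def fun_eq_iff)
  then show ?case
    using Suc by simp
qed simp

lemma continuous_map_Euclidean_coordinate:
  "continuous_map (subtopology (Euclidean_space n) U) euclideanreal (\<lambda>x. x j)"
  unfolding Euclidean_space_def
  by (intro continuous_map_from_subtopology continuous_map_product_coordinates) auto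

lemma Ck_coordinate: "Ck n U k (\<lambda>x. x j)"
proof (cases k)
  case 0
  then show ?thesis
    by (simp add: continuous_map_Euclidean_coordinate)
next
  case (Suc k')
  have D: "((\<lambda>s. (x(i := s)) j) has_real_derivative (if i = j then 1 else 0)) (at (x i))" for i and x :: "nat \<Rightarrow> real"
    by (auto intro!: derivative_eq_intros)
  then have "partial i (\<lambda>x. x j) = (\<lambda>x. if i = j then 1 else 0)" for i
    unfolding partial_def by (intro ext DERIV_imp_deriv)
  then show ?thesis
    using Suc D by (simp add: Ck_const continuous_map_Euclidean_coordinate del: fun_upd_apply)
qed

lemma Ck_add:
  assumes "openin (Euclidean_space n) U" "Ck n U k f" "Ck n U k g"
  shows "Ck n U k (\<lambda>x. f x + g x)"
  using assms(2,3)
proof (induction k arbitrary: f g)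
  case 0
  then show ?case
    by (auto intro: continuous_intros)
next
  case (Suc k)
  have D: "((\<lambda>s. f (x(i := s)) + g (x(i := s))) has_real_derivative partial i f x + partial i g x) (at (x i))"
    if "i < n" "x \<in> U" for i x
    using Suc.prems that by (auto intro!: derivative_intros)
  then have eq: "partial i (\<lambda>x. f x + g x) x = partial i f x + partial i g x" if "i < n" "x \<in> U" for i x
    using that by (auto simp: partial_def[of i "\<lambda>x. f x + g x"] intro!: DERIV_imp_deriv)
  have "Ck n U k (partial i (\<lambda>x. f x + g x))" if "i < n" for i
  proof (rule Ck_cong[OF assms(1)])
    show "Ck n U k (\<lambda>x. partial i f x + partial i g x)"
      using Suc.prems that by (intro Suc.IH) auto
  qed (use that eq in auto)
  moreover have "continuous_map (subtopology (Euclidean_space n) U) euclideanreal (\<lambda>x. f x + g x)"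
    using Suc.prems by (intro continuous_map_add) auto
  ultimately show ?case
    using D eq by simp
qed

lemma Ck_mult:
  assumes "openin (Euclidean_space n) U" "Ck n U k f" "Ck n U k g"
  shows "Ck n U k (\<lambda>x. f x * g x)"
  using assms(2,3)
proof (induction k arbitrary: f g)
  case 0
  then show ?case
    by (auto intro: continuous_intros)
next
  case (Suc k)
  have D: "((\<lambda>s. f (x(i := s)) * g (x(i := s))) has_real_derivative
      partial i f x * g x + f x * partial i g x) (at (x i))"
    if "i < n" "x \<in> U" for i x
    using Suc.prems that by (auto intro!: derivative_eq_intros)
  then have eq: "partial i (\<lambda>x. f x * g x) x = partial i f x * g x + f x * partial i g x"
    if "i < n" "x \<in> U" for i x
    using that by (auto simp: partial_def[of i "\<lambda>x. f x * g x"] intro!: DERIV_imp_deriv)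
  have "Ck n U k (partial i (\<lambda>x. f x * g x))" if "i < n" for i
  proof (rule Ck_cong[OF assms(1)])
    \<comment> \<open>The product rule leaves one factor undifferentiated in each summand. That
      factor is known at order k + 1 and is used at order k.\<close>
    show "Ck n U k (\<lambda>x. partial i f x * g x + f x * partial i g x)"
      using Suc.prems that Ck_SucD[OF Suc.prems(1)] Ck_SucD[OF Suc.prems(2)]
      by (intro Ck_add assms(1) Suc.IH) auto
  qed (use that eq in auto)
  moreover have "continuous_map (subtopology (Euclidean_space n) U) euclideanreal (\<lambda>x. f x * g x)"
    using Suc.prems by (intro continuous_map_real_mult) auto
  ultimately show ?case
    using D eq by simp
qed

lemma Ck_sum:
  assumes "openin (Euclidean_space n) U" "finite I" "\<And>i. i \<in> I \<Longrightarrow> Ck n U k (f i)"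
  shows "Ck n U k (\<lambda>x. \<Sum>i\<in>I. f i x)"
  using assms(2,3) by (induction I rule: finite_induct) (auto intro: Ck_const Ck_add assms(1))

text \<open>
  A function with continuous first partial derivatives is differentiable: move from \<open>x\<close> to \<open>y\<close>
  one coordinate at a time and apply the mean value theorem to each step.
\<close>

lemma Ck_linear_approximation:
  assumes U: "openin (Euclidean_space n) U" "x \<in> U" and f: "Ck n U (Suc 0) f" and "e > 0"
  obtains d where "d > 0"
    "\<And>y. y \<in> topspace (Euclidean_space n) \<Longrightarrow> (\<And>i. i < n \<Longrightarrow> \<bar>y i - x i\<bar> < d) \<Longrightarrow>
       \<bar>f y - f x - (\<Sum>i<n. partial i f x * (y i - x i))\<bar> \<le> e * (\<Sum>i<n. \<bar>y i - x i\<bar>)"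
proof -
  let ?E = "Euclidean_space n"
  \<comment> \<open>On V every partial derivative is within e of its value at x. A box inside V is
    therefore a region where the mean value theorem yields the factor e.\<close>
  define V where "V = {y\<in>U. \<forall>i<n. \<bar>partial i f y - partial i f x\<bar> < e}"
  have "openin ?E {y\<in>U. \<bar>partial i f y - partial i f x\<bar> < e}" if "i < n" for i
  proof -
    have "continuous_map (subtopology ?E U) euclideanreal (\<lambda>y. \<bar>partial i f y - partial i f x\<bar>)"
      using f that by (auto intro!: continuous_intros)
    then have "openin (subtopology ?E U) {y \<in> topspace (subtopology ?E U). \<bar>partial i f y - partial i f x\<bar> \<in> {..<e}}"
      by (rule openin_continuous_map_preimage) auto
    moreover have "topspace (subtopology ?E U) = U"
      using openin_subset[OF U(1)] by auto
    ultimately show ?thesis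
      using U(1) by (simp add: openin_open_subtopology del: topspace_subtopology)
  qed
  then have "openin ?E (U \<inter> (\<Inter>i\<in>{..<n}. {y\<in>U. \<bar>partial i f y - partial i f x\<bar> < e}))"
  \<comment> \<open>\<open>openin_INT2\<close> asks for a nonempty index set. Over the empty one the
    intersection is everything, and only U remains.\<close>
  proof (cases "n = 0")
    case False
    then show ?thesis
      using \<open>\<And>i. i < n \<Longrightarrow> openin ?E {y\<in>U. \<bar>partial i f y - partial i f x\<bar> < e}\<close>
      by (intro openin_Int U(1) openin_INT2) auto
  qed (use U(1) in auto)
  also have "U \<inter> (\<Inter>i\<in>{..<n}. {y\<in>U. \<bar>partial i f y - partial i f x\<bar> < e}) = V"
    by (auto simp: V_def)
  finally obtain d where d: "d > 0"
      "\<And>y. y \<in> topspace ?E \<Longrightarrow> (\<And>i. i < n \<Longrightarrow> \<bar>y i - x i\<bar> < d) \<Longrightarrow> y \<in> V"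
    using openin_Euclidean_space_box[of n V x] U(2) \<open>e > 0\<close> by (auto simp: V_def)
  have xE: "x \<in> topspace ?E"
    using U openin_subset by blast
  have "\<bar>f y - f x - (\<Sum>i<n. partial i f x * (y i - x i))\<bar> \<le> e * (\<Sum>i<n. \<bar>y i - x i\<bar>)"
    if y: "y \<in> topspace ?E" "\<And>i. i < n \<Longrightarrow> \<bar>y i - x i\<bar> < d" for y
  proof -
    \<comment> \<open>The corners of the path from x to y: at \<open>z k\<close> the first k
      coordinates have already moved.\<close>
    define z where "z k = (\<lambda>i. if i < k then y i else x i)" for k
    have step: "\<bar>f (z (Suc k)) - f (z k) - partial k f x * (y k - x k)\<bar> \<le> e * \<bar>y k - x k\<bar>" if "k < n" for k
    proof -
      \<comment> \<open>With the linear term subtracted, the derivative of h along the segment is a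
        difference of values of \<open>partial k f\<close>, which is bounded by e on V.\<close>
      define h where "h s = f ((z k)(k := s)) - partial k f x * s" for s
      have zV: "(z k)(k := s) \<in> V" if s: "s \<in> closed_segment (x k) (y k)" for s
      proof (rule d(2))
        have "\<bar>s - x k\<bar> < d"
          using s y(2)[OF \<open>k < n\<close>] by (auto simp: closed_segment_eq_real_ivl split: if_splits)
        then show "\<bar>((z k)(k := s)) i - x i\<bar> < d" if "i < n" for i
          using y(2)[OF that] d(1) by (auto simp: z_def)
      qed (use y(1) xE \<open>k < n\<close> in \<open>auto simp: z_def topspace_Euclidean_space\<close>)
      have "norm (h (y k) - h (x k)) \<le> e * norm (y k - x k)"
      proof (rule field_differentiable_bound)
        show "(h has_field_derivative partial k f ((z k)(k := s)) - partial k f x)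
            (at s within closed_segment (x k) (y k))"
          if s: "s \<in> closed_segment (x k) (y k)" for s
        proof -
          have "((\<lambda>r. f (((z k)(k := s))(k := r))) has_real_derivative partial k f ((z k)(k := s)))
              (at (((z k)(k := s)) k))"
            using f zV[OF s] \<open>k < n\<close> unfolding V_def Ck.simps by blast
          then have "((\<lambda>r. f ((z k)(k := r))) has_real_derivative partial k f ((z k)(k := s))) (at s)"
            by simp
          then show ?thesis
            unfolding h_def
            by (rule has_field_derivative_at_within[OF DERIV_diff[OF _ DERIV_cmult_Id]])
        qed
        show "norm (partial k f ((z k)(k := s)) - partial k f x) \<le> e"
          if s: "s \<in> closed_segment (x k) (y k)" for s
          using zV[OF s] \<open>k < n\<close> by (auto simp: V_def less_imp_le)
      qed auto
      moreover have "(z k)(k := y k) = z (Suc k)" "(z k)(k := x k) = z k"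
        by (auto simp: z_def fun_eq_iff less_Suc_eq)
      ultimately show ?thesis
        by (simp add: h_def algebra_simps)
    qed
    have "z n = y" "z 0 = x"
      using y(1) xE by (auto simp: z_def fun_eq_iff topspace_Euclidean_space)
    then have "f y - f x = (\<Sum>k<n. f (z (Suc k)) - f (z k))"
      using sum_lessThan_telescope[of "\<lambda>k. f (z k)" n] by simp
    then have "\<bar>f y - f x - (\<Sum>i<n. partial i f x * (y i - x i))\<bar> =
        \<bar>\<Sum>k<n. f (z (Suc k)) - f (z k) - partial k f x * (y k - x k)\<bar>"
      by (simp add: sum_subtractf)
    also have "\<dots> \<le> (\<Sum>k<n. e * \<bar>y k - x k\<bar>)"
      using step by (intro order.trans[OF sum_abs] sum_mono) auto
    finally show ?thesis
      by (simp add: sum_distrib_left)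
  qed
  then show ?thesis
    using d(1) that by blast
qed

text \<open>A curve of one real variable suffices, because a partial derivative of a composite is
  the derivative along such a curve. Taken with tolerance e / B, the linear approximation has a
  remainder whose quotient by r - s is at most e / B times a sum of difference quotients, and that
  sum is eventually below B.\<close>

lemma Ck_chain_rule:
  assumes U: "openin (Euclidean_space n) U" "c s \<in> U" and f: "Ck n U (Suc 0) f"
    and c: "eventually (\<lambda>r. c r \<in> topspace (Euclidean_space n)) (at s)"
    and c': "\<And>i. i < n \<Longrightarrow> ((\<lambda>r. c r i) has_real_derivative c' i) (at s)"
  shows "((\<lambda>r. f (c r)) has_real_derivative (\<Sum>i<n. partial i f (c s) * c' i)) (at s)"
proof -
  let ?D = "\<lambda>r. \<Sum>i<n. partial i f (c s) * (c r i - c s i)"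
  have "((\<lambda>r. (c r i - c s i) / (r - s)) \<longlongrightarrow> c' i) (at s)" if "i < n" for i
    using c'[OF that] by (simp add: has_field_derivative_iff)
  then have quotient: "((\<lambda>r. ?D r / (r - s)) \<longlongrightarrow> (\<Sum>i<n. partial i f (c s) * c' i)) (at s)"
      and abs_quotient: "((\<lambda>r. \<Sum>i<n. \<bar>(c r i - c s i) / (r - s)\<bar>) \<longlongrightarrow> (\<Sum>i<n. \<bar>c' i\<bar>)) (at s)"
    by (auto simp: sum_divide_distrib simp del: abs_divide simp flip: times_divide_eq_right
        intro!: tendsto_intros)
  \<comment> \<open>The added 1 puts B strictly above the limit of the sum of difference quotients
    and makes it positive even if that limit is 0.\<close>
  define B where "B = (\<Sum>i<n. \<bar>c' i\<bar>) + 1"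
  have "B > 0"
    by (simp add: B_def sum_nonneg add_nonneg_pos)
  have bound: "eventually (\<lambda>r. (\<Sum>i<n. \<bar>(c r i - c s i) / (r - s)\<bar>) < B) (at s)"
    using order_tendstoD(2)[OF abs_quotient, of B] by (simp add: B_def)
  have "((\<lambda>r. (f (c r) - f (c s) - ?D r) / (r - s)) \<longlongrightarrow> 0) (at s)"
  proof (rule tendstoI)
    fix e :: real assume "e > 0"
    then have "e / B > 0"
      using \<open>B > 0\<close> by simp
    then obtain d where d: "d > 0"
      "\<And>y. y \<in> topspace (Euclidean_space n) \<Longrightarrow> (\<And>i. i < n \<Longrightarrow> \<bar>y i - c s i\<bar> < d) \<Longrightarrow>
         \<bar>f y - f (c s) - (\<Sum>i<n. partial i f (c s) * (y i - c s i))\<bar> \<le> e / B * (\<Sum>i<n. \<bar>y i - c s i\<bar>)"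
      using Ck_linear_approximation[OF U f] by blast
    have "eventually (\<lambda>r. \<bar>c r i - c s i\<bar> < d) (at s)" if "i < n" for i
      using DERIV_isCont[OF c'[OF that]] d(1) by (auto simp: isCont_def dist_real_def dest: tendstoD)
    then have "eventually (\<lambda>r. \<forall>i\<in>{..<n}. \<bar>c r i - c s i\<bar> < d) (at s)"
      by (intro eventually_ball_finite) auto
    moreover have "eventually (\<lambda>r. r \<noteq> s) (at s)"
      by (simp add: eventually_at_filter)
    ultimately show "eventually (\<lambda>r. dist ((f (c r) - f (c s) - ?D r) / (r - s)) 0 < e) (at s)"
      using bound c
    proof eventually_elim
      case (elim r)
      have "\<bar>(f (c r) - f (c s) - ?D r) / (r - s)\<bar> \<le> e / B * (\<Sum>i<n. \<bar>c r i - c s i\<bar>) / \<bar>r - s\<bar>"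
        unfolding abs_divide using d(2)[of "c r"] elim by (intro divide_right_mono) auto
      also have "\<dots> = e / B * (\<Sum>i<n. \<bar>(c r i - c s i) / (r - s)\<bar>)"
        by (simp add: abs_divide flip: sum_divide_distrib)
      also have "\<dots> < e / B * B"
        using elim \<open>e / B > 0\<close> by (intro mult_strict_left_mono) auto
      finally show ?case
        using \<open>B > 0\<close> by simp
    qed
  qed
  from tendsto_add[OF this quotient] show ?thesis
    by (simp add: has_field_derivative_iff diff_divide_distrib)
qed

section \<open>Composition of C^k functions\<close>

lemma continuous_map_into_Euclidean_space:
  assumes "\<And>j. j < m \<Longrightarrow> continuous_map T euclideanreal (\<lambda>x. g x j)"
    "\<And>x. x \<in> topspace T \<Longrightarrow> g x \<in> topspace (Euclidean_space m)"
  shows "continuous_map T (Euclidean_space m) g"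
\<comment> \<open>The componentwise criterion for continuity speaks of sequences cut off at m; a
  sequence in \<open>Euclidean_space m\<close> equals its own cut-off.\<close>
proof (rule continuous_map_eq)
  show "continuous_map T (Euclidean_space m) (\<lambda>x i. if i < m then g x i else 0)"
    using assms(1) by (simp add: continuous_map_componentwise_Euclidean_space)
  show "(\<lambda>i. if i < m then g x i else 0) = g x" if "x \<in> topspace T" for x
    using assms(2)[OF that] by (auto simp: topspace_Euclidean_space fun_eq_iff)
qed

lemma has_partial_compose:
  assumes U: "openin (Euclidean_space n) U" "x \<in> U" "i < n" and V: "openin (Euclidean_space m) V"
    and g: "\<And>y. y \<in> U \<Longrightarrow> g y \<in> V"
      "\<And>j. j < m \<Longrightarrow> ((\<lambda>s. g (x(i := s)) j) has_real_derivative partial i (\<lambda>y. g y j) x) (at (x i))"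
    and f: "Ck m V (Suc 0) f"
  shows "((\<lambda>s. f (g (x(i := s)))) has_real_derivative
           (\<Sum>j<m. partial j f (g x) * partial i (\<lambda>y. g y j) x)) (at (x i))"
proof -
  have "eventually (\<lambda>s. x(i := s) \<in> U) (at (x i))"
    using eventually_fun_upd_in_open[OF U] eventually_nhds_conv_at by blast
  then have "eventually (\<lambda>s. g (x(i := s)) \<in> topspace (Euclidean_space m)) (at (x i))"
    by (rule eventually_mono) (use g(1) openin_subset[OF V] in auto)
  from Ck_chain_rule[OF V _ f this g(2)] show ?thesis
    using g(1)[OF U(2)] by simp
qed

text \<open>By the chain rule, \<open>partial i\<close> of the composite is a sum of products of
  \<open>partial j f\<close> after g with partial derivatives of g. The induction hypothesis handles
  \<open>partial j f\<close> after g, which is why f varies in the induction while g stays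
  fixed.\<close>

lemma Ck_compose:
  assumes U: "openin (Euclidean_space n) U" and V: "openin (Euclidean_space m) V"
    and g: "\<And>y. y \<in> U \<Longrightarrow> g y \<in> V" "\<And>j. j < m \<Longrightarrow> Ck n U k (\<lambda>x. g x j)" and f: "Ck m V k f"
  shows "Ck n U k (\<lambda>x. f (g x))"
  using f g(2)
proof (induction k arbitrary: f)
  have cont: "continuous_map (subtopology (Euclidean_space n) U) euclideanreal (\<lambda>x. f (g x))"
    if f: "Ck m V k f" and g': "\<And>j. j < m \<Longrightarrow> Ck n U k (\<lambda>x. g x j)" for f k
  proof -
    have "continuous_map (subtopology (Euclidean_space n) U) (Euclidean_space m) g"
      using g(1) openin_subset[OF V] Ck_continuous[OF g']
      by (intro continuous_map_into_Euclidean_space) auto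
    then have "continuous_map (subtopology (Euclidean_space n) U) (subtopology (Euclidean_space m) V) g"
      using g(1) by (auto simp: continuous_map_in_subtopology)
    from continuous_map_compose[OF this Ck_continuous[OF f]] show ?thesis
      by (simp add: comp_def)
  qed
  {
    case 0
    then show ?case
      using cont[of 0 f] by simp
  next
    case (Suc k)
    have f1: "Ck m V (Suc 0) f"
      using Suc.prems(1) by (auto dest: Ck_continuous)
    have D: "((\<lambda>s. f (g (x(i := s)))) has_real_derivative
           (\<Sum>j<m. partial j f (g x) * partial i (\<lambda>y. g y j) x)) (at (x i))" if "i < n" "x \<in> U" for i x
    proof (rule has_partial_compose[OF U that(2,1) V g(1)])
      show "((\<lambda>s. g (x(i := s)) j) has_real_derivative partial i (\<lambda>y. g y j) x) (at (x i))" if "j < m" for j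
        using Suc.prems(2)[OF that] \<open>i < n\<close> \<open>x \<in> U\<close> unfolding Ck.simps by blast
    qed (auto intro: f1 simp del: Ck.simps)
    then have eq: "partial i (\<lambda>x. f (g x)) x = (\<Sum>j<m. partial j f (g x) * partial i (\<lambda>y. g y j) x)"
      if "i < n" "x \<in> U" for i x
      using that by (auto simp: partial_def[of i "\<lambda>x. f (g x)"] intro!: DERIV_imp_deriv)
    have "Ck n U k (partial i (\<lambda>x. f (g x)))" if "i < n" for i
    proof (rule Ck_cong[OF U])
      show "Ck n U k (\<lambda>x. \<Sum>j<m. partial j f (g x) * partial i (\<lambda>y. g y j) x)"
      proof (rule Ck_sum[OF U finite_lessThan], rule Ck_mult[OF U])
        fix j assume j: "j \<in> {..<m}"
        show "Ck n U k (\<lambda>x. partial j f (g x))"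
        proof (rule Suc.IH)
          show "Ck m V k (partial j f)"
            using Suc.prems(1) j by simp
          show "Ck n U k (\<lambda>x. g x j)" if "j < m" for j
            using Suc.prems(2)[OF that] by (rule Ck_SucD)
        qed
        show "Ck n U k (partial i (\<lambda>y. g y j))"
          using Suc.prems(2) j that by simp
      qed
    qed (use that eq in auto)
    then show ?case
      using D eq cont[OF Suc.prems] by auto
  }
qed

section \<open>Smooth functions of arbitrary order and Jacobians\<close>

definition smooth_real :: "nat \<Rightarrow> (nat \<Rightarrow> real) set \<Rightarrow> ((nat \<Rightarrow> real) \<Rightarrow> real) \<Rightarrow> bool" where
  "smooth_real n U f \<longleftrightarrow> (\<forall>k. Ck n U k f)"

lemma euclid_smooth_iff: "euclid_smooth n U f \<longleftrightarrow> (\<forall>j. smooth_real n U (\<lambda>x. f x j))"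
  by (auto simp: euclid_smooth_def smooth_real_def)

lemma smooth_real_cong:
  "openin (Euclidean_space n) U \<Longrightarrow> (\<And>y. y \<in> U \<Longrightarrow> f y = g y) \<Longrightarrow> smooth_real n U f \<Longrightarrow> smooth_real n U g"
  by (auto simp: smooth_real_def intro: Ck_cong)

lemma smooth_real_subset: "smooth_real n U f \<Longrightarrow> V \<subseteq> U \<Longrightarrow> smooth_real n V f"
  by (auto simp: smooth_real_def intro: Ck_subset)

lemma smooth_real_local:
  assumes "\<And>x. x \<in> U \<Longrightarrow> \<exists>W. openin (Euclidean_space n) W \<and> x \<in> W \<and> smooth_real n W f"
  shows "smooth_real n U f"
  unfolding smooth_real_def using assms by (intro allI Ck_local) (auto simp: smooth_real_def)

lemma smooth_real_continuous:
  "smooth_real n U f \<Longrightarrow> continuous_map (subtopology (Euclidean_space n) U) euclideanreal f"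
  by (auto simp: smooth_real_def intro: Ck_continuous)

lemma smooth_real_const: "smooth_real n U (\<lambda>x. c)"
  by (simp add: smooth_real_def Ck_const)

lemma smooth_real_coordinate: "smooth_real n U (\<lambda>x. x j)"
  by (simp add: smooth_real_def Ck_coordinate)

lemma smooth_real_add:
  "openin (Euclidean_space n) U \<Longrightarrow> smooth_real n U f \<Longrightarrow> smooth_real n U g \<Longrightarrow> smooth_real n U (\<lambda>x. f x + g x)"
  by (simp add: smooth_real_def Ck_add)

lemma smooth_real_mult:
  "openin (Euclidean_space n) U \<Longrightarrow> smooth_real n U f \<Longrightarrow> smooth_real n U g \<Longrightarrow> smooth_real n U (\<lambda>x. f x * g x)"
  by (simp add: smooth_real_def Ck_mult)

lemma smooth_real_sum:
  "openin (Euclidean_space n) U \<Longrightarrow> finite I \<Longrightarrow> (\<And>i. i \<in> I \<Longrightarrow> smooth_real n U (f i)) \<Longrightarrow>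
    smooth_real n U (\<lambda>x. \<Sum>i\<in>I. f i x)"
  by (simp add: smooth_real_def Ck_sum)

lemma smooth_real_compose:
  assumes "openin (Euclidean_space n) U" "openin (Euclidean_space m) V"
    "\<And>y. y \<in> U \<Longrightarrow> g y \<in> V" "\<And>j. j < m \<Longrightarrow> smooth_real n U (\<lambda>x. g x j)" "smooth_real m V f"
  shows "smooth_real n U (\<lambda>x. f (g x))"
  unfolding smooth_real_def
proof
  fix k
  show "Ck n U k (\<lambda>x. f (g x))"
    by (rule Ck_compose[OF assms(1,2,3)]) (use assms(4,5) in \<open>auto simp: smooth_real_def\<close>)
qed

lemma smooth_real_partial:
  assumes "smooth_real n U f" "i < n"
  shows "smooth_real n U (partial i f)"
  unfolding smooth_real_def
proof
  fix k
  have "Ck n U (Suc k) f"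
    using assms(1) unfolding smooth_real_def by blast
  then show "Ck n U k (partial i f)"
    using assms(2) by simp
qed

lemma smooth_real_has_partial:
  assumes "smooth_real n U f" "x \<in> U" "i < n"
  shows "((\<lambda>s. f (x(i := s))) has_real_derivative partial i f x) (at (x i))"
proof -
  have "Ck n U (Suc 0) f"
    using assms(1) unfolding smooth_real_def by blast
  then show ?thesis
    using assms(2,3) unfolding Ck.simps by blast
qed

lemma partial_compose:
  assumes U: "openin (Euclidean_space n) U" "x \<in> U" "i < n" and V: "openin (Euclidean_space m) V"
    and g: "\<And>y. y \<in> U \<Longrightarrow> g y \<in> V" "\<And>j. j < m \<Longrightarrow> smooth_real n U (\<lambda>y. g y j)"
    and f: "smooth_real m V f"
  shows "partial i (\<lambda>y. f (g y)) x = (\<Sum>j<m. partial j f (g x) * partial i (\<lambda>y. g y j) x)"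
proof -
  have "((\<lambda>s. f (g (x(i := s)))) has_real_derivative
           (\<Sum>j<m. partial j f (g x) * partial i (\<lambda>y. g y j) x)) (at (x i))"
    using f g(2) U by (intro has_partial_compose[OF U V g(1)] smooth_real_has_partial) (auto simp only: smooth_real_def)
  then show ?thesis
    unfolding partial_def[of i "\<lambda>y. f (g y)"] by (rule DERIV_imp_deriv)
qed

lemma euclid_smooth_cong:
  "openin (Euclidean_space n) U \<Longrightarrow> (\<And>y. y \<in> U \<Longrightarrow> f y = g y) \<Longrightarrow> euclid_smooth n U f \<Longrightarrow> euclid_smooth n U g"
  unfolding euclid_smooth_iff by (intro allI smooth_real_cong[of n U "\<lambda>x. f x _" "\<lambda>x. g x _"]) auto

lemma euclid_smooth_subset: "euclid_smooth n U f \<Longrightarrow> V \<subseteq> U \<Longrightarrow> euclid_smooth n V f"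
  by (auto simp: euclid_smooth_iff intro: smooth_real_subset)

lemma euclid_smooth_local:
  assumes "\<And>x. x \<in> U \<Longrightarrow> \<exists>W. openin (Euclidean_space n) W \<and> x \<in> W \<and> euclid_smooth n W f"
  shows "euclid_smooth n U f"
  unfolding euclid_smooth_iff using assms
  by (intro allI smooth_real_local) (auto simp: euclid_smooth_iff)

lemma euclid_smooth_compose:
  assumes "openin (Euclidean_space n) U" "openin (Euclidean_space m) V"
    "\<And>y. y \<in> U \<Longrightarrow> g y \<in> V" "euclid_smooth n U g" "euclid_smooth m V f"
  shows "euclid_smooth n U (f \<circ> g)"
  unfolding euclid_smooth_iff comp_def
proof
  fix j
  show "smooth_real n U (\<lambda>x. f (g x) j)"
    by (rule smooth_real_compose[OF assms(1-3)]) (use assms(4,5) in \<open>auto simp: euclid_smooth_iff\<close>)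
qed

lemma euclid_smooth_id: "euclid_smooth n U (\<lambda>x. x)"
  by (simp add: euclid_smooth_iff smooth_real_coordinate)

lemma euclid_smooth_continuous:
  assumes "euclid_smooth n U f" "openin (Euclidean_space n) U" "\<And>x. x \<in> U \<Longrightarrow> f x \<in> topspace (Euclidean_space m)"
  shows "continuous_map (subtopology (Euclidean_space n) U) (Euclidean_space m) f"
  using assms by (intro continuous_map_into_Euclidean_space) (auto simp: euclid_smooth_iff intro: smooth_real_continuous)

lemma jacobian_cong:
  assumes "openin (Euclidean_space n) U" "x \<in> U" "\<And>y. y \<in> U \<Longrightarrow> f y = g y"
  shows "jacobian n f x u = jacobian n g x u"
proof -
  have "partial i (\<lambda>y. f y j) x = partial i (\<lambda>y. g y j) x" if "i < n" for i j
    using assms that by (intro partial_cong[OF assms(1,2)]) auto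
  then show ?thesis
    by (auto simp: jacobian_def)
qed

lemma jacobian_compose:
  assumes "openin (Euclidean_space n) U" "x \<in> U" "openin (Euclidean_space m) V"
    "\<And>y. y \<in> U \<Longrightarrow> g y \<in> V" "euclid_smooth n U g" "euclid_smooth m V f"
  shows "jacobian n (f \<circ> g) x u = jacobian m f (g x) (jacobian n g x u)"
proof
  fix k
  have "jacobian n (f \<circ> g) x u k =
      (\<Sum>i<n. (\<Sum>j<m. partial j (\<lambda>y. f y k) (g x) * partial i (\<lambda>y. g y j) x) * u i)"
    using partial_compose[OF assms(1,2) _ assms(3,4), where f = "\<lambda>y. f y k"] assms(5,6)
    by (simp add: jacobian_def euclid_smooth_iff)
  also have "\<dots> = (\<Sum>j<m. \<Sum>i<n. partial j (\<lambda>y. f y k) (g x) * (partial i (\<lambda>y. g y j) x * u i))"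
    by (subst sum.swap) (simp add: sum_distrib_right mult.assoc)
  also have "\<dots> = jacobian m f (g x) (jacobian n g x u) k"
    by (simp add: jacobian_def sum_distrib_left)
  finally show "jacobian n (f \<circ> g) x u k = jacobian m f (g x) (jacobian n g x u) k" .
qed

lemma jacobian_id:
  assumes "u \<in> topspace (Euclidean_space n)"
  shows "jacobian n (\<lambda>x. x) x u = u"
proof
  fix j
  have "partial i (\<lambda>x. x j) x = (if i = j then 1 else 0)" for i
    unfolding partial_def by (rule DERIV_imp_deriv) (auto intro!: derivative_eq_intros)
  then have "jacobian n (\<lambda>x. x) x u j = (\<Sum>i<n. if i = j then u i else 0)"
    unfolding jacobian_def by (intro sum.cong) auto
  then show "jacobian n (\<lambda>x. x) x u j = u j"
    using assms by (auto simp: topspace_Euclidean_space not_less)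
qed

text \<open>The components of f from index m on vanish on the whole neighbourhood U, hence so do
  their partial derivatives at x.\<close>

lemma jacobian_in_Euclidean_space:
  assumes "openin (Euclidean_space n) U" "x \<in> U" "\<And>y. y \<in> U \<Longrightarrow> f y \<in> topspace (Euclidean_space m)"
  shows "jacobian n f x u \<in> topspace (Euclidean_space m)"
proof -
  have "partial i (\<lambda>y. f y j) x = 0" if "i < n" "m \<le> j" for i j
  proof -
    have "partial i (\<lambda>y. f y j) x = partial i (\<lambda>y. 0) x"
      using assms(3) that(2) by (intro partial_cong[OF assms(1,2) that(1)]) (auto simp: topspace_Euclidean_space)
    then show ?thesis
      by (simp add: partial_def)
  qed
  then show ?thesis
    by (auto simp: topspace_Euclidean_space jacobian_def)
qed

lemma jacobian_add: "jacobian n f x (\<lambda>i. u i + v i) = (\<lambda>j. jacobian n f x u j + jacobian n f x v j)"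
  by (auto simp: jacobian_def distrib_left sum.distrib)

lemma jacobian_scale: "jacobian n f x (\<lambda>i. r * u i) = (\<lambda>j. r * jacobian n f x u j)"
  by (auto simp: jacobian_def sum_distrib_left intro!: sum.cong)

lemma jacobian_zero: "jacobian n f x (\<lambda>i. 0) = (\<lambda>j. 0)"
  by (simp add: jacobian_def)

subsection \<open>Charts\<close>

lemma chart_open: "is_chart T n (U, \<phi>) \<Longrightarrow> openin T U"
  by (simp add: is_chart_def)

lemma chart_image: "is_chart T n (U, \<phi>) \<Longrightarrow> openin (Euclidean_space n) (\<phi> ` U)"
  by (simp add: is_chart_def)

lemma chart_inj:
  assumes "is_chart T n (U, \<phi>)"
  shows "inj_on \<phi> U"
proof -
  have "U \<subseteq> topspace T"
    using chart_open[OF assms] by (rule openin_subset)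
  then show ?thesis
    using assms homeomorphic_imp_injective_map[of "subtopology T U" _ \<phi>]
    by (auto simp: is_chart_def Int_absorb1)
qed

lemma chart_in_Euclidean_space:
  "is_chart T n (U, \<phi>) \<Longrightarrow> x \<in> U \<Longrightarrow> \<phi> x \<in> topspace (Euclidean_space n)"
  using openin_subset[OF chart_image] by blast

lemma chart_image_open:
  assumes c: "is_chart T n (U, \<phi>)" and W: "openin T W" "W \<subseteq> U"
  shows "openin (Euclidean_space n) (\<phi> ` W)"
proof -
  have "open_map (subtopology T U) (subtopology (Euclidean_space n) (\<phi> ` U)) \<phi>"
    using c by (auto simp: is_chart_def intro: homeomorphic_imp_open_map)
  then show ?thesis
    using W chart_open[OF c] chart_image[OF c]
    by (auto simp: open_map_def openin_open_subtopology)
qed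

lemma chart_preimage_open:
  assumes c: "is_chart T n (U, \<phi>)" and S: "openin (Euclidean_space n) S"
  shows "openin T {x \<in> U. \<phi> x \<in> S}"
proof -
  have "continuous_map (subtopology T U) (Euclidean_space n) \<phi>"
    using c by (auto simp: is_chart_def continuous_map_in_subtopology dest: homeomorphic_imp_continuous_map)
  then have "openin (subtopology T U) {x \<in> topspace (subtopology T U). \<phi> x \<in> S}"
    using S by (rule openin_continuous_map_preimage)
  moreover have "topspace (subtopology T U) = U"
    using openin_subset[OF chart_open[OF c]] by auto
  ultimately show ?thesis
    using chart_open[OF c] by (simp add: openin_open_subtopology del: topspace_subtopology)
qed

lemma chart_continuous:
  "is_chart T n (U, \<phi>) \<Longrightarrow> continuous_map (subtopology T U) (Euclidean_space n) \<phi>"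
  by (auto simp: is_chart_def continuous_map_in_subtopology dest: homeomorphic_imp_continuous_map)

lemma chart_inverse_continuous:
  assumes c: "is_chart T n (U, \<phi>)"
  shows "continuous_map (subtopology (Euclidean_space n) (\<phi> ` U)) T (inv_into U \<phi>)"
proof -
  have top: "topspace (subtopology (Euclidean_space n) (\<phi> ` U)) = \<phi> ` U"
    using openin_subset[OF chart_image[OF c]] by auto
  have "openin (subtopology (Euclidean_space n) (\<phi> ` U)) {y \<in> \<phi> ` U. inv_into U \<phi> y \<in> W}" if W: "openin T W" for W
  proof -
    have "{y \<in> \<phi> ` U. inv_into U \<phi> y \<in> W} = \<phi> ` (W \<inter> U)"
      using chart_inj[OF c] by auto
    moreover have "openin (Euclidean_space n) (\<phi> ` (W \<inter> U))"
      using chart_open[OF c] W by (intro chart_image_open[OF c]) auto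
    ultimately show ?thesis
      using chart_image[OF c] by (auto simp: openin_open_subtopology)
  qed
  moreover have "inv_into U \<phi> y \<in> topspace T" if "y \<in> \<phi> ` U" for y
    using inv_into_into[OF that] openin_subset[OF chart_open[OF c]] by blast
  ultimately show ?thesis
    unfolding continuous_map top by auto
qed

text \<open>The target is the image of \<open>\<phi>\<close>, so a continuous left inverse is
  automatically two-sided.\<close>

lemma is_chartI:
  assumes "openin T U" "\<phi> \<in> extensional U" "openin (Euclidean_space n) (\<phi> ` U)"
    and "continuous_map (subtopology T U) (Euclidean_space n) \<phi>"
    and "continuous_map (subtopology (Euclidean_space n) (\<phi> ` U)) T \<kappa>"
    and "\<And>x. x \<in> U \<Longrightarrow> \<kappa> (\<phi> x) = x"
  shows "is_chart T n (U, \<phi>)"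
proof -
  have "homeomorphic_maps (subtopology T U) (subtopology (Euclidean_space n) (\<phi> ` U)) \<phi> \<kappa>"
    using assms by (auto simp: homeomorphic_maps_def continuous_map_in_subtopology)
  then show ?thesis
    using assms(1-3) by (auto simp: is_chart_def homeomorphic_map_maps)
qed


subsection \<open>Smooth functions and maps on open subsets\<close>

text \<open>
  A set with a chart structure in the sense of \<open>charted\<close> need not be Hausdorff, second countable or
  carry a maximal atlas. This weak notion is inherited by all constructions on manifolds at once.
\<close>

definition charted :: "'a manifold \<Rightarrow> bool" where
  "charted M \<longleftrightarrow> (\<forall>c\<in>atlas M. is_chart (mtop M) (mdim M) c) \<and>
     (\<forall>c\<in>atlas M. \<forall>d\<in>atlas M. compatible (mdim M) c d) \<and>
     (\<Union>(U, \<phi>)\<in>atlas M. U) = mcarrier M"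

definition smooth_fn :: "'a manifold \<Rightarrow> 'a set \<Rightarrow> ('a \<Rightarrow> real) \<Rightarrow> bool" where
  "smooth_fn M W f \<longleftrightarrow> (\<forall>(U, \<phi>)\<in>atlas M. smooth_real (mdim M) (\<phi> ` (U \<inter> W)) (\<lambda>y. f (inv_into U \<phi> y)))"

text \<open>One chart of N and one neighbourhood are asked for, where \<open>smooth_map\<close>
  quantifies over all pairs of charts. This existential form is easy to establish and to glue, and
  continuity follows from it, see \<open>smooth_on_preimage_open\<close>.\<close>

abbreviation (input) smooth_at :: "'a manifold \<Rightarrow> 'a set \<Rightarrow> 'b manifold \<Rightarrow> ('a \<Rightarrow> 'b) \<Rightarrow> 'a \<Rightarrow> bool" where
  "smooth_at M W N f x \<equiv>
     \<exists>V \<psi> W'. (V, \<psi>) \<in> atlas N \<and> openin (mtop M) W' \<and> x \<in> W' \<and> W' \<subseteq> W \<and> f ` W' \<subseteq> V \<and>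
       (\<forall>j<mdim N. smooth_fn M W' (\<lambda>x. \<psi> (f x) j))"

definition smooth_on :: "'a manifold \<Rightarrow> 'a set \<Rightarrow> 'b manifold \<Rightarrow> ('a \<Rightarrow> 'b) \<Rightarrow> bool" where
  "smooth_on M W N f \<longleftrightarrow> openin (mtop M) W \<and> (\<forall>x\<in>W. smooth_at M W N f x)"

lemma charted_chart: "charted M \<Longrightarrow> (U, \<phi>) \<in> atlas M \<Longrightarrow> is_chart (mtop M) (mdim M) (U, \<phi>)"
  by (auto simp: charted_def)

lemma charted_transition:
  assumes "charted M" "(U, \<phi>) \<in> atlas M" "(V, \<psi>) \<in> atlas M"
  shows "euclid_smooth (mdim M) (\<phi> ` (U \<inter> V)) (\<lambda>y. \<psi> (inv_into U \<phi> y))"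
  using assms by (force simp: charted_def compatible_def comp_def)

lemma charted_cover:
  assumes "charted M" "x \<in> mcarrier M"
  obtains U \<phi> where "(U, \<phi>) \<in> atlas M" "x \<in> U"
  using assms unfolding charted_def by blast

lemma atlas_open: "charted M \<Longrightarrow> (U, \<phi>) \<in> atlas M \<Longrightarrow> openin (mtop M) U"
  using charted_chart chart_open by blast

lemma atlas_subset: "charted M \<Longrightarrow> (U, \<phi>) \<in> atlas M \<Longrightarrow> U \<subseteq> mcarrier M"
  using atlas_open openin_subset by blast

lemma atlas_inv: "charted M \<Longrightarrow> (U, \<phi>) \<in> atlas M \<Longrightarrow> x \<in> U \<Longrightarrow> inv_into U \<phi> (\<phi> x) = x"
  using charted_chart chart_inj inv_into_f_f by metis

lemma atlas_image_open:
  "charted M \<Longrightarrow> (U, \<phi>) \<in> atlas M \<Longrightarrow> openin (mtop M) W \<Longrightarrow> openin (Euclidean_space (mdim M)) (\<phi> ` (U \<inter> W))"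
  by (rule chart_image_open[OF charted_chart]) (auto intro: atlas_open)

lemma smooth_manifold_charted: "smooth_manifold M \<Longrightarrow> charted M"
  unfolding smooth_manifold_def charted_def max_atlas_def by blast

lemma smooth_fnD:
  assumes "smooth_fn M W f" "(U, \<phi>) \<in> atlas M"
  shows "smooth_real (mdim M) (\<phi> ` (U \<inter> W)) (\<lambda>y. f (inv_into U \<phi> y))"
  using assms by (auto simp: smooth_fn_def)

text \<open>Testing in a single chart around W is enough: any other chart differs from it by a
  smooth transition map.\<close>

lemma smooth_fn_chartI:
  assumes M: "charted M" and W: "openin (mtop M) W" and c: "(U, \<phi>) \<in> atlas M" and "W \<subseteq> U"
    and f: "smooth_real (mdim M) (\<phi> ` W) (\<lambda>y. f (inv_into U \<phi> y))"
  shows "smooth_fn M W f"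
  unfolding smooth_fn_def
proof clarify
  fix V \<psi> assume d: "(V, \<psi>) \<in> atlas M"
  let ?n = "mdim M"
  have open1: "openin (Euclidean_space ?n) (\<psi> ` (V \<inter> W))"
    using M d W by (rule atlas_image_open)
  have open2: "openin (Euclidean_space ?n) (\<phi> ` W)"
    using chart_image_open[OF charted_chart[OF M c] W \<open>W \<subseteq> U\<close>] .
  have tr: "euclid_smooth ?n (\<psi> ` (V \<inter> W)) (\<lambda>y. \<phi> (inv_into V \<psi> y))"
    by (rule euclid_smooth_subset[OF charted_transition[OF M d c]]) (use \<open>W \<subseteq> U\<close> in auto)
  have "smooth_real ?n (\<psi> ` (V \<inter> W)) (\<lambda>y. f (inv_into U \<phi> (\<phi> (inv_into V \<psi> y))))"
    by (rule smooth_real_compose[OF open1 open2 _ _ f])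
      (use tr atlas_inv[OF M d] in \<open>auto simp: euclid_smooth_iff\<close>)
  then show "smooth_real ?n (\<psi> ` (V \<inter> W)) (\<lambda>y. f (inv_into V \<psi> y))"
    by (rule smooth_real_cong[OF open1, rotated]) (use atlas_inv[OF M d] atlas_inv[OF M c] \<open>W \<subseteq> U\<close> in auto)
qed

lemma smooth_fn_local:
  assumes M: "charted M"
    and loc: "\<And>x. x \<in> W \<Longrightarrow> \<exists>W'. openin (mtop M) W' \<and> x \<in> W' \<and> smooth_fn M W' f"
  shows "smooth_fn M W f"
  unfolding smooth_fn_def
proof clarify
  fix U \<phi> assume c: "(U, \<phi>) \<in> atlas M"
  show "smooth_real (mdim M) (\<phi> ` (U \<inter> W)) (\<lambda>y. f (inv_into U \<phi> y))"
  proof (rule smooth_real_local)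
    fix y assume "y \<in> \<phi> ` (U \<inter> W)"
    then obtain x where x: "x \<in> U" "x \<in> W" "y = \<phi> x"
      by blast
    then obtain W' where W': "openin (mtop M) W'" "x \<in> W'" "smooth_fn M W' f"
      using loc by blast
    then show "\<exists>S. openin (Euclidean_space (mdim M)) S \<and> y \<in> S \<and> smooth_real (mdim M) S (\<lambda>y. f (inv_into U \<phi> y))"
      using atlas_image_open[OF M c W'(1)] smooth_fnD[OF W'(3) c] x
      by (intro exI[of _ "\<phi> ` (U \<inter> W')"]) auto
  qed
qed

lemma smooth_fn_subset: "smooth_fn M W f \<Longrightarrow> V \<subseteq> W \<Longrightarrow> smooth_fn M V f"
  by (fastforce simp: smooth_fn_def intro: smooth_real_subset)

lemma smooth_fn_cong:
  assumes "charted M" "openin (mtop M) W" "\<And>x. x \<in> W \<Longrightarrow> f x = g x" "smooth_fn M W f"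
  shows "smooth_fn M W g"
  unfolding smooth_fn_def
proof clarify
  fix U \<phi> assume c: "(U, \<phi>) \<in> atlas M"
  show "smooth_real (mdim M) (\<phi> ` (U \<inter> W)) (\<lambda>y. g (inv_into U \<phi> y))"
    by (rule smooth_real_cong[OF atlas_image_open[OF assms(1) c assms(2)] _ smooth_fnD[OF assms(4) c]])
      (use atlas_inv[OF assms(1) c] assms(3) in auto)
qed

lemma smooth_fn_compose_real:
  assumes "charted M" "openin (mtop M) W" "openin (Euclidean_space m) S"
    "\<And>x. x \<in> W \<Longrightarrow> g x \<in> S" "\<And>j. j < m \<Longrightarrow> smooth_fn M W (\<lambda>x. g x j)" "smooth_real m S h"
  shows "smooth_fn M W (\<lambda>x. h (g x))"
  unfolding smooth_fn_def
proof clarify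
  fix U \<phi> assume c: "(U, \<phi>) \<in> atlas M"
  show "smooth_real (mdim M) (\<phi> ` (U \<inter> W)) (\<lambda>y. h (g (inv_into U \<phi> y)))"
    by (rule smooth_real_compose[OF atlas_image_open[OF assms(1) c assms(2)] assms(3) _ _ assms(6)])
      (use atlas_inv[OF assms(1) c] assms(4) smooth_fnD[OF assms(5) c] in auto)
qed

lemma smooth_fn_const: "smooth_fn M W (\<lambda>x. c)"
  by (auto simp: smooth_fn_def smooth_real_const)

lemma smooth_fn_add:
  assumes "charted M" "openin (mtop M) W" "smooth_fn M W f" "smooth_fn M W g"
  shows "smooth_fn M W (\<lambda>x. f x + g x)"
  using assms unfolding smooth_fn_def by (auto intro!: smooth_real_add atlas_image_open)

lemma smooth_fn_mult:
  assumes "charted M" "openin (mtop M) W" "smooth_fn M W f" "smooth_fn M W g"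
  shows "smooth_fn M W (\<lambda>x. f x * g x)"
  using assms unfolding smooth_fn_def by (auto intro!: smooth_real_mult atlas_image_open)

lemma smooth_fn_sum:
  assumes "charted M" "openin (mtop M) W" "finite I" "\<And>i. i \<in> I \<Longrightarrow> smooth_fn M W (f i)"
  shows "smooth_fn M W (\<lambda>x. \<Sum>i\<in>I. f i x)"
  using assms(3,4) by (induction I rule: finite_induct) (auto intro: smooth_fn_const smooth_fn_add assms(1,2))

lemma smooth_fn_coordinate:
  assumes "charted M" "(U, \<phi>) \<in> atlas M"
  shows "smooth_fn M U (\<lambda>x. \<phi> x j)"
proof (rule smooth_fn_chartI[OF assms(1) atlas_open[OF assms] assms(2) order.refl])
  show "smooth_real (mdim M) (\<phi> ` U) (\<lambda>y. \<phi> (inv_into U \<phi> y) j)"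
    by (rule smooth_real_cong[OF chart_image[OF charted_chart[OF assms]] _ smooth_real_coordinate[where j = j]])
      (auto simp: f_inv_into_f)
qed

text \<open>Continuity of a map with smooth coordinates, obtained near each point by moving to a
  chart, where it is continuity of a smooth map between Euclidean spaces.\<close>

lemma smooth_fn_preimage_open:
  assumes M: "charted M" and W: "openin (mtop M) W" and g: "\<And>j. j < m \<Longrightarrow> smooth_fn M W (\<lambda>x. g x j)"
    "\<And>x. x \<in> W \<Longrightarrow> g x \<in> topspace (Euclidean_space m)" and S: "openin (Euclidean_space m) S"
  shows "openin (mtop M) {x \<in> W. g x \<in> S}"
proof (subst openin_subopen, intro ballI)
  fix x assume x: "x \<in> {x \<in> W. g x \<in> S}"
  then have "x \<in> mcarrier M"
    using openin_subset[OF W] by blast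
  then obtain U \<phi> where c: "(U, \<phi>) \<in> atlas M" "x \<in> U"
    using charted_cover M by metis
  let ?B = "\<phi> ` (U \<inter> W)"
  have B: "openin (Euclidean_space (mdim M)) ?B"
    using atlas_image_open[OF M c(1) W] .
  then have top: "topspace (subtopology (Euclidean_space (mdim M)) ?B) = ?B"
    using openin_subset by fastforce
  have inv: "inv_into U \<phi> (\<phi> z) = z" if "z \<in> U" for z
    using atlas_inv[OF M c(1) that] .
  have "continuous_map (subtopology (Euclidean_space (mdim M)) ?B) (Euclidean_space m) (\<lambda>y. g (inv_into U \<phi> y))"
    using smooth_real_continuous[OF smooth_fnD[OF g(1) c(1)]] g(2) inv
    by (intro continuous_map_into_Euclidean_space) (auto simp: top)
  from openin_continuous_map_preimage[OF this S]
  have "openin (Euclidean_space (mdim M)) {y \<in> ?B. g (inv_into U \<phi> y) \<in> S}"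
    using B unfolding top by (simp add: openin_open_subtopology)
  then have "openin (mtop M) {z \<in> U. \<phi> z \<in> {y \<in> ?B. g (inv_into U \<phi> y) \<in> S}}"
    by (rule chart_preimage_open[OF charted_chart[OF M c(1)]])
  moreover have zW: "z \<in> W" if "z \<in> U" "\<phi> z \<in> ?B" for z
    using that inj_onD[OF chart_inj[OF charted_chart[OF M c(1)]]] by blast
  moreover have "{z \<in> U. \<phi> z \<in> {y \<in> ?B. g (inv_into U \<phi> y) \<in> S}} = {z \<in> U. z \<in> W \<and> g z \<in> S}"
    using inv zW by (intro Collect_cong) (metis (mono_tags, lifting) IntI image_eqI mem_Collect_eq)
  ultimately show "\<exists>T. openin (mtop M) T \<and> x \<in> T \<and> T \<subseteq> {x \<in> W. g x \<in> S}"
    using x c(2) by (intro exI[of _ "{z \<in> U. z \<in> W \<and> g z \<in> S}"]) auto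
qed

section \<open>Maps that are smooth on an open subset\<close>

lemma smooth_onI:
  assumes "openin (mtop M) W" "\<And>x. x \<in> W \<Longrightarrow> smooth_at M W N f x"
  shows "smooth_on M W N f"
  unfolding smooth_on_def using assms by (intro conjI ballI)

lemma smooth_onE:
  assumes "smooth_on M W N f" "x \<in> W"
  obtains V \<psi> W' where "(V, \<psi>) \<in> atlas N" "openin (mtop M) W'" "x \<in> W'" "W' \<subseteq> W" "f ` W' \<subseteq> V"
    "\<And>j. j < mdim N \<Longrightarrow> smooth_fn M W' (\<lambda>x. \<psi> (f x) j)"
proof -
  have "smooth_at M W N f x"
    using assms unfolding smooth_on_def by (elim conjE) (rule bspec)
  then show ?thesis
    by (elim exE conjE) (rule that, auto)
qed

lemma smooth_on_open: "smooth_on M W N f \<Longrightarrow> openin (mtop M) W"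
  by (simp add: smooth_on_def)

lemma smooth_on_carrier:
  assumes "charted N" "smooth_on M W N f" "x \<in> W"
  shows "f x \<in> mcarrier N"
  using smooth_onE[OF assms(2,3)] atlas_subset[OF assms(1)] by (metis image_subset_iff subsetD)

text \<open>A chart \<open>\<psi>\<close> is injective on its domain V', so for f x in V' the
  condition that f x lies in V can be read off from \<open>\<psi> (f x)\<close>, which has smooth
  coordinates.\<close>

lemma smooth_on_preimage_open:
  assumes M: "charted M" and N: "charted N" and f: "smooth_on M W N f" and V: "openin (mtop N) V"
  shows "openin (mtop M) {x \<in> W. f x \<in> V}"
proof (subst openin_subopen, intro ballI)
  fix x assume x: "x \<in> {x \<in> W. f x \<in> V}"
  then obtain V' \<psi> W' where c: "(V', \<psi>) \<in> atlas N" "openin (mtop M) W'" "x \<in> W'" "W' \<subseteq> W" "f ` W' \<subseteq> V'"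
      "\<And>j. j < mdim N \<Longrightarrow> smooth_fn M W' (\<lambda>x. \<psi> (f x) j)"
    using smooth_onE[OF f] by blast
  note ch = charted_chart[OF N c(1)]
  have "openin (mtop M) {x \<in> W'. \<psi> (f x) \<in> \<psi> ` (V' \<inter> V)}"
    by (rule smooth_fn_preimage_open[OF M c(2,6)])
      (use c(5) chart_in_Euclidean_space[OF ch] atlas_image_open[OF N c(1) V] in auto)
  moreover have "{x \<in> W'. \<psi> (f x) \<in> \<psi> ` (V' \<inter> V)} = {x \<in> W'. f x \<in> V}"
    using c(5) inj_onD[OF chart_inj[OF ch]] by blast
  ultimately show "\<exists>T. openin (mtop M) T \<and> x \<in> T \<and> T \<subseteq> {x \<in> W. f x \<in> V}"
    using x c(3,4) by (intro exI[of _ "{x \<in> W'. f x \<in> V}"]) auto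
qed

text \<open>Factor h after f as (h after the inverse of \<open>\<psi>\<close>) after
  (\<open>\<psi>\<close> after f), with the chart \<open>\<psi>\<close> that
  \<open>smooth_on\<close> supplies. Both factors are smooth by definition. Composition and the
  change to an arbitrary chart are instances of this.\<close>

lemma smooth_fn_pullback:
  assumes M: "charted M" and N: "charted N" and f: "smooth_on M W N f"
    and h: "openin (mtop N) V" "smooth_fn N V h" "\<And>x. x \<in> W \<Longrightarrow> f x \<in> V"
  shows "smooth_fn M W (\<lambda>x. h (f x))"
proof (rule smooth_fn_local[OF M])
  fix x assume x: "x \<in> W"
  then obtain V' \<psi> W' where c: "(V', \<psi>) \<in> atlas N" "openin (mtop M) W'" "x \<in> W'" "W' \<subseteq> W" "f ` W' \<subseteq> V'"
      "\<And>j. j < mdim N \<Longrightarrow> smooth_fn M W' (\<lambda>x. \<psi> (f x) j)"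
    using smooth_onE[OF f] by blast
  have "smooth_fn M W' (\<lambda>x. h (inv_into V' \<psi> (\<psi> (f x))))"
    by (rule smooth_fn_compose_real[OF M c(2) atlas_image_open[OF N c(1) h(1)] _ c(6) smooth_fnD[OF h(2) c(1)]])
      (use c(4,5) h(3) in blast)
  then have "smooth_fn M W' (\<lambda>x. h (f x))"
    by (rule smooth_fn_cong[OF M c(2), rotated]) (use c(5) atlas_inv[OF N c(1)] in auto)
  then show "\<exists>W'. openin (mtop M) W' \<and> x \<in> W' \<and> smooth_fn M W' (\<lambda>x. h (f x))"
    using c by blast
qed

lemma smooth_on_subset:
  assumes f: "smooth_on M W N f" and V: "openin (mtop M) V" "V \<subseteq> W"
  shows "smooth_on M V N f"
proof (rule smooth_onI[OF V(1)])
  fix x assume x: "x \<in> V"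
  then obtain U \<psi> W' where "(U, \<psi>) \<in> atlas N" "openin (mtop M) W'" "x \<in> W'" "W' \<subseteq> W" "f ` W' \<subseteq> U"
      "\<And>j. j < mdim N \<Longrightarrow> smooth_fn M W' (\<lambda>x. \<psi> (f x) j)"
    using smooth_onE[OF f] V(2) by blast
  then show "smooth_at M V N f x"
    using V(1) x by (intro exI[of _ U] exI[of _ \<psi>] exI[of _ "V \<inter> W'"]) (auto intro: smooth_fn_subset)
qed

lemma smooth_on_local:
  assumes "openin (mtop M) W"
    "\<And>x. x \<in> W \<Longrightarrow> \<exists>W'. x \<in> W' \<and> W' \<subseteq> W \<and> smooth_on M W' N f"
  shows "smooth_on M W N f"
proof (rule smooth_onI[OF assms(1)])
  fix x assume "x \<in> W"
  then obtain W' where W': "x \<in> W'" "W' \<subseteq> W" "smooth_on M W' N f"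
    using assms(2) by blast
  obtain V \<psi> W'' where "(V, \<psi>) \<in> atlas N" "openin (mtop M) W''" "x \<in> W''" "W'' \<subseteq> W'" "f ` W'' \<subseteq> V"
      "\<And>j. j < mdim N \<Longrightarrow> smooth_fn M W'' (\<lambda>x. \<psi> (f x) j)"
    using smooth_onE[OF W'(3,1)] by blast
  then show "smooth_at M W N f x"
    using W'(2) by blast
qed

lemma smooth_on_cong:
  assumes M: "charted M" and f: "smooth_on M W N f" and eq: "\<And>x. x \<in> W \<Longrightarrow> f x = g x"
  shows "smooth_on M W N g"
proof (rule smooth_onI[OF smooth_on_open[OF f]])
  fix x assume "x \<in> W"
  then obtain V \<psi> W' where c: "(V, \<psi>) \<in> atlas N" "openin (mtop M) W'" "x \<in> W'" "W' \<subseteq> W" "f ` W' \<subseteq> V"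
      "\<And>j. j < mdim N \<Longrightarrow> smooth_fn M W' (\<lambda>x. \<psi> (f x) j)"
    using smooth_onE[OF f] by blast
  have "smooth_fn M W' (\<lambda>x. \<psi> (g x) j)" if "j < mdim N" for j
    by (rule smooth_fn_cong[OF M c(2) _ c(6)[OF that]]) (use c(4) eq in auto)
  moreover have "g ` W' \<subseteq> V"
    using c(4,5) eq by fastforce
  ultimately show "smooth_at M W N g x"
    using c by (intro exI[of _ V] exI[of _ \<psi>] exI[of _ W']) auto
qed

lemma smooth_on_compose:
  assumes M: "charted M" and N: "charted N" and f: "smooth_on M W N f" and g: "smooth_on N V P g"
    and fV: "\<And>x. x \<in> W \<Longrightarrow> f x \<in> V"
  shows "smooth_on M W P (\<lambda>x. g (f x))"
proof (rule smooth_onI[OF smooth_on_open[OF f]])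
  fix x assume x: "x \<in> W"
  then obtain U \<psi> V' where c: "(U, \<psi>) \<in> atlas P" "openin (mtop N) V'" "f x \<in> V'" "V' \<subseteq> V" "g ` V' \<subseteq> U"
      "\<And>j. j < mdim P \<Longrightarrow> smooth_fn N V' (\<lambda>x. \<psi> (g x) j)"
    using smooth_onE[OF g fV] by metis
  let ?W = "{x \<in> W. f x \<in> V'}"
  have W: "openin (mtop M) ?W"
    using smooth_on_preimage_open[OF M N f c(2)] .
  have "smooth_fn M ?W (\<lambda>x. \<psi> (g (f x)) j)" if "j < mdim P" for j
    by (rule smooth_fn_pullback[OF M N smooth_on_subset[OF f W] c(2) c(6)[OF that]]) auto
  then show "smooth_at M W P (\<lambda>x. g (f x)) x"
    using x c(1,3,5) W by (intro exI[of _ U] exI[of _ \<psi>] exI[of _ ?W]) auto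
qed

lemma smooth_on_id:
  assumes "charted M" "openin (mtop M) W"
  shows "smooth_on M W M (\<lambda>x. x)"
proof (rule smooth_onI[OF assms(2)])
  fix x assume x: "x \<in> W"
  then obtain U \<phi> where c: "(U, \<phi>) \<in> atlas M" "x \<in> U"
    using charted_cover[OF assms(1)] openin_subset[OF assms(2)] by blast
  then show "smooth_at M W M (\<lambda>x. x) x"
    using x assms atlas_open[OF assms(1) c(1)] smooth_fn_coordinate[OF assms(1) c(1)]
    by (intro exI[of _ U] exI[of _ \<phi>] exI[of _ "U \<inter> W"]) (auto intro: smooth_fn_subset)
qed

lemma smooth_on_const:
  assumes "charted N" "openin (mtop M) W" "c \<in> mcarrier N"
  shows "smooth_on M W N (\<lambda>x. c)"
proof (rule smooth_onI[OF assms(2)])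
  fix x assume "x \<in> W"
  obtain V \<psi> where "(V, \<psi>) \<in> atlas N" "c \<in> V"
    using charted_cover[OF assms(1,3)] .
  then show "smooth_at M W N (\<lambda>x. c) x"
    using \<open>x \<in> W\<close> assms(2) by (intro exI[of _ V] exI[of _ \<psi>] exI[of _ W]) (auto intro: smooth_fn_const)
qed

text \<open>The passage between the definition and the form that is easy to work with. An arbitrary
  chart of N is recovered from the existential form by pulling back its coordinate
  functions.\<close>

lemma smooth_map_iff:
  assumes M: "charted M" and N: "charted N"
  shows "smooth_map M N f \<longleftrightarrow> smooth_on M (mcarrier M) N f"
proof
  assume f: "smooth_map M N f"
  then have cont: "continuous_map (mtop M) (mtop N) f"
    by (simp add: smooth_map_def)
  show "smooth_on M (mcarrier M) N f"
  proof (rule smooth_onI)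
    fix x assume x: "x \<in> mcarrier M"
    then have "f x \<in> mcarrier N"
      using continuous_map_image_subset_topspace[OF cont] by blast
    then obtain V \<psi> where d: "(V, \<psi>) \<in> atlas N" "f x \<in> V"
      using charted_cover[OF N] by metis
    let ?W = "{x \<in> mcarrier M. f x \<in> V}"
    have W: "openin (mtop M) ?W"
      using openin_continuous_map_preimage[OF cont atlas_open[OF N d(1)]] .
    have "smooth_fn M ?W (\<lambda>x. \<psi> (f x) j)" for j
      unfolding smooth_fn_def
    proof clarify
      fix U \<phi> assume c: "(U, \<phi>) \<in> atlas M"
      then have "U \<inter> ?W = U \<inter> f -` V"
        using atlas_subset[OF M c] by auto
      moreover have "euclid_smooth (mdim M) (\<phi> ` (U \<inter> f -` V)) (\<psi> \<circ> f \<circ> inv_into U \<phi>)"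
        using f c d(1) by (fastforce simp: smooth_map_def)
      ultimately show "smooth_real (mdim M) (\<phi> ` (U \<inter> ?W)) (\<lambda>y. \<psi> (f (inv_into U \<phi> y)) j)"
        by (simp add: euclid_smooth_iff)
    qed
    then show "smooth_at M (mcarrier M) N f x"
      using x d W by (intro exI[of _ V] exI[of _ \<psi>] exI[of _ ?W]) auto
  qed auto
next
  assume f: "smooth_on M (mcarrier M) N f"
  have "continuous_map (mtop M) (mtop N) f"
    using smooth_on_preimage_open[OF M N f] smooth_on_carrier[OF N f] by (auto simp: continuous_map)
  moreover have "euclid_smooth (mdim M) (\<phi> ` (U \<inter> f -` V)) (\<psi> \<circ> f \<circ> inv_into U \<phi>)"
    if c: "(U, \<phi>) \<in> atlas M" and d: "(V, \<psi>) \<in> atlas N" for U \<phi> V \<psi>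
  proof -
    let ?W = "{x \<in> mcarrier M. f x \<in> V}"
    have W: "openin (mtop M) ?W"
      using smooth_on_preimage_open[OF M N f atlas_open[OF N d]] .
    have "smooth_fn M ?W (\<lambda>x. \<psi> (f x) j)" for j
      by (rule smooth_fn_pullback[OF M N smooth_on_subset[OF f W] atlas_open[OF N d] smooth_fn_coordinate[OF N d]]) auto
    moreover have "U \<inter> ?W = U \<inter> f -` V"
      using atlas_subset[OF M c] by auto
    ultimately show ?thesis
      using smooth_fnD[OF _ c, of ?W] by (fastforce simp: euclid_smooth_iff)
  qed
  ultimately show "smooth_map M N f"
    by (auto simp: smooth_map_def)
qed

lemma smooth_map_compose:
  assumes "charted M" "charted N" "charted P" "smooth_map M N f" "smooth_map N P g"
  shows "smooth_map M P (\<lambda>x. g (f x))"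
proof -
  have "smooth_on M (mcarrier M) N f" "smooth_on N (mcarrier N) P g"
    using assms by (auto simp: smooth_map_iff)
  then show ?thesis
    using assms smooth_on_carrier[OF assms(2)]
    by (subst smooth_map_iff) (auto intro!: smooth_on_compose[OF assms(1,2), where V = "mcarrier N"])
qed

lemma smooth_map_cong:
  assumes "charted M" "charted N" "\<And>x. x \<in> mcarrier M \<Longrightarrow> f x = g x" "smooth_map M N f"
  shows "smooth_map M N g"
  using assms(3,4) unfolding smooth_map_iff[OF assms(1,2)] by (auto intro: smooth_on_cong[OF assms(1)])

lemma smooth_map_carrier: "smooth_map M N f \<Longrightarrow> x \<in> mcarrier M \<Longrightarrow> f x \<in> mcarrier N"
  using continuous_map_image_subset_topspace by (fastforce simp: smooth_map_def)

subsection \<open>Constructions of manifolds\<close>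

text \<open>Near each point the transition factors through a chart of the covering family A. This is
  why members of the maximal atlas generated by A are compatible with each other although they are
  only required to be compatible with A.\<close>

lemma transition_through_charts:
  assumes c: "is_chart T n (U, \<phi>)" and d: "is_chart T n (V, \<psi>)"
    and A: "\<And>S \<sigma>. (S, \<sigma>) \<in> A \<Longrightarrow> is_chart T n (S, \<sigma>) \<and> compatible n (U, \<phi>) (S, \<sigma>) \<and> compatible n (V, \<psi>) (S, \<sigma>)"
    and cover: "\<And>x. x \<in> U \<inter> V \<Longrightarrow> \<exists>S \<sigma>. (S, \<sigma>) \<in> A \<and> x \<in> S"
  shows "euclid_smooth n (\<phi> ` (U \<inter> V)) (\<psi> \<circ> inv_into U \<phi>)"
proof (rule euclid_smooth_local)
  fix y assume "y \<in> \<phi> ` (U \<inter> V)"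
  then obtain x where x: "x \<in> U" "x \<in> V" "y = \<phi> x"
    by blast
  then obtain S \<sigma> where S: "(S, \<sigma>) \<in> A" "x \<in> S"
    using cover by blast
  note a = A[OF S(1), THEN conjunct1]
  have "openin T (U \<inter> V \<inter> S)" "openin T (S \<inter> V)"
    using chart_open[OF c] chart_open[OF d] chart_open[OF a] by auto
  then have opens: "openin (Euclidean_space n) (\<phi> ` (U \<inter> V \<inter> S))" "openin (Euclidean_space n) (\<sigma> ` (S \<inter> V))"
    using chart_image_open[OF c] chart_image_open[OF a] by auto
  have inv: "inv_into U \<phi> (\<phi> z) = z" if "z \<in> U" for z
    using chart_inj[OF c] that by simp
  have "euclid_smooth n (\<phi> ` (U \<inter> V \<inter> S)) ((\<psi> \<circ> inv_into S \<sigma>) \<circ> (\<sigma> \<circ> inv_into U \<phi>))"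
  proof (rule euclid_smooth_compose[OF opens])
    show "euclid_smooth n (\<phi> ` (U \<inter> V \<inter> S)) (\<sigma> \<circ> inv_into U \<phi>)"
      using A[OF S(1)] by (auto simp: compatible_def intro: euclid_smooth_subset)
    show "euclid_smooth n (\<sigma> ` (S \<inter> V)) (\<psi> \<circ> inv_into S \<sigma>)"
      using A[OF S(1)] by (auto simp: compatible_def Int_commute)
  qed (auto simp: inv)
  then have "euclid_smooth n (\<phi> ` (U \<inter> V \<inter> S)) (\<psi> \<circ> inv_into U \<phi>)"
    by (rule euclid_smooth_cong[OF opens(1), rotated]) (auto simp: inv chart_inj[OF a])
  then show "\<exists>W. openin (Euclidean_space n) W \<and> y \<in> W \<and> euclid_smooth n W (\<psi> \<circ> inv_into U \<phi>)"
    using opens(1) x S(2) by blast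
qed

lemma manifold_by_simps [simp]:
  "mtop (manifold_by T n A) = T" "mdim (manifold_by T n A) = n" "atlas (manifold_by T n A) = max_atlas T n A"
  by (simp_all add: manifold_by_def)

text \<open>Every constructed manifold enters through this: it is described by a few explicit
  charts, but its atlas is the maximal one, so both the structure and the membership of the explicit
  charts are needed.\<close>

lemma charted_manifold_by:
  assumes A: "\<And>c. c \<in> A \<Longrightarrow> is_chart T n c" "\<And>c d. c \<in> A \<Longrightarrow> d \<in> A \<Longrightarrow> compatible n c d"
    and cover: "(\<Union>(U, \<phi>)\<in>A. U) = topspace T"
  shows "charted (manifold_by T n A) \<and> A \<subseteq> atlas (manifold_by T n A)"
proof -
  have sub: "A \<subseteq> atlas (manifold_by T n A)"
    using A by (auto simp: max_atlas_def)
  have "compatible n c d" if c: "c \<in> max_atlas T n A" and d: "d \<in> max_atlas T n A" for c d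
  proof -
    obtain U \<phi> V \<psi> where cd: "c = (U, \<phi>)" "d = (V, \<psi>)"
      by (metis surj_pair)
    have ch: "is_chart T n (U, \<phi>)" "is_chart T n (V, \<psi>)"
      using c d cd by (auto simp: max_atlas_def)
    have "\<exists>S \<sigma>. (S, \<sigma>) \<in> A \<and> x \<in> S" if "x \<in> U \<inter> V" for x
      using that openin_subset[OF chart_open[OF ch(1)]] cover by blast
    moreover have "is_chart T n (S, \<sigma>) \<and> compatible n (U, \<phi>) (S, \<sigma>) \<and> compatible n (V, \<psi>) (S, \<sigma>)"
      if "(S, \<sigma>) \<in> A" for S \<sigma>
      using that c d cd A(1) by (auto simp: max_atlas_def)
    ultimately show ?thesis
      using transition_through_charts[OF ch, of A] transition_through_charts[OF ch(2,1), of A]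
      unfolding compatible_def cd by (simp add: Int_commute)
  qed
  moreover have "(\<Union>(U, \<phi>)\<in>max_atlas T n A. U) = topspace T"
  proof
    show "(\<Union>(U, \<phi>)\<in>max_atlas T n A. U) \<subseteq> topspace T"
      by (auto simp: max_atlas_def dest!: chart_open openin_subset)
    show "topspace T \<subseteq> (\<Union>(U, \<phi>)\<in>max_atlas T n A. U)"
      using sub cover by fastforce
  qed
  ultimately have "charted (manifold_by T n A)"
    by (auto simp: charted_def max_atlas_def)
  with sub show ?thesis
    by blast
qed

section \<open>Products of manifolds\<close>

definition fst_coords :: "nat \<Rightarrow> (nat \<Rightarrow> real) \<Rightarrow> nat \<Rightarrow> real" where
  "fst_coords m z = (\<lambda>i. if i < m then z i else 0)"

text \<open>Unlike the first half, this one needs no cut-off: if z vanishes from m + n on, the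
  shifted sequence vanishes from n on.\<close>

definition snd_coords :: "nat \<Rightarrow> (nat \<Rightarrow> real) \<Rightarrow> nat \<Rightarrow> real" where
  "snd_coords m z = (\<lambda>i. z (m + i))"

lemma juxtapose_in_Euclidean_space:
  "x \<in> topspace (Euclidean_space m) \<Longrightarrow> y \<in> topspace (Euclidean_space n) \<Longrightarrow>
    juxtapose m x y \<in> topspace (Euclidean_space (m + n))"
  by (auto simp: juxtapose_def topspace_Euclidean_space)

lemma fst_coords_juxtapose: "x \<in> topspace (Euclidean_space m) \<Longrightarrow> fst_coords m (juxtapose m x y) = x"
  by (auto simp: fst_coords_def juxtapose_def topspace_Euclidean_space)

lemma snd_coords_juxtapose: "snd_coords m (juxtapose m x y) = y"
  by (auto simp: snd_coords_def juxtapose_def)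

lemma juxtapose_coords: "juxtapose m (fst_coords m z) (snd_coords m z) = z"
  by (auto simp: fst_coords_def snd_coords_def juxtapose_def)

lemma fst_coords_in_Euclidean_space: "fst_coords m z \<in> topspace (Euclidean_space m)"
  by (auto simp: fst_coords_def topspace_Euclidean_space)

lemma snd_coords_in_Euclidean_space:
  "z \<in> topspace (Euclidean_space (m + n)) \<Longrightarrow> snd_coords m z \<in> topspace (Euclidean_space n)"
  by (auto simp: snd_coords_def topspace_Euclidean_space)

lemma continuous_map_fst_coords:
  "continuous_map (subtopology (Euclidean_space (m + n)) S) (Euclidean_space m) (fst_coords m)"
  by (intro continuous_map_into_Euclidean_space fst_coords_in_Euclidean_space)
    (simp add: fst_coords_def continuous_map_Euclidean_coordinate)

lemma continuous_map_snd_coords: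
  "continuous_map (subtopology (Euclidean_space (m + n)) S) (Euclidean_space n) (snd_coords m)"
  by (intro continuous_map_into_Euclidean_space)
    (auto simp: snd_coords_in_Euclidean_space, simp add: snd_coords_def continuous_map_Euclidean_coordinate)

lemma juxtapose_image:
  assumes "A \<subseteq> topspace (Euclidean_space m)" "B \<subseteq> topspace (Euclidean_space n)"
  shows "(\<lambda>(x, y). juxtapose m x y) ` (A \<times> B) =
    {z \<in> topspace (Euclidean_space (m + n)). fst_coords m z \<in> A \<and> snd_coords m z \<in> B}"
proof -
  have "z \<in> (\<lambda>(x, y). juxtapose m x y) ` (A \<times> B)" if "fst_coords m z \<in> A" "snd_coords m z \<in> B" for z
    using that by (intro image_eqI[of _ _ "(fst_coords m z, snd_coords m z)"]) (auto simp: juxtapose_coords)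
  then show ?thesis
    using assms
    by (auto simp: fst_coords_juxtapose snd_coords_juxtapose subset_iff intro!: juxtapose_in_Euclidean_space)
qed

lemma juxtapose_image_open:
  assumes A: "openin (Euclidean_space m) A" and B: "openin (Euclidean_space n) B"
  shows "openin (Euclidean_space (m + n)) ((\<lambda>(x, y). juxtapose m x y) ` (A \<times> B))"
proof -
  let ?E = "Euclidean_space (m + n)"
  have "openin ?E {z \<in> topspace ?E. fst_coords m z \<in> A}" "openin ?E {z \<in> topspace ?E. snd_coords m z \<in> B}"
    using openin_continuous_map_preimage[OF continuous_map_fst_coords[of m n "topspace ?E"] A]
      openin_continuous_map_preimage[OF continuous_map_snd_coords[of m n "topspace ?E"] B] by auto
  moreover have "{z \<in> topspace ?E. fst_coords m z \<in> A} \<inter> {z \<in> topspace ?E. snd_coords m z \<in> B} =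
      {z \<in> topspace ?E. fst_coords m z \<in> A \<and> snd_coords m z \<in> B}"
    by blast
  ultimately show ?thesis
    using openin_Int[of ?E "{z \<in> topspace ?E. fst_coords m z \<in> A}" "{z \<in> topspace ?E. snd_coords m z \<in> B}"]
    unfolding juxtapose_image[OF openin_subset[OF A] openin_subset[OF B]] by simp
qed

lemma smooth_real_fst_coords:
  assumes "openin (Euclidean_space k) J" "openin (Euclidean_space m) A" "smooth_real m A f"
    "\<And>z. z \<in> J \<Longrightarrow> fst_coords m z \<in> A"
  shows "smooth_real k J (\<lambda>z. f (fst_coords m z))"
  by (rule smooth_real_compose[OF assms(1,2,4) _ assms(3)]) (simp_all add: fst_coords_def smooth_real_coordinate)

lemma smooth_real_snd_coords:
  assumes "openin (Euclidean_space k) J" "openin (Euclidean_space n) A" "smooth_real n A f"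
    "\<And>z. z \<in> J \<Longrightarrow> snd_coords m z \<in> A"
  shows "smooth_real k J (\<lambda>z. f (snd_coords m z))"
  by (rule smooth_real_compose[OF assms(1,2,4) _ assms(3)]) (simp_all add: snd_coords_def smooth_real_coordinate)

definition prod_chart :: "nat \<Rightarrow> 'a chart \<Rightarrow> 'b chart \<Rightarrow> ('a \<times> 'b) chart" where
  "prod_chart m c d = (fst c \<times> fst d, \<lambda>(x, y)\<in>fst c \<times> fst d. juxtapose m (snd c x) (snd d y))"

lemma prod_manifold_eq:
  "prod_manifold M N = manifold_by (prod_topology (mtop M) (mtop N)) (mdim M + mdim N)
     {prod_chart (mdim M) c d | c d. c \<in> atlas M \<and> d \<in> atlas N}"
proof -
  have "{(U \<times> V, \<lambda>(x, y)\<in>U \<times> V. juxtapose (mdim M) (\<phi> x) (\<psi> y)) | U \<phi> V \<psi>.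
        (U, \<phi>) \<in> atlas M \<and> (V, \<psi>) \<in> atlas N} = {prod_chart (mdim M) c d | c d. c \<in> atlas M \<and> d \<in> atlas N}"
    unfolding prod_chart_def by force
  then show ?thesis
    by (simp add: prod_manifold_def)
qed

lemma prod_chart_image:
  assumes "S \<subseteq> U" "R \<subseteq> V"
  shows "snd (prod_chart m (U, \<phi>) (V, \<psi>)) ` (S \<times> R) = (\<lambda>(x, y). juxtapose m x y) ` (\<phi> ` S \<times> \<psi> ` R)"
  using assms unfolding prod_chart_def by (force simp: image_iff)

text \<open>The explicit inverse does double duty: its continuity makes the product a chart, and it
  computes the \<open>inv_into\<close> that the definition of smoothness refers to.\<close>

lemma
  assumes c: "is_chart S m (U, \<phi>)" and d: "is_chart T n (V, \<psi>)"
  shows prod_chart: "is_chart (prod_topology S T) (m + n) (prod_chart m (U, \<phi>) (V, \<psi>))"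
    and prod_chart_inv: "\<And>z. z \<in> snd (prod_chart m (U, \<phi>) (V, \<psi>)) ` (U \<times> V) \<Longrightarrow>
      inv_into (U \<times> V) (snd (prod_chart m (U, \<phi>) (V, \<psi>))) z =
        (inv_into U \<phi> (fst_coords m z), inv_into V \<psi> (snd_coords m z))"
proof -
  let ?E = "Euclidean_space (m + n)"
  let ?c = "snd (prod_chart m (U, \<phi>) (V, \<psi>))"
  let ?J = "?c ` (U \<times> V)"
  let ?k = "\<lambda>z. (inv_into U \<phi> (fst_coords m z), inv_into V \<psi> (snd_coords m z))"
  have J: "?J = (\<lambda>(x, y). juxtapose m x y) ` (\<phi> ` U \<times> \<psi> ` V)"
    by (rule prod_chart_image) auto
  have open_J: "openin ?E ?J"
    unfolding J by (intro juxtapose_image_open chart_image[OF c] chart_image[OF d])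
  have J_coords: "fst_coords m z \<in> \<phi> ` U" "snd_coords m z \<in> \<psi> ` V" if "z \<in> ?J" for z
    using that chart_in_Euclidean_space[OF c] chart_in_Euclidean_space[OF d]
    unfolding J by (auto simp: fst_coords_juxtapose snd_coords_juxtapose)
  have inverse: "?k (?c p) = p" if "p \<in> U \<times> V" for p
    using that chart_in_Euclidean_space[OF c] chart_inj[OF c] chart_inj[OF d]
    by (auto simp: prod_chart_def fst_coords_juxtapose snd_coords_juxtapose)
  have "inj_on ?c (U \<times> V)"
    using inverse by (intro inj_on_inverseI)
  then show "inv_into (U \<times> V) ?c z = ?k z" if "z \<in> ?J" for z
    using that inverse by auto
  have "is_chart (prod_topology S T) (m + n) (U \<times> V, ?c)"
  proof (rule is_chartI[where \<kappa> = ?k])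
    show "openin (prod_topology S T) (U \<times> V)"
      using chart_open[OF c] chart_open[OF d] by (simp add: openin_prod_Times_iff)
    show "?c \<in> extensional (U \<times> V)"
      by (simp add: prod_chart_def)
    show "continuous_map (subtopology (prod_topology S T) (U \<times> V)) ?E ?c"
    proof (rule continuous_map_into_Euclidean_space)
      have cont1: "continuous_map (subtopology S U) euclideanreal (\<lambda>x. \<phi> x j)" for j
        using continuous_map_compose[OF chart_continuous[OF c], of euclideanreal "\<lambda>x. x j"]
          continuous_map_Euclidean_coordinate[of m "topspace (Euclidean_space m)" j]
        by (simp add: comp_def)
      have cont2: "continuous_map (subtopology T V) euclideanreal (\<lambda>x. \<psi> x j)" for j
        using continuous_map_compose[OF chart_continuous[OF d], of euclideanreal "\<lambda>x. x j"]
          continuous_map_Euclidean_coordinate[of n "topspace (Euclidean_space n)" j]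
        by (simp add: comp_def)
      fix j
      have "continuous_map (prod_topology (subtopology S U) (subtopology T V)) euclideanreal
          (\<lambda>p. juxtapose m (\<phi> (fst p)) (\<psi> (snd p)) j)"
        using continuous_map_compose[OF continuous_map_fst[of "subtopology S U" "subtopology T V"] cont1[of j]]
          continuous_map_compose[OF continuous_map_snd[of "subtopology S U" "subtopology T V"] cont2[of "j - m"]]
        by (simp add: comp_def juxtapose_def)
      then have "continuous_map (subtopology (prod_topology S T) (U \<times> V)) euclideanreal
          (\<lambda>p. juxtapose m (\<phi> (fst p)) (\<psi> (snd p)) j)"
        by (simp only: subtopology_Times)
      then show "continuous_map (subtopology (prod_topology S T) (U \<times> V)) euclideanreal (\<lambda>p. ?c p j)"
        by (rule continuous_map_eq) (auto simp: prod_chart_def)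
    qed (use openin_subset[OF open_J] in auto)
    have "continuous_map (subtopology ?E ?J) (subtopology (Euclidean_space m) (\<phi> ` U)) (fst_coords m)"
      "continuous_map (subtopology ?E ?J) (subtopology (Euclidean_space n) (\<psi> ` V)) (snd_coords m)"
      using J_coords by (auto simp: continuous_map_in_subtopology continuous_map_fst_coords continuous_map_snd_coords)
    from continuous_map_compose[OF this(1) chart_inverse_continuous[OF c]]
      continuous_map_compose[OF this(2) chart_inverse_continuous[OF d]]
    show "continuous_map (subtopology ?E ?J) (prod_topology S T) ?k"
      by (simp add: continuous_map_pairwise comp_def)
  qed (use open_J inverse in auto)
  then show "is_chart (prod_topology S T) (m + n) (prod_chart m (U, \<phi>) (V, \<psi>))"
    by (simp add: prod_chart_def)
qed

text \<open>In coordinates this is the juxtaposition of the two transition maps, each acting on its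
  own half.\<close>

lemma prod_chart_transition:
  assumes M: "charted M" "(U, \<phi>) \<in> atlas M" "(U', \<phi>') \<in> atlas M"
    and N: "charted N" "(V, \<psi>) \<in> atlas N" "(V', \<psi>') \<in> atlas N"
  shows "euclid_smooth (mdim M + mdim N)
      (snd (prod_chart (mdim M) (U, \<phi>) (V, \<psi>)) ` ((U \<times> V) \<inter> (U' \<times> V')))
      (snd (prod_chart (mdim M) (U', \<phi>') (V', \<psi>')) \<circ> inv_into (U \<times> V) (snd (prod_chart (mdim M) (U, \<phi>) (V, \<psi>))))"
proof -
  let ?m = "mdim M" and ?n = "mdim N"
  let ?c = "snd (prod_chart ?m (U, \<phi>) (V, \<psi>))" and ?c' = "snd (prod_chart ?m (U', \<phi>') (V', \<psi>'))"
  let ?J = "?c ` ((U \<times> V) \<inter> (U' \<times> V'))"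
  let ?f = "\<lambda>x. \<phi>' (inv_into U \<phi> x)" and ?g = "\<lambda>x. \<psi>' (inv_into V \<psi> x)"
  note c = charted_chart[OF M(1,2)] and d = charted_chart[OF N(1,2)]
  have J: "?J = (\<lambda>(x, y). juxtapose ?m x y) ` (\<phi> ` (U \<inter> U') \<times> \<psi> ` (V \<inter> V'))"
    unfolding Times_Int_Times by (rule prod_chart_image) auto
  have opens: "openin (Euclidean_space ?m) (\<phi> ` (U \<inter> U'))" "openin (Euclidean_space ?n) (\<psi> ` (V \<inter> V'))"
    using atlas_image_open[OF M(1,2) atlas_open[OF M(1,3)]] atlas_image_open[OF N(1,2) atlas_open[OF N(1,3)]] by auto
  then have open_J: "openin (Euclidean_space (?m + ?n)) ?J"
    unfolding J by (intro juxtapose_image_open)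
  have J_coords: "fst_coords ?m z \<in> \<phi> ` (U \<inter> U')" "snd_coords ?m z \<in> \<psi> ` (V \<inter> V')" if "z \<in> ?J" for z
    using that openin_subset[OF opens(1)] openin_subset[OF opens(2)] unfolding J by (auto simp: juxtapose_image)
  have "smooth_real (?m + ?n) ?J (\<lambda>z. juxtapose ?m (?f (fst_coords ?m z)) (?g (snd_coords ?m z)) j)" for j
  proof (cases "j < ?m")
    case True
    have "smooth_real (?m + ?n) ?J (\<lambda>z. ?f (fst_coords ?m z) j)"
      by (rule smooth_real_fst_coords[OF open_J opens(1) _ J_coords(1)])
        (use charted_transition[OF M] in \<open>simp_all add: euclid_smooth_iff\<close>)
    then show ?thesis
      using True by (simp add: juxtapose_def)
  next
    case False
    have "smooth_real (?m + ?n) ?J (\<lambda>z. ?g (snd_coords ?m z) (j - ?m))"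
      by (rule smooth_real_snd_coords[OF open_J opens(2) _ J_coords(2)])
        (use charted_transition[OF N] in \<open>simp_all add: euclid_smooth_iff\<close>)
    then show ?thesis
      using False by (simp add: juxtapose_def)
  qed
  then have "euclid_smooth (?m + ?n) ?J (\<lambda>z. juxtapose ?m (?f (fst_coords ?m z)) (?g (snd_coords ?m z)))"
    by (simp add: euclid_smooth_iff)
  then show ?thesis
  proof (rule euclid_smooth_cong[OF open_J, rotated])
    fix z assume z: "z \<in> ?J"
    then have "z \<in> ?c ` (U \<times> V)"
      by blast
    moreover have "inv_into U \<phi> (fst_coords ?m z) \<in> U'" "inv_into V \<psi> (snd_coords ?m z) \<in> V'"
      using J_coords[OF z] chart_inj[OF c] chart_inj[OF d] by auto
    ultimately show "juxtapose ?m (?f (fst_coords ?m z)) (?g (snd_coords ?m z)) =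
        (?c' \<circ> inv_into (U \<times> V) ?c) z"
      using prod_chart_inv[OF c d, of z] by (simp add: prod_chart_def)
  qed
qed

lemma prod_manifold_simps [simp]:
  "mtop (prod_manifold M N) = prod_topology (mtop M) (mtop N)"
  "mdim (prod_manifold M N) = mdim M + mdim N"
  by (simp_all add: prod_manifold_def)

lemma
  assumes M: "charted M" and N: "charted N"
  shows charted_prod_manifold: "charted (prod_manifold M N)"
    and prod_chart_in_atlas: "\<And>c d. c \<in> atlas M \<Longrightarrow> d \<in> atlas N \<Longrightarrow>
      prod_chart (mdim M) c d \<in> atlas (prod_manifold M N)"
proof -
  let ?A = "{prod_chart (mdim M) c d | c d. c \<in> atlas M \<and> d \<in> atlas N}"
  let ?T = "prod_topology (mtop M) (mtop N)" and ?n = "mdim M + mdim N"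
  have "is_chart ?T ?n e" if "e \<in> ?A" for e
    using that charted_chart[OF M] charted_chart[OF N] by (auto intro!: prod_chart)
  moreover have "compatible ?n e e'" if e: "e \<in> ?A" and e': "e' \<in> ?A" for e e'
  proof -
    obtain U \<phi> V \<psi> where *: "(U, \<phi>) \<in> atlas M" "(V, \<psi>) \<in> atlas N" "e = prod_chart (mdim M) (U, \<phi>) (V, \<psi>)"
      using e by auto
    obtain U' \<phi>' V' \<psi>' where **: "(U', \<phi>') \<in> atlas M" "(V', \<psi>') \<in> atlas N" "e' = prod_chart (mdim M) (U', \<phi>') (V', \<psi>')"
      using e' by auto
    have "fst e = U \<times> V" "fst e' = U' \<times> V'"
      by (auto simp: prod_chart_def * **)
    then show ?thesis
      using prod_chart_transition[OF M *(1) **(1) N *(2) **(2)] prod_chart_transition[OF M **(1) *(1) N **(2) *(2)]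
      by (simp add: compatible_def case_prod_beta Int_commute flip: *(3) **(3))
  qed
  moreover have "(\<Union>(U, \<phi>)\<in>?A. U) = topspace ?T"
  proof (intro equalityI subsetI)
    fix p assume "p \<in> (\<Union>(U, \<phi>)\<in>?A. U)"
    then show "p \<in> topspace ?T"
      using atlas_subset[OF M] atlas_subset[OF N] by (fastforce simp: prod_chart_def)
  next
    fix p assume "p \<in> topspace ?T"
    then obtain x y where p: "p = (x, y)" "x \<in> mcarrier M" "y \<in> mcarrier N"
      by auto
    obtain U \<phi> where "(U, \<phi>) \<in> atlas M" "x \<in> U"
      using charted_cover[OF M p(2)] .
    moreover obtain V \<psi> where "(V, \<psi>) \<in> atlas N" "y \<in> V"
      using charted_cover[OF N p(3)] .
    ultimately have "prod_chart (mdim M) (U, \<phi>) (V, \<psi>) \<in> ?A" "p \<in> fst (prod_chart (mdim M) (U, \<phi>) (V, \<psi>))"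
      using p(1) by (auto simp: prod_chart_def)
    then show "p \<in> (\<Union>(U, \<phi>)\<in>?A. U)"
      unfolding case_prod_beta by (rule UN_I)
  qed
  ultimately have *: "charted (manifold_by ?T ?n ?A) \<and> ?A \<subseteq> atlas (manifold_by ?T ?n ?A)"
    by (rule charted_manifold_by)
  then show "charted (prod_manifold M N)"
    unfolding prod_manifold_eq by blast
  show "prod_chart (mdim M) c d \<in> atlas (prod_manifold M N)" if "c \<in> atlas M" "d \<in> atlas N" for c d
    using that * unfolding prod_manifold_eq by blast
qed

text \<open>In a product chart the coordinates of \<open>fst p\<close> are the leading
  \<open>mdim M\<close> coordinates of p and those of \<open>snd p\<close> are the remaining
  ones.\<close>

lemma
  assumes M: "charted M" and N: "charted N"
  shows smooth_map_fst: "smooth_map (prod_manifold M N) M fst"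
    and smooth_map_snd: "smooth_map (prod_manifold M N) N snd"
proof -
  let ?P = "prod_manifold M N"
  note P = charted_prod_manifold[OF M N]
  have chart: "\<exists>U \<phi> V \<psi>. (U, \<phi>) \<in> atlas M \<and> (V, \<psi>) \<in> atlas N \<and> openin (mtop ?P) (U \<times> V) \<and> p \<in> U \<times> V \<and>
      U \<times> V \<subseteq> mcarrier ?P \<and> (\<forall>j. smooth_fn ?P (U \<times> V) (\<lambda>p. juxtapose (mdim M) (\<phi> (fst p)) (\<psi> (snd p)) j))"
    if "p \<in> mcarrier ?P" for p
  proof -
    obtain x y where p: "p = (x, y)" "x \<in> mcarrier M" "y \<in> mcarrier N"
      using \<open>p \<in> mcarrier ?P\<close> by auto
    obtain U \<phi> where c: "(U, \<phi>) \<in> atlas M" "x \<in> U"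
      using charted_cover[OF M p(2)] .
    obtain V \<psi> where d: "(V, \<psi>) \<in> atlas N" "y \<in> V"
      using charted_cover[OF N p(3)] .
    have e: "(U \<times> V, snd (prod_chart (mdim M) (U, \<phi>) (V, \<psi>))) \<in> atlas ?P"
      using prod_chart_in_atlas[OF M N c(1) d(1)] by (simp add: prod_chart_def)
    have "smooth_fn ?P (U \<times> V) (\<lambda>p. juxtapose (mdim M) (\<phi> (fst p)) (\<psi> (snd p)) j)" for j
      by (rule smooth_fn_cong[OF P atlas_open[OF P e] _ smooth_fn_coordinate[OF P e]]) (auto simp: prod_chart_def)
    then show ?thesis
      using c d p atlas_open[OF P e] atlas_subset[OF P e] by blast
  qed
  have "smooth_on ?P (mcarrier ?P) M fst"
  proof (rule smooth_onI)
    fix p assume "p \<in> mcarrier ?P"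
    obtain U \<phi> V \<psi> where *: "(U, \<phi>) \<in> atlas M" "openin (mtop ?P) (U \<times> V)" "p \<in> U \<times> V"
      "U \<times> V \<subseteq> mcarrier ?P" "\<And>j. smooth_fn ?P (U \<times> V) (\<lambda>p. juxtapose (mdim M) (\<phi> (fst p)) (\<psi> (snd p)) j)"
      using chart[OF \<open>p \<in> mcarrier ?P\<close>] by blast
    have "smooth_fn ?P (U \<times> V) (\<lambda>p. \<phi> (fst p) j)" if "j < mdim M" for j
      using *(5)[of j] that by (simp add: juxtapose_def)
    then show "smooth_at ?P (mcarrier ?P) M fst p"
      using * by (intro exI[of _ U] exI[of _ \<phi>] exI[of _ "U \<times> V"]) auto
  qed (rule openin_topspace)
  then show "smooth_map ?P M fst"
    by (simp add: smooth_map_iff[OF P M])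
  have "smooth_on ?P (mcarrier ?P) N snd"
  proof (rule smooth_onI)
    fix p assume "p \<in> mcarrier ?P"
    obtain U \<phi> V \<psi> where *: "(V, \<psi>) \<in> atlas N" "openin (mtop ?P) (U \<times> V)" "p \<in> U \<times> V"
      "U \<times> V \<subseteq> mcarrier ?P" "\<And>j. smooth_fn ?P (U \<times> V) (\<lambda>p. juxtapose (mdim M) (\<phi> (fst p)) (\<psi> (snd p)) j)"
      using chart[OF \<open>p \<in> mcarrier ?P\<close>] by blast
    have "smooth_fn ?P (U \<times> V) (\<lambda>p. \<psi> (snd p) j)" for j
      using *(5)[of "mdim M + j"] by (simp add: juxtapose_def)
    then show "smooth_at ?P (mcarrier ?P) N snd p"
      using * by (intro exI[of _ V] exI[of _ \<psi>] exI[of _ "U \<times> V"]) auto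
  qed (rule openin_topspace)
  then show "smooth_map ?P N snd"
    by (simp add: smooth_map_iff[OF P N])
qed

lemma smooth_on_Pair:
  assumes M: "charted M" and N: "charted N" and P: "charted P"
    and f: "smooth_on M W N f" and g: "smooth_on M W P g"
  shows "smooth_on M W (prod_manifold N P) (\<lambda>x. (f x, g x))"
proof (rule smooth_onI[OF smooth_on_open[OF f]])
  fix x assume x: "x \<in> W"
  obtain U \<phi> W1 where 1: "(U, \<phi>) \<in> atlas N" "openin (mtop M) W1" "x \<in> W1" "W1 \<subseteq> W" "f ` W1 \<subseteq> U"
      "\<And>j. j < mdim N \<Longrightarrow> smooth_fn M W1 (\<lambda>x. \<phi> (f x) j)"
    using smooth_onE[OF f x] by blast
  obtain V \<psi> W2 where 2: "(V, \<psi>) \<in> atlas P" "openin (mtop M) W2" "x \<in> W2" "W2 \<subseteq> W" "g ` W2 \<subseteq> V"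
      "\<And>j. j < mdim P \<Longrightarrow> smooth_fn M W2 (\<lambda>x. \<psi> (g x) j)"
    using smooth_onE[OF g x] by blast
  let ?W = "W1 \<inter> W2" and ?c = "prod_chart (mdim N) (U, \<phi>) (V, \<psi>)"
  have W: "openin (mtop M) ?W"
    using 1 2 by blast
  have "smooth_fn M ?W (\<lambda>x. snd ?c (f x, g x) j)" if "j < mdim N + mdim P" for j
  proof (rule smooth_fn_cong[OF M W])
    show "smooth_fn M ?W (\<lambda>x. juxtapose (mdim N) (\<phi> (f x)) (\<psi> (g x)) j)"
    proof (cases "j < mdim N")
      case True
      then show ?thesis
        using smooth_fn_subset[OF 1(6), of j ?W] by (simp add: juxtapose_def)
    next
      case False
      then have "j - mdim N < mdim P"
        using that by linarith
      then show ?thesis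
        using smooth_fn_subset[OF 2(6), of "j - mdim N" ?W] False by (simp add: juxtapose_def)
    qed
  qed (use 1(5) 2(5) in \<open>auto simp: prod_chart_def\<close>)
  moreover have "(U \<times> V, snd ?c) \<in> atlas (prod_manifold N P)"
    using prod_chart_in_atlas[OF N P 1(1) 2(1)] by (simp add: prod_chart_def)
  ultimately show "smooth_at M W (prod_manifold N P) (\<lambda>x. (f x, g x)) x"
    using W 1 2 by (intro exI[of _ "U \<times> V"] exI[of _ "snd ?c"] exI[of _ ?W]) auto
qed

lemma smooth_map_Pair:
  assumes "charted M" "charted N" "charted P" "smooth_map M N f" "smooth_map M P g"
  shows "smooth_map M (prod_manifold N P) (\<lambda>x. (f x, g x))"
  using assms smooth_on_Pair[OF assms(1-3)] by (simp add: smooth_map_iff charted_prod_manifold)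

lemma smooth_map_id: "charted M \<Longrightarrow> smooth_map M M (\<lambda>x. x)"
  by (simp add: smooth_map_iff smooth_on_id)

lemma smooth_map_const: "charted M \<Longrightarrow> charted N \<Longrightarrow> c \<in> mcarrier N \<Longrightarrow> smooth_map M N (\<lambda>x. c)"
  by (simp add: smooth_map_iff smooth_on_const)

section \<open>Euclidean space and open submanifolds\<close>

lemma euclid_manifold_simps [simp]:
  "mtop (euclid_manifold n) = Euclidean_space n" "mdim (euclid_manifold n) = n"
  by (simp_all add: euclid_manifold_def)

lemma
  shows charted_euclid_manifold: "charted (euclid_manifold n)"
    and euclid_chart_in_atlas: "(topspace (Euclidean_space n), \<lambda>x\<in>topspace (Euclidean_space n). x) \<in> atlas (euclid_manifold n)"
proof -
  let ?S = "topspace (Euclidean_space n)"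
  let ?A = "{(?S, \<lambda>x\<in>?S. x)}"
  have chart: "is_chart (Euclidean_space n) n (?S, \<lambda>x\<in>?S. x)"
    by (rule is_chartI[where \<kappa> = "\<lambda>x. x"]) (auto intro: continuous_map_eq[OF continuous_map_id[unfolded id_def]])
  have "euclid_smooth n ?S ((\<lambda>x\<in>?S. x) \<circ> inv_into ?S (\<lambda>x\<in>?S. x))"
  proof (rule euclid_smooth_cong[OF _ _ euclid_smooth_id])
    fix y assume y: "y \<in> ?S"
    then have "y \<in> (\<lambda>x\<in>?S. x) ` ?S"
      by auto
    from f_inv_into_f[OF this] show "y = ((\<lambda>x\<in>?S. x) \<circ> inv_into ?S (\<lambda>x\<in>?S. x)) y"
      by simp
  qed auto
  then have "compatible n (?S, \<lambda>x\<in>?S. x) (?S, \<lambda>x\<in>?S. x)"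
    by (simp add: compatible_def)
  then have "charted (manifold_by (Euclidean_space n) n ?A) \<and> ?A \<subseteq> atlas (manifold_by (Euclidean_space n) n ?A)"
    using chart by (intro charted_manifold_by) auto
  then show "charted (euclid_manifold n)" "(?S, \<lambda>x\<in>?S. x) \<in> atlas (euclid_manifold n)"
    by (auto simp: euclid_manifold_def)
qed

lemma smooth_on_euclid_manifold:
  assumes M: "charted M" and W: "openin (mtop M) W"
    and f: "\<And>x. x \<in> W \<Longrightarrow> f x \<in> topspace (Euclidean_space n)" "\<And>j. j < n \<Longrightarrow> smooth_fn M W (\<lambda>x. f x j)"
  shows "smooth_on M W (euclid_manifold n) f"
proof (rule smooth_onI[OF W])
  fix x assume x: "x \<in> W"
  let ?S = "topspace (Euclidean_space n)"
  have "smooth_fn M W (\<lambda>x. (\<lambda>x\<in>?S. x) (f x) j)" if "j < n" for j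
    by (rule smooth_fn_cong[OF M W _ f(2)[OF that]]) (use f(1) in simp)
  then show "smooth_at M W (euclid_manifold n) f x"
    using euclid_chart_in_atlas[of n] W x f(1)
    by (intro exI[of _ ?S] exI[of _ "\<lambda>x\<in>?S. x"] exI[of _ W]) auto
qed

lemma smooth_fn_euclid_coordinate: "smooth_fn (euclid_manifold n) (topspace (Euclidean_space n)) (\<lambda>x. x j)"
  by (rule smooth_fn_cong[OF charted_euclid_manifold _ _
        smooth_fn_coordinate[OF charted_euclid_manifold euclid_chart_in_atlas, of n j]]) auto

text \<open>Here maximality of the atlas enters. \<open>open_submanifold\<close> retains only the
  charts whose domain lies in S, and these cover S because the restriction of a chart to an open set
  is again in the atlas.\<close>

lemma restricted_chart_in_atlas:
  assumes M: "smooth_manifold M" and c: "(U, \<phi>) \<in> atlas M" and S: "openin (mtop M) S"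
  shows "(U \<inter> S, restrict \<phi> (U \<inter> S)) \<in> atlas M"
proof -
  let ?n = "mdim M" and ?\<phi> = "restrict \<phi> (U \<inter> S)"
  note C = smooth_manifold_charted[OF M]
  note ch = charted_chart[OF C c]
  have im: "?\<phi> ` R = \<phi> ` R" if "R \<subseteq> U \<inter> S" for R
    using that by (auto simp: subset_iff image_iff)
  have op: "openin (Euclidean_space ?n) (\<phi> ` (U \<inter> S))"
    using atlas_image_open[OF C c S] .
  have inj: "inj_on ?\<phi> (U \<inter> S)"
    using chart_inj[OF ch] by (auto simp: inj_on_def)
  have inv: "inv_into (U \<inter> S) ?\<phi> y = inv_into U \<phi> y" if "y \<in> \<phi> ` (U \<inter> S)" for y
    using that inv_into_f_f[OF inj] atlas_inv[OF C c] by fastforce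
  have "is_chart (mtop M) ?n (U \<inter> S, ?\<phi>)"
  proof (rule is_chartI[where \<kappa> = "inv_into U \<phi>"])
    show "continuous_map (subtopology (mtop M) (U \<inter> S)) (Euclidean_space ?n) ?\<phi>"
      by (rule continuous_map_eq[OF continuous_map_from_subtopology_mono[OF chart_continuous[OF ch]]]) auto
    show "continuous_map (subtopology (Euclidean_space ?n) (?\<phi> ` (U \<inter> S))) (mtop M) (inv_into U \<phi>)"
      by (rule continuous_map_from_subtopology_mono[OF chart_inverse_continuous[OF ch]]) auto
  qed (use chart_open[OF ch] S op atlas_inv[OF C c] im in auto)
  moreover have "compatible ?n (U \<inter> S, ?\<phi>) (V, \<psi>)" if d: "(V, \<psi>) \<in> atlas M" for V \<psi>
  proof -
    have VS: "openin (mtop M) (S \<inter> V)"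
      using S atlas_open[OF C d] by blast
    have 1: "openin (Euclidean_space ?n) (\<phi> ` (U \<inter> (S \<inter> V)))" "openin (Euclidean_space ?n) (\<psi> ` (V \<inter> (S \<inter> U)))"
      using atlas_image_open[OF C c VS] atlas_image_open[OF C d] S atlas_open[OF C c] by auto
    have "euclid_smooth ?n (\<phi> ` (U \<inter> (S \<inter> V))) (\<psi> \<circ> inv_into (U \<inter> S) ?\<phi>)"
      by (rule euclid_smooth_cong[OF 1(1) _ euclid_smooth_subset[OF charted_transition[OF C c d]]])
        (auto simp: inv)
    moreover have "euclid_smooth ?n (\<psi> ` (V \<inter> (S \<inter> U))) (?\<phi> \<circ> inv_into V \<psi>)"
      by (rule euclid_smooth_cong[OF 1(2) _ euclid_smooth_subset[OF charted_transition[OF C d c]]])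
        (auto simp: atlas_inv[OF C d])
    moreover have "?\<phi> ` (U \<inter> S \<inter> V) = \<phi> ` (U \<inter> (S \<inter> V))" "\<psi> ` (U \<inter> S \<inter> V) = \<psi> ` (V \<inter> (S \<inter> U))"
      using im[of "U \<inter> S \<inter> V"] by (auto simp: Int_ac)
    ultimately show ?thesis
      by (simp add: compatible_def)
  qed
  ultimately have "(U \<inter> S, ?\<phi>) \<in> max_atlas (mtop M) ?n (atlas M)"
    by (auto simp: max_atlas_def)
  then show ?thesis
    using M by (simp add: smooth_manifold_def)
qed

lemma open_submanifold_simps [simp]:
  "mtop (open_submanifold M S) = subtopology (mtop M) S" "mdim (open_submanifold M S) = mdim M"
  "c \<in> atlas (open_submanifold M S) \<longleftrightarrow> c \<in> atlas M \<and> fst c \<subseteq> S"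
  by (auto simp: open_submanifold_def)

context
  fixes M :: "'a manifold" and S :: "'a set"
  assumes M: "smooth_manifold M" and S: "openin (mtop M) S"
begin

lemma mcarrier_open_submanifold: "mcarrier (open_submanifold M S) = S"
  using openin_subset[OF S] by auto

lemma open_submanifold_cover:
  assumes "x \<in> S"
  obtains U \<phi> where "(U, \<phi>) \<in> atlas (open_submanifold M S)" "x \<in> U"
proof -
  obtain U \<phi> where "(U, \<phi>) \<in> atlas M" "x \<in> U"
    using charted_cover[OF smooth_manifold_charted[OF M]] openin_subset[OF S] assms by blast
  then show ?thesis
    using restricted_chart_in_atlas[OF M _ S] assms by (intro that[of "U \<inter> S"]) auto
qed

lemma charted_open_submanifold: "charted (open_submanifold M S)"
proof -
  have "is_chart (subtopology (mtop M) S) (mdim M) (U, \<phi>)" if "(U, \<phi>) \<in> atlas M" "U \<subseteq> S" for U \<phi>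
    using charted_chart[OF smooth_manifold_charted[OF M] that(1)] that(2) S
    by (simp add: is_chart_def openin_open_subtopology subtopology_subtopology Int_absorb1)
  moreover have "(\<Union>(U, \<phi>)\<in>atlas (open_submanifold M S). U) = mcarrier (open_submanifold M S)"
    unfolding mcarrier_open_submanifold
  proof (intro equalityI subsetI)
    fix x assume "x \<in> S"
    then obtain U \<phi> where "(U, \<phi>) \<in> atlas (open_submanifold M S)" "x \<in> U"
      by (rule open_submanifold_cover)
    then show "x \<in> (\<Union>(U, \<phi>)\<in>atlas (open_submanifold M S). U)"
      by (intro UN_I[of "(U, \<phi>)"]) auto
  qed auto
  ultimately show ?thesis
    using smooth_manifold_charted[OF M] by (auto simp: charted_def)
qed

text \<open>The identity in both directions lets smoothness on an open subset and smoothness on the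
  submanifold be exchanged by composition.\<close>

lemma smooth_on_into_open_submanifold: "smooth_on M S (open_submanifold M S) (\<lambda>x. x)"
proof (rule smooth_onI[OF S])
  fix x assume "x \<in> S"
  then obtain U \<phi> where "(U, \<phi>) \<in> atlas (open_submanifold M S)" "x \<in> U"
    using open_submanifold_cover by blast
  then show "smooth_at M S (open_submanifold M S) (\<lambda>x. x) x"
    using atlas_open[OF smooth_manifold_charted[OF M]] smooth_fn_coordinate[OF smooth_manifold_charted[OF M]]
    by (intro exI[of _ U] exI[of _ \<phi>] exI[of _ U]) auto
qed

lemma smooth_on_from_open_submanifold: "smooth_on (open_submanifold M S) S M (\<lambda>x. x)"
proof (rule smooth_onI)
  show "openin (mtop (open_submanifold M S)) S"
    using mcarrier_open_submanifold openin_topspace by metis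
  fix x assume "x \<in> S"
  then obtain U \<phi> where c: "(U, \<phi>) \<in> atlas (open_submanifold M S)" "x \<in> U"
    using open_submanifold_cover by blast
  then show "smooth_at (open_submanifold M S) S M (\<lambda>x. x) x"
    using atlas_open[OF charted_open_submanifold c(1)] smooth_fn_coordinate[OF charted_open_submanifold c(1)]
    by (intro exI[of _ U] exI[of _ \<phi>] exI[of _ U]) auto
qed

end

section \<open>Manifolds whose topology is made from their charts\<close>

definition chart_family :: "'a set \<Rightarrow> nat \<Rightarrow> 'a chart set \<Rightarrow> bool" where
  "chart_family S n A \<longleftrightarrow>
     (\<forall>(U, \<phi>)\<in>A. U \<subseteq> S \<and> \<phi> \<in> extensional U \<and> inj_on \<phi> U \<and> openin (Euclidean_space n) (\<phi> ` U)) \<and>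
     (\<Union>(U, \<phi>)\<in>A. U) = S \<and>
     (\<forall>(U, \<phi>)\<in>A. \<forall>(V, \<psi>)\<in>A. openin (Euclidean_space n) (\<phi> ` (U \<inter> V)) \<and>
        euclid_smooth n (\<phi> ` (U \<inter> V)) (\<lambda>y. \<psi> (inv_into U \<phi> y)))"

lemma chart_familyI:
  assumes "\<And>U \<phi>. (U, \<phi>) \<in> A \<Longrightarrow>
      U \<subseteq> S \<and> \<phi> \<in> extensional U \<and> inj_on \<phi> U \<and> openin (Euclidean_space n) (\<phi> ` U)"
    and "\<And>x. x \<in> S \<Longrightarrow> \<exists>U \<phi>. (U, \<phi>) \<in> A \<and> x \<in> U"
    and "\<And>U \<phi> V \<psi>. (U, \<phi>) \<in> A \<Longrightarrow> (V, \<psi>) \<in> A \<Longrightarrow> openin (Euclidean_space n) (\<phi> ` (U \<inter> V)) \<and>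
        euclid_smooth n (\<phi> ` (U \<inter> V)) (\<lambda>y. \<psi> (inv_into U \<phi> y))"
  shows "chart_family S n A"
proof -
  have "(\<Union>(U, \<phi>)\<in>A. U) = S"
  proof (intro equalityI subsetI)
    fix x assume "x \<in> S"
    then obtain U \<phi> where "(U, \<phi>) \<in> A" "x \<in> U"
      using assms(2) by blast
    then show "x \<in> (\<Union>(U, \<phi>)\<in>A. U)"
      by (intro UN_I[of "(U, \<phi>)"]) auto
  qed (use assms(1) in blast)
  moreover have "\<forall>(U, \<phi>)\<in>A. U \<subseteq> S \<and> \<phi> \<in> extensional U \<and> inj_on \<phi> U \<and> openin (Euclidean_space n) (\<phi> ` U)"
    using assms(1) by (simp only: Ball_def split_paired_All prod.case) blast
  moreover have "\<forall>(U, \<phi>)\<in>A. \<forall>(V, \<psi>)\<in>A. openin (Euclidean_space n) (\<phi> ` (U \<inter> V)) \<and>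
        euclid_smooth n (\<phi> ` (U \<inter> V)) (\<lambda>y. \<psi> (inv_into U \<phi> y))"
    using assms(3) by (simp only: Ball_def split_paired_All prod.case) blast
  ultimately show ?thesis
    unfolding chart_family_def by (intro conjI)
qed

context
  fixes S :: "'a set" and n :: nat and A :: "'a chart set"
  assumes A: "chart_family S n A"
begin

lemma chart_familyD:
  assumes "(U, \<phi>) \<in> A"
  shows "U \<subseteq> S" "\<phi> \<in> extensional U" "inj_on \<phi> U" "openin (Euclidean_space n) (\<phi> ` U)"
  using A assms by (auto simp: chart_family_def)

lemma chart_family_transition:
  assumes "(U, \<phi>) \<in> A" "(V, \<psi>) \<in> A"
  shows "openin (Euclidean_space n) (\<phi> ` (U \<inter> V))" "euclid_smooth n (\<phi> ` (U \<inter> V)) (\<lambda>y. \<psi> (inv_into U \<phi> y))"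
  using A assms by (fastforce simp: chart_family_def)+

text \<open>\<open>topology\<close> is only meaningful for a predicate closed under unions and
  finite intersections. Images commute with unions always, and with intersections because the charts
  are injective.\<close>

lemma openin_manifold_of_charts:
  "openin (mtop (manifold_of_charts S n A)) W \<longleftrightarrow>
    W \<subseteq> S \<and> (\<forall>(U, \<phi>)\<in>A. openin (Euclidean_space n) (\<phi> ` (W \<inter> U)))"
proof -
  let ?P = "\<lambda>W. W \<subseteq> S \<and> (\<forall>(U, \<phi>)\<in>A. openin (Euclidean_space n) (\<phi> ` (W \<inter> U)))"
  have "istopology ?P"
    unfolding istopology_def
  proof (rule conjI; clarify)
    fix W W' assume *: "\<forall>(U, \<phi>)\<in>A. openin (Euclidean_space n) (\<phi> ` (W \<inter> U))"
      "\<forall>(U, \<phi>)\<in>A. openin (Euclidean_space n) (\<phi> ` (W' \<inter> U))" "W \<subseteq> S" "W' \<subseteq> S"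
    have "openin (Euclidean_space n) (\<phi> ` (W \<inter> W' \<inter> U))" if "(U, \<phi>) \<in> A" for U \<phi>
    proof -
      have "\<phi> ` (W \<inter> W' \<inter> U) = \<phi> ` (W \<inter> U) \<inter> \<phi> ` (W' \<inter> U)"
        using chart_familyD(3)[OF that] by (auto simp: inj_on_def)
      then show ?thesis
        using * that by (auto intro!: openin_Int)
    qed
    then show "W \<inter> W' \<subseteq> S \<and> (\<forall>(U, \<phi>)\<in>A. openin (Euclidean_space n) (\<phi> ` (W \<inter> W' \<inter> U)))"
      using * by auto
  next
    fix \<W> assume *: "\<forall>W\<in>\<W>. W \<subseteq> S \<and> (\<forall>(U, \<phi>)\<in>A. openin (Euclidean_space n) (\<phi> ` (W \<inter> U)))"
    have "openin (Euclidean_space n) (\<phi> ` (\<Union>\<W> \<inter> U))" if "(U, \<phi>) \<in> A" for U \<phi>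
    proof -
      have "\<phi> ` (\<Union>\<W> \<inter> U) = (\<Union>W\<in>\<W>. \<phi> ` (W \<inter> U))"
        by auto
      then show ?thesis
        using * that by (auto intro!: openin_Union)
    qed
    then show "\<Union>\<W> \<subseteq> S \<and> (\<forall>(U, \<phi>)\<in>A. openin (Euclidean_space n) (\<phi> ` (\<Union>\<W> \<inter> U)))"
      using * by auto
  qed
  then show ?thesis
    by (simp add: manifold_of_charts_def topology_inverse')
qed

lemma mcarrier_manifold_of_charts: "mcarrier (manifold_of_charts S n A) = S"
proof
  show "mcarrier (manifold_of_charts S n A) \<subseteq> S"
    using openin_topspace[of "mtop (manifold_of_charts S n A)"] unfolding openin_manifold_of_charts by blast
  have "openin (mtop (manifold_of_charts S n A)) S"
    unfolding openin_manifold_of_charts using chart_familyD(1,4) by (fastforce simp: Int_absorb1)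
  then show "S \<subseteq> mcarrier (manifold_of_charts S n A)"
    by (rule openin_subset)
qed

text \<open>Domains are open because the overlaps have open images. Continuity of
  \<open>\<phi>\<close> is tested in the other charts of the family, where it becomes continuity of
  a transition map.\<close>

lemma chart_family_is_chart:
  assumes c: "(U, \<phi>) \<in> A"
  shows "is_chart (mtop (manifold_of_charts S n A)) n (U, \<phi>)"
proof (rule is_chartI[where \<kappa> = "inv_into U \<phi>"])
  let ?T = "mtop (manifold_of_charts S n A)" and ?E = "Euclidean_space n"
  note props = chart_familyD[OF c]
  show openU: "openin ?T U"
    unfolding openin_manifold_of_charts using props(1) chart_family_transition(1)[OF _ c]
    by (auto simp: Int_commute)
  have tE: "topspace (subtopology ?E (\<phi> ` U)) = \<phi> ` U"
    using openin_subset[OF props(4)] by auto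
  have tT: "topspace (subtopology ?T U) = U"
    using openin_subset[OF openU] by auto
  have "openin ?T {x \<in> U. \<phi> x \<in> O'}" if O': "openin ?E O'" for O'
    unfolding openin_manifold_of_charts
  proof (intro conjI ballI)
    show "{x \<in> U. \<phi> x \<in> O'} \<subseteq> S"
      using props(1) by blast
    fix d assume "d \<in> A"
    then obtain V \<psi> where d: "d = (V, \<psi>)" "(V, \<psi>) \<in> A"
      by (metis surj_pair)
    let ?B = "\<psi> ` (V \<inter> U)"
    have tr: "openin ?E ?B" "euclid_smooth n ?B (\<lambda>y. \<phi> (inv_into V \<psi> y))"
      using chart_family_transition[OF d(2) c] by auto
    have inv: "inv_into V \<psi> (\<psi> x) = x" if "x \<in> V" for x
      using chart_familyD(3)[OF d(2)] that by simp
    have "\<phi> (inv_into V \<psi> y) \<in> topspace ?E" if "y \<in> ?B" for y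
      using that openin_subset[OF props(4)] inv by auto
    from euclid_smooth_continuous[OF tr(2,1) this]
    have "continuous_map (subtopology ?E ?B) ?E (\<lambda>y. \<phi> (inv_into V \<psi> y))" .
    from openin_continuous_map_preimage[OF this O']
    have "openin ?E {y \<in> ?B. \<phi> (inv_into V \<psi> y) \<in> O'}"
      using tr(1) openin_subset[OF tr(1)] by (simp add: openin_open_subtopology Int_absorb1)
    moreover have "{y \<in> ?B. \<phi> (inv_into V \<psi> y) \<in> O'} = \<psi> ` ({x \<in> U. \<phi> x \<in> O'} \<inter> V)"
      using inv by auto
    ultimately show "case d of (V, \<psi>) \<Rightarrow> openin ?E (\<psi> ` ({x \<in> U. \<phi> x \<in> O'} \<inter> V))"
      using d by simp
  qed
  then show "continuous_map (subtopology ?T U) ?E \<phi>"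
    unfolding continuous_map tT using openU openin_subset[OF props(4)]
    by (auto simp: openin_open_subtopology)
  have "openin ?E {y \<in> \<phi> ` U. inv_into U \<phi> y \<in> W}" if W: "openin ?T W" for W
  proof -
    have "{y \<in> \<phi> ` U. inv_into U \<phi> y \<in> W} = \<phi> ` (W \<inter> U)"
      using props(3) by auto
    then show ?thesis
      using W c unfolding openin_manifold_of_charts by auto
  qed
  moreover have "inv_into U \<phi> y \<in> topspace ?T" if "y \<in> \<phi> ` U" for y
    using inv_into_into[OF that] openin_subset[OF openU] by blast
  ultimately show "continuous_map (subtopology ?E (\<phi> ` U)) ?T (inv_into U \<phi>)"
    unfolding continuous_map tE using props(4) by (auto simp: openin_open_subtopology)
qed (use chart_familyD[OF c] in auto)

lemma charted_manifold_of_charts: "charted (manifold_of_charts S n A)"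
  and chart_family_in_atlas: "A \<subseteq> atlas (manifold_of_charts S n A)"
proof -
  let ?T = "mtop (manifold_of_charts S n A)"
  have eq: "manifold_of_charts S n A = manifold_by ?T n A"
    by (simp add: manifold_of_charts_def)
  have *: "charted (manifold_by ?T n A) \<and> A \<subseteq> atlas (manifold_by ?T n A)"
  proof (rule charted_manifold_by)
    show "is_chart ?T n c" if "c \<in> A" for c
      using chart_family_is_chart that by (cases c) auto
    show "compatible n c d" if "c \<in> A" "d \<in> A" for c d
    proof -
      obtain U \<phi> V \<psi> where "c = (U, \<phi>)" "d = (V, \<psi>)"
        by (metis surj_pair)
      then show ?thesis
        using that chart_family_transition(2)[of U \<phi> V \<psi>] chart_family_transition(2)[of V \<psi> U \<phi>]
        by (simp add: compatible_def comp_def Int_commute)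
    qed
    show "(\<Union>(U, \<phi>)\<in>A. U) = topspace ?T"
      unfolding mcarrier_manifold_of_charts using A by (simp add: chart_family_def)
  qed
  show "charted (manifold_of_charts S n A)" "A \<subseteq> atlas (manifold_of_charts S n A)"
    using * eq by simp_all
qed

end

section \<open>Copies of manifolds along injections\<close>

context
  fixes \<iota> :: "'a \<Rightarrow> 'b" and M :: "'a manifold"
  assumes M: "charted M" and inj: "inj_on \<iota> (mcarrier M)"
begin

abbreviation (input) image_coord :: "'a set \<Rightarrow> ('a \<Rightarrow> nat \<Rightarrow> real) \<Rightarrow> 'b \<Rightarrow> nat \<Rightarrow> real" where
  "image_coord U \<phi> \<equiv> \<lambda>y\<in>\<iota> ` U. \<phi> (inv_into (mcarrier M) \<iota> y)"

lemma image_inverse: "x \<in> mcarrier M \<Longrightarrow> inv_into (mcarrier M) \<iota> (\<iota> x) = x"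
  using inj by simp

text \<open>The transported charts have the same images in Euclidean space and the same transition
  maps as the original ones, so every condition is inherited.\<close>

lemma image_chart_family:
  "chart_family (\<iota> ` mcarrier M) (mdim M) {(\<iota> ` U, image_coord U \<phi>) | U \<phi>. (U, \<phi>) \<in> atlas M}"
proof -
  have image: "image_coord U \<phi> ` (\<iota> ` W) = \<phi> ` W" if "(U, \<phi>) \<in> atlas M" "W \<subseteq> U" for U \<phi> W
    unfolding image_image
  proof (rule image_cong[OF refl])
    fix x assume "x \<in> W"
    then have "x \<in> U" "x \<in> mcarrier M"
      using that atlas_subset[OF M that(1)] by auto
    then show "image_coord U \<phi> (\<iota> x) = \<phi> x"
      using image_inverse by simp
  qed
  have inj': "inj_on (image_coord U \<phi>) (\<iota> ` U)" if "(U, \<phi>) \<in> atlas M" for U \<phi>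
    using that atlas_subset[OF M that] image_inverse chart_inj[OF charted_chart[OF M that]]
    by (auto simp: inj_on_def subset_iff)
  have int: "\<iota> ` U \<inter> \<iota> ` V = \<iota> ` (U \<inter> V)" if "(U, \<phi>) \<in> atlas M" "(V, \<psi>) \<in> atlas M" for U \<phi> V \<psi>
    by (rule inj_on_image_Int[OF inj atlas_subset[OF M that(1)] atlas_subset[OF M that(2)], symmetric])
  have "openin (Euclidean_space (mdim M)) (image_coord U \<phi> ` (\<iota> ` U \<inter> \<iota> ` V)) \<and>
      euclid_smooth (mdim M) (image_coord U \<phi> ` (\<iota> ` U \<inter> \<iota> ` V))
        (\<lambda>y. image_coord V \<psi> (inv_into (\<iota> ` U) (image_coord U \<phi>) y))"
    if c: "(U, \<phi>) \<in> atlas M" and d: "(V, \<psi>) \<in> atlas M" for U \<phi> V \<psi>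
  proof -
    have im: "image_coord U \<phi> ` (\<iota> ` U \<inter> \<iota> ` V) = \<phi> ` (U \<inter> V)"
      unfolding int[OF c d] by (rule image[OF c]) auto
    have op: "openin (Euclidean_space (mdim M)) (\<phi> ` (U \<inter> V))"
      by (rule atlas_image_open[OF M c atlas_open[OF M d]])
    have "\<psi> (inv_into U \<phi> y) = image_coord V \<psi> (inv_into (\<iota> ` U) (image_coord U \<phi>) y)" if "y \<in> \<phi> ` (U \<inter> V)" for y
    proof -
      obtain x where x: "x \<in> U" "x \<in> V" "y = \<phi> x"
        using \<open>y \<in> \<phi> ` (U \<inter> V)\<close> by blast
      have "x \<in> mcarrier M"
        using x(1) atlas_subset[OF M c] by blast
      then have "y = image_coord U \<phi> (\<iota> x)"
        using x image_inverse by simp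
      then have "inv_into (\<iota> ` U) (image_coord U \<phi>) y = \<iota> x"
        using inv_into_f_f[OF inj'[OF c]] x(1) by blast
      then show ?thesis
        using x \<open>x \<in> mcarrier M\<close> atlas_inv[OF M c] image_inverse by simp
    qed
    from euclid_smooth_cong[OF op this charted_transition[OF M c d]] show ?thesis
      unfolding im using op by blast
  qed
  moreover have "(\<Union>(U, \<phi>)\<in>{(\<iota> ` U, image_coord U \<phi>) | U \<phi>. (U, \<phi>) \<in> atlas M}. U) = \<iota> ` mcarrier M"
  proof -
    have "(\<Union>(U, \<phi>)\<in>{(\<iota> ` U, image_coord U \<phi>) | U \<phi>. (U, \<phi>) \<in> atlas M}. U) = \<iota> ` (\<Union>(U, \<phi>)\<in>atlas M. U)"
    proof -
      have "{(\<iota> ` U, image_coord U \<phi>) | U \<phi>. (U, \<phi>) \<in> atlas M} =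
          (\<lambda>c. (\<iota> ` fst c, image_coord (fst c) (snd c))) ` atlas M"
      proof (intro equalityI subsetI)
        fix d assume "d \<in> {(\<iota> ` U, image_coord U \<phi>) | U \<phi>. (U, \<phi>) \<in> atlas M}"
        then obtain U \<phi> where "d = (\<iota> ` U, image_coord U \<phi>)" "(U, \<phi>) \<in> atlas M"
          by blast
        then show "d \<in> (\<lambda>c. (\<iota> ` fst c, image_coord (fst c) (snd c))) ` atlas M"
          by (intro image_eqI[of _ _ "(U, \<phi>)"]) simp_all
      next
        fix d assume "d \<in> (\<lambda>c. (\<iota> ` fst c, image_coord (fst c) (snd c))) ` atlas M"
        then obtain c where "d = (\<iota> ` fst c, image_coord (fst c) (snd c))" "c \<in> atlas M"
          by blast
        then show "d \<in> {(\<iota> ` U, image_coord U \<phi>) | U \<phi>. (U, \<phi>) \<in> atlas M}"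
          by (intro CollectI exI[of _ "fst c"] exI[of _ "snd c"]) simp
      qed
      then show ?thesis
        by (simp add: case_prod_beta image_UN)
    qed
    then show ?thesis
      using M by (simp add: charted_def)
  qed
  moreover have "U \<subseteq> mcarrier M" "openin (Euclidean_space (mdim M)) (image_coord U \<phi> ` (\<iota> ` U))"
    if "(U, \<phi>) \<in> atlas M" for U \<phi>
    using atlas_subset[OF M that] image[OF that order.refl] chart_image[OF charted_chart[OF M that]] by auto
  ultimately show ?thesis
    unfolding chart_family_def using inj' by (auto intro: atlas_subset[OF M, THEN subsetD])
qed

lemma charted_image_manifold: "charted (image_manifold \<iota> M)"
  unfolding image_manifold_def by (rule charted_manifold_of_charts[OF image_chart_family])

lemma mcarrier_image_manifold: "mcarrier (image_manifold \<iota> M) = \<iota> ` mcarrier M"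
  unfolding image_manifold_def by (rule mcarrier_manifold_of_charts[OF image_chart_family])

lemma image_chart_in_atlas: "(U, \<phi>) \<in> atlas M \<Longrightarrow> (\<iota> ` U, image_coord U \<phi>) \<in> atlas (image_manifold \<iota> M)"
  using chart_family_in_atlas[OF image_chart_family] unfolding image_manifold_def by blast

text \<open>The coordinates of \<open>\<iota> x\<close> are those of x. Together with smoothness of
  the inverse this makes the copy diffeomorphic to M.\<close>

lemma smooth_map_to_image: "smooth_map M (image_manifold \<iota> M) \<iota>"
  unfolding smooth_map_iff[OF M charted_image_manifold]
proof (rule smooth_onI)
  fix x assume "x \<in> mcarrier M"
  then obtain U \<phi> where c: "(U, \<phi>) \<in> atlas M" "x \<in> U"
    using charted_cover[OF M] by metis
  have "smooth_fn M U (\<lambda>x. image_coord U \<phi> (\<iota> x) j)" for j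
    by (rule smooth_fn_cong[OF M atlas_open[OF M c(1)] _ smooth_fn_coordinate[OF M c(1)]])
      (use atlas_subset[OF M c(1)] image_inverse in auto)
  then show "smooth_at M (mcarrier M) (image_manifold \<iota> M) \<iota> x"
    using c(2) image_chart_in_atlas[OF c(1)] atlas_open[OF M c(1)] atlas_subset[OF M c(1)]
    by (intro exI[of _ "\<iota> ` U"] exI[of _ "image_coord U \<phi>"] exI[of _ U]) auto
qed auto

lemma smooth_map_from_image: "smooth_map (image_manifold \<iota> M) M (inv_into (mcarrier M) \<iota>)"
  unfolding smooth_map_iff[OF charted_image_manifold M]
proof (rule smooth_onI)
  let ?I = "image_manifold \<iota> M"
  fix y assume "y \<in> mcarrier ?I"
  then obtain x where x: "x \<in> mcarrier M" "y = \<iota> x"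
    by (auto simp: mcarrier_image_manifold)
  then obtain U \<phi> where c: "(U, \<phi>) \<in> atlas M" "x \<in> U"
    using charted_cover[OF M] by metis
  note d = image_chart_in_atlas[OF c(1)]
  have "smooth_fn ?I (\<iota> ` U) (\<lambda>y. \<phi> (inv_into (mcarrier M) \<iota> y) j)" for j
    by (rule smooth_fn_cong[OF charted_image_manifold atlas_open[OF charted_image_manifold d] _
          smooth_fn_coordinate[OF charted_image_manifold d]]) auto
  moreover have "inv_into (mcarrier M) \<iota> ` \<iota> ` U \<subseteq> U"
    using atlas_subset[OF M c(1)] image_inverse by auto
  ultimately show "smooth_at ?I (mcarrier ?I) M (inv_into (mcarrier M) \<iota>) y"
    using c x atlas_open[OF charted_image_manifold d] atlas_subset[OF charted_image_manifold d]
    by (intro exI[of _ U] exI[of _ \<phi>] exI[of _ "\<iota> ` U"]) auto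
qed auto

end

subsection \<open>Tangent vectors\<close>

lemma charts_at_iff [simp]: "(U, \<phi>) \<in> charts_at M p \<longleftrightarrow> (U, \<phi>) \<in> atlas M \<and> p \<in> U"
  by (simp add: charts_at_def)

lemma charts_at_nonempty:
  assumes "charted M" "p \<in> mcarrier M"
  obtains U \<phi> where "(U, \<phi>) \<in> charts_at M p"
  using charted_cover[OF assms] that unfolding charts_at_iff by blast

lemma smooth_map_local_rep:
  assumes M: "charted M" and N: "charted N" and f: "smooth_map M N f"
    and c: "(U, \<phi>) \<in> atlas M" and d: "(V, \<psi>) \<in> atlas N"
  shows "openin (mtop M) {x \<in> U. f x \<in> V}"
    and "openin (Euclidean_space (mdim M)) (\<phi> ` {x \<in> U. f x \<in> V})"
    and "euclid_smooth (mdim M) (\<phi> ` {x \<in> U. f x \<in> V}) (\<lambda>y. \<psi> (f (inv_into U \<phi> y)))"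
proof -
  have f': "smooth_on M (mcarrier M) N f"
    using f smooth_map_iff[OF M N] by blast
  have "openin (mtop M) {x \<in> mcarrier M. f x \<in> V}"
    using smooth_on_preimage_open[OF M N f' atlas_open[OF N d]] .
  then have "openin (mtop M) (U \<inter> {x \<in> mcarrier M. f x \<in> V})"
    using atlas_open[OF M c] by blast
  moreover have "U \<inter> {x \<in> mcarrier M. f x \<in> V} = {x \<in> U. f x \<in> V}"
    using atlas_subset[OF M c] by auto
  ultimately show W: "openin (mtop M) {x \<in> U. f x \<in> V}"
    by simp
  then show "openin (Euclidean_space (mdim M)) (\<phi> ` {x \<in> U. f x \<in> V})"
    by (rule chart_image_open[OF charted_chart[OF M c]]) auto
  have "euclid_smooth (mdim M) (\<phi> ` (U \<inter> f -` V)) (\<psi> \<circ> f \<circ> inv_into U \<phi>)"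
    using f c d by (fastforce simp: smooth_map_def)
  moreover have "U \<inter> f -` V = {x \<in> U. f x \<in> V}"
    by auto
  ultimately show "euclid_smooth (mdim M) (\<phi> ` {x \<in> U. f x \<in> V}) (\<lambda>y. \<psi> (f (inv_into U \<phi> y)))"
    by (simp add: comp_def)
qed

text \<open>The chain rule in charts. With f and g the identity it is the cocycle rule for
  transitions; with one of them the identity it gives independence of the chart and the
  transformation rule for pushforwards; in general it gives their functoriality.\<close>

lemma jacobian_local_rep_compose:
  assumes M: "charted M" and N: "charted N" and P: "charted P"
    and f: "smooth_map M N f" and g: "smooth_map N P g"
    and c: "(U, \<phi>) \<in> charts_at M p" and d: "(V, \<psi>) \<in> charts_at N (f p)" and e: "(S, \<sigma>) \<in> charts_at P (g (f p))"
  shows "jacobian (mdim M) (\<lambda>y. \<sigma> (g (f (inv_into U \<phi> y)))) (\<phi> p) u =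
    jacobian (mdim N) (\<lambda>y. \<sigma> (g (inv_into V \<psi> y))) (\<psi> (f p))
      (jacobian (mdim M) (\<lambda>y. \<psi> (f (inv_into U \<phi> y))) (\<phi> p) u)"
proof -
  have c': "(U, \<phi>) \<in> atlas M" "p \<in> U" and d': "(V, \<psi>) \<in> atlas N" "f p \<in> V" and e': "(S, \<sigma>) \<in> atlas P" "g (f p) \<in> S"
    using c d e by auto
  note invM = atlas_inv[OF M c'(1)] and invN = atlas_inv[OF N d'(1)]
  let ?F = "\<lambda>y. \<psi> (f (inv_into U \<phi> y))" and ?G = "\<lambda>y. \<sigma> (g (inv_into V \<psi> y))"
  \<comment> \<open>The composite factors through the chart V only where f x lies in V, and is
    expressed in S only where \<open>g (f x)\<close> lies in S.\<close>
  let ?A = "{x \<in> U. f x \<in> V} \<inter> {x \<in> U. g (f x) \<in> S}" and ?B = "{y \<in> V. g y \<in> S}"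
  have "openin (mtop M) ?A"
    using smooth_map_local_rep(1)[OF M N f c'(1) d'(1)]
      smooth_map_local_rep(1)[OF M P smooth_map_compose[OF M N P f g] c'(1) e'(1)] by blast
  then have A: "openin (Euclidean_space (mdim M)) (\<phi> ` ?A)"
    by (rule chart_image_open[OF charted_chart[OF M c'(1)]]) auto
  note B = smooth_map_local_rep(2)[OF N P g d'(1) e'(1)]
  have pA: "\<phi> p \<in> \<phi> ` ?A"
    using c' d' e' by blast
  have "jacobian (mdim M) (\<lambda>y. \<sigma> (g (f (inv_into U \<phi> y)))) (\<phi> p) u = jacobian (mdim M) (?G \<circ> ?F) (\<phi> p) u"
    by (rule jacobian_cong[OF A pA]) (auto simp: invM invN)
  also have "\<dots> = jacobian (mdim N) ?G (?F (\<phi> p)) (jacobian (mdim M) ?F (\<phi> p) u)"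
  proof (rule jacobian_compose[OF A pA B])
    show "euclid_smooth (mdim M) (\<phi> ` ?A) ?F"
      by (rule euclid_smooth_subset[OF smooth_map_local_rep(3)[OF M N f c'(1) d'(1)]]) auto
    show "euclid_smooth (mdim N) (\<psi> ` ?B) ?G"
      by (rule smooth_map_local_rep(3)[OF N P g d'(1) e'(1)])
  qed (auto simp: invM)
  also have "?F (\<phi> p) = \<psi> (f p)"
    using c'(2) by (simp add: invM)
  finally show ?thesis .
qed

lemma jacobian_transition_compose:
  assumes "charted M" "(U, \<phi>) \<in> charts_at M p" "(V, \<psi>) \<in> charts_at M p" "(S, \<sigma>) \<in> charts_at M p"
  shows "jacobian (mdim M) (\<lambda>y. \<sigma> (inv_into U \<phi> y)) (\<phi> p) u =
    jacobian (mdim M) (\<lambda>y. \<sigma> (inv_into V \<psi> y)) (\<psi> p) (jacobian (mdim M) (\<lambda>y. \<psi> (inv_into U \<phi> y)) (\<phi> p) u)"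
  using jacobian_local_rep_compose[OF assms(1,1,1) smooth_map_id[OF assms(1)] smooth_map_id[OF assms(1)] assms(2-4)] .

lemma jacobian_transition_self:
  assumes M: "charted M" and c: "(U, \<phi>) \<in> charts_at M p" and u: "u \<in> topspace (Euclidean_space (mdim M))"
  shows "jacobian (mdim M) (\<lambda>y. \<phi> (inv_into U \<phi> y)) (\<phi> p) u = u"
proof -
  have c': "(U, \<phi>) \<in> atlas M" "p \<in> U"
    using c by auto
  have "jacobian (mdim M) (\<lambda>y. \<phi> (inv_into U \<phi> y)) (\<phi> p) u = jacobian (mdim M) (\<lambda>y. y) (\<phi> p) u"
    by (rule jacobian_cong[OF chart_image[OF charted_chart[OF M c'(1)]]]) (use c'(2) in \<open>auto simp: f_inv_into_f\<close>)
  then show ?thesis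
    using jacobian_id[OF u] by simp
qed

lemma jacobian_local_rep_in_Euclidean_space:
  assumes M: "charted M" and N: "charted N" and f: "smooth_map M N f"
    and c: "(U, \<phi>) \<in> charts_at M p" and d: "(V, \<psi>) \<in> charts_at N (f p)"
  shows "jacobian (mdim M) (\<lambda>y. \<psi> (f (inv_into U \<phi> y))) (\<phi> p) u \<in> topspace (Euclidean_space (mdim N))"
proof -
  have c': "(U, \<phi>) \<in> atlas M" "p \<in> U" and d': "(V, \<psi>) \<in> atlas N" "f p \<in> V"
    using c d by auto
  show ?thesis
    by (rule jacobian_in_Euclidean_space[OF smooth_map_local_rep(2)[OF M N f c'(1) d'(1)]])
      (use c' d' atlas_inv[OF M c'(1)] chart_in_Euclidean_space[OF charted_chart[OF N d'(1)]] in auto)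
qed

lemma mem_tangent_space:
  "v \<in> tangent_space M p \<longleftrightarrow> fst v = p \<and> snd v \<in> charts_at M p \<rightarrow>\<^sub>E topspace (Euclidean_space (mdim M)) \<and>
     (\<forall>U \<phi> V \<psi>. (U, \<phi>) \<in> charts_at M p \<longrightarrow> (V, \<psi>) \<in> charts_at M p \<longrightarrow>
        snd v (V, \<psi>) = jacobian (mdim M) (\<lambda>y. \<psi> (inv_into U \<phi> y)) (\<phi> p) (snd v (U, \<phi>)))"
  unfolding tangent_space_def
  by (cases v) (simp only: comp_def Ball_def split_paired_All prod.case mem_Collect_eq fst_conv snd_conv prod.inject, blast)

lemma tangent_space_fst: "v \<in> tangent_space M p \<Longrightarrow> fst v = p"
  by (simp add: mem_tangent_space)

lemma tangent_space_coord:
  "v \<in> tangent_space M p \<Longrightarrow> c \<in> charts_at M p \<Longrightarrow> snd v c \<in> topspace (Euclidean_space (mdim M))"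
  unfolding mem_tangent_space by (blast dest: PiE_mem)

lemma tangent_space_transition:
  "v \<in> tangent_space M p \<Longrightarrow> (U, \<phi>) \<in> charts_at M p \<Longrightarrow> (V, \<psi>) \<in> charts_at M p \<Longrightarrow>
    snd v (V, \<psi>) = jacobian (mdim M) (\<lambda>y. \<psi> (inv_into U \<phi> y)) (\<phi> p) (snd v (U, \<phi>))"
  unfolding mem_tangent_space by blast

lemma tangent_space_extensional: "v \<in> tangent_space M p \<Longrightarrow> snd v \<in> extensional (charts_at M p)"
  unfolding mem_tangent_space PiE_def by blast

lemma tangent_space_coords_eqI:
  assumes "v \<in> tangent_space M p" "w \<in> tangent_space M p"
    "\<And>V \<psi>. (V, \<psi>) \<in> charts_at M p \<Longrightarrow> snd v (V, \<psi>) = snd w (V, \<psi>)"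
  shows "v = w"
proof (rule prod_eqI)
  show "snd v = snd w"
  proof (rule extensionalityI[of _ "charts_at M p"])
    fix c assume "c \<in> charts_at M p"
    then show "snd v c = snd w c"
      using assms(3) by (cases c) auto
  qed (rule tangent_space_extensional, rule assms)+
qed (simp add: tangent_space_fst[OF assms(1)] tangent_space_fst[OF assms(2)])

text \<open>The transformation rule determines all coordinates from those in one chart.\<close>

lemma tangent_space_eqI:
  assumes "v \<in> tangent_space M p" "w \<in> tangent_space M p" "(U, \<phi>) \<in> charts_at M p" "snd v (U, \<phi>) = snd w (U, \<phi>)"
  shows "v = w"
  by (rule tangent_space_coords_eqI[OF assms(1,2)])
    (simp only: tangent_space_transition[OF assms(1,3)] tangent_space_transition[OF assms(2,3)] assms(4))

text \<open>The inverse of reading off coordinates in the chart c: the coordinates in any other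
  chart are forced by the transformation rule.\<close>

definition tangent_of :: "'a manifold \<Rightarrow> 'a \<Rightarrow> 'a chart \<Rightarrow> (nat \<Rightarrow> real) \<Rightarrow> 'a tangent" where
  "tangent_of M p c u =
     (p, \<lambda>d\<in>charts_at M p. jacobian (mdim M) (\<lambda>y. snd d (inv_into (fst c) (snd c) y)) (snd c p) u)"

text \<open>The cocycle rule for Jacobians of transition maps is exactly what makes the prescribed
  coordinates a tangent vector.\<close>

lemma
  assumes M: "charted M" and c: "(U, \<phi>) \<in> charts_at M p" and u: "u \<in> topspace (Euclidean_space (mdim M))"
  shows tangent_of_in: "tangent_of M p (U, \<phi>) u \<in> tangent_space M p"
    and tangent_of_coord: "snd (tangent_of M p (U, \<phi>) u) (U, \<phi>) = u"
proof -
  show "snd (tangent_of M p (U, \<phi>) u) (U, \<phi>) = u"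
    using jacobian_transition_self[OF M c u] c by (simp add: tangent_of_def)
  show "tangent_of M p (U, \<phi>) u \<in> tangent_space M p"
    unfolding mem_tangent_space
  proof (intro conjI allI impI)
    show "snd (tangent_of M p (U, \<phi>) u) \<in> charts_at M p \<rightarrow>\<^sub>E topspace (Euclidean_space (mdim M))"
    proof (rule PiE_I)
      fix d assume d: "d \<in> charts_at M p"
      then show "snd (tangent_of M p (U, \<phi>) u) d \<in> topspace (Euclidean_space (mdim M))"
        using jacobian_local_rep_in_Euclidean_space[OF M M smooth_map_id[OF M] c, of "fst d" "snd d"]
        by (simp add: tangent_of_def)
    qed (simp add: tangent_of_def)
    fix V \<psi> S \<sigma> assume "(V, \<psi>) \<in> charts_at M p" "(S, \<sigma>) \<in> charts_at M p"
    then show "snd (tangent_of M p (U, \<phi>) u) (S, \<sigma>) =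
        jacobian (mdim M) (\<lambda>y. \<sigma> (inv_into V \<psi> y)) (\<psi> p) (snd (tangent_of M p (U, \<phi>) u) (V, \<psi>))"
      using jacobian_transition_compose[OF M c, of V \<psi> S \<sigma> u] by (simp add: tangent_of_def del: charts_at_iff)
  qed (simp add: tangent_of_def)
qed

section \<open>Vector space operations and pushforward of tangent vectors\<close>

lemma tangent_add_coord: "c \<in> charts_at M (fst v) \<Longrightarrow> snd (tangent_add M v w) c = (\<lambda>i. snd v c i + snd w c i)"
  by (simp add: tangent_add_def)

lemma tangent_scale_coord: "c \<in> charts_at M (fst v) \<Longrightarrow> snd (tangent_scale M r v) c = (\<lambda>i. r * snd v c i)"
  by (simp add: tangent_scale_def)

lemma tangent_zero_coord: "c \<in> charts_at M p \<Longrightarrow> snd (tangent_zero M p) c = (\<lambda>i. 0)"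
  by (simp add: tangent_zero_def)

lemma fst_tangent_add [simp]: "fst (tangent_add M v w) = fst v"
  by (simp add: tangent_add_def)

lemma fst_tangent_scale [simp]: "fst (tangent_scale M r v) = fst v"
  by (simp add: tangent_scale_def)

lemma fst_tangent_zero [simp]: "fst (tangent_zero M p) = p"
  by (simp add: tangent_zero_def)

lemma tangent_add_in:
  assumes v: "v \<in> tangent_space M p" and w: "w \<in> tangent_space M p"
  shows "tangent_add M v w \<in> tangent_space M p"
  unfolding mem_tangent_space
proof (intro conjI allI impI)
  show "snd (tangent_add M v w) \<in> charts_at M p \<rightarrow>\<^sub>E topspace (Euclidean_space (mdim M))"
    using tangent_space_fst[OF v] tangent_space_coord[OF v] tangent_space_coord[OF w]
    by (auto simp: tangent_add_def topspace_Euclidean_space)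
  fix U \<phi> V \<psi> assume "(U, \<phi>) \<in> charts_at M p" "(V, \<psi>) \<in> charts_at M p"
  then show "snd (tangent_add M v w) (V, \<psi>) =
      jacobian (mdim M) (\<lambda>y. \<psi> (inv_into U \<phi> y)) (\<phi> p) (snd (tangent_add M v w) (U, \<phi>))"
    using tangent_space_fst[OF v] tangent_space_transition[OF v, of U \<phi> V \<psi>]
      tangent_space_transition[OF w, of U \<phi> V \<psi>]
    by (simp add: tangent_add_coord jacobian_add del: charts_at_iff)
qed (simp add: tangent_space_fst[OF v])

lemma tangent_scale_in:
  assumes v: "v \<in> tangent_space M p"
  shows "tangent_scale M r v \<in> tangent_space M p"
  unfolding mem_tangent_space
proof (intro conjI allI impI)
  show "snd (tangent_scale M r v) \<in> charts_at M p \<rightarrow>\<^sub>E topspace (Euclidean_space (mdim M))"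
    using tangent_space_fst[OF v] tangent_space_coord[OF v] by (auto simp: tangent_scale_def topspace_Euclidean_space)
  fix U \<phi> V \<psi> assume "(U, \<phi>) \<in> charts_at M p" "(V, \<psi>) \<in> charts_at M p"
  then show "snd (tangent_scale M r v) (V, \<psi>) =
      jacobian (mdim M) (\<lambda>y. \<psi> (inv_into U \<phi> y)) (\<phi> p) (snd (tangent_scale M r v) (U, \<phi>))"
    using tangent_space_fst[OF v] tangent_space_transition[OF v, of U \<phi> V \<psi>]
    by (simp add: tangent_scale_coord jacobian_scale del: charts_at_iff)
qed (simp add: tangent_space_fst[OF v])

lemma tangent_zero_in: "tangent_zero M p \<in> tangent_space M p"
  unfolding mem_tangent_space by (auto simp: tangent_zero_def topspace_Euclidean_space jacobian_zero)

lemma tangent_add_commute: "fst v = fst w \<Longrightarrow> tangent_add M v w = tangent_add M w v"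
  by (simp add: tangent_add_def add.commute)

lemma tangent_add_zero:
  assumes "v \<in> tangent_space M p"
  shows "tangent_add M v (tangent_zero M p) = v"
  by (rule tangent_space_coords_eqI[OF tangent_add_in[OF assms tangent_zero_in] assms])
    (use tangent_space_fst[OF assms] in \<open>simp add: tangent_add_coord tangent_zero_coord del: charts_at_iff\<close>)

text \<open>The definition chooses a chart by \<open>SOME\<close>. The chain rule, applied to the
  change of charts followed by f, allows any chart at p instead.\<close>

lemma pushforward_eq:
  assumes M: "charted M" and N: "charted N" and f: "smooth_map M N f"
    and v: "v \<in> tangent_space M p" and c: "(U, \<phi>) \<in> charts_at M p"
  shows "pushforward M N f v = (f p, \<lambda>d\<in>charts_at N (f p).
    jacobian (mdim M) (\<lambda>y. snd d (f (inv_into U \<phi> y))) (\<phi> p) (snd v (U, \<phi>)))"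
proof -
  define c0 where "c0 = (SOME c. c \<in> charts_at M p)"
  obtain U0 \<phi>0 where c0: "c0 = (U0, \<phi>0)"
    by (cases c0)
  have c0_in: "(U0, \<phi>0) \<in> charts_at M p"
    using someI[of "\<lambda>c. c \<in> charts_at M p", OF c] c0 unfolding c0_def by simp
  have "jacobian (mdim M) (\<lambda>y. \<psi> (f (inv_into U0 \<phi>0 y))) (\<phi>0 p) (snd v (U0, \<phi>0)) =
      jacobian (mdim M) (\<lambda>y. \<psi> (f (inv_into U \<phi> y))) (\<phi> p) (snd v (U, \<phi>))" if "(V, \<psi>) \<in> charts_at N (f p)" for V \<psi>
    using jacobian_local_rep_compose[OF M M N smooth_map_id[OF M] f c c0_in that]
      tangent_space_transition[OF v c c0_in] by simp
  then show ?thesis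
    using tangent_space_fst[OF v] c0 unfolding pushforward_def Let_def c0_def
    by (auto simp: comp_def case_prod_beta simp del: charts_at_iff intro!: restrict_ext)
qed

context
  fixes M :: "'a manifold" and N :: "'b manifold" and f :: "'a \<Rightarrow> 'b"
  assumes M: "charted M" and N: "charted N" and f: "smooth_map M N f"
begin

lemma pushforward_coord:
  assumes "v \<in> tangent_space M p" "(U, \<phi>) \<in> charts_at M p" "(V, \<psi>) \<in> charts_at N (f p)"
  shows "snd (pushforward M N f v) (V, \<psi>) =
    jacobian (mdim M) (\<lambda>y. \<psi> (f (inv_into U \<phi> y))) (\<phi> p) (snd v (U, \<phi>))"
  using pushforward_eq[OF M N f assms(1,2)] assms(3) by simp

lemma pushforward_in:
  assumes p: "p \<in> mcarrier M" and v: "v \<in> tangent_space M p"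
  shows "pushforward M N f v \<in> tangent_space N (f p)"
proof -
  obtain U \<phi> where c: "(U, \<phi>) \<in> charts_at M p"
    using charts_at_nonempty[OF M p] .
  show ?thesis
    unfolding mem_tangent_space
  proof (intro conjI allI impI)
    show "snd (pushforward M N f v) \<in> charts_at N (f p) \<rightarrow>\<^sub>E topspace (Euclidean_space (mdim N))"
      using jacobian_local_rep_in_Euclidean_space[OF M N f c] unfolding pushforward_eq[OF M N f v c] by auto
    fix V \<psi> S \<sigma> assume d: "(V, \<psi>) \<in> charts_at N (f p)" "(S, \<sigma>) \<in> charts_at N (f p)"
    show "snd (pushforward M N f v) (S, \<sigma>) =
        jacobian (mdim N) (\<lambda>y. \<sigma> (inv_into V \<psi> y)) (\<psi> (f p)) (snd (pushforward M N f v) (V, \<psi>))"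
      using jacobian_local_rep_compose[OF M N N f smooth_map_id[OF N] c d] pushforward_coord[OF v c] d
      by (simp del: charts_at_iff)
  qed (simp add: pushforward_eq[OF M N f v c])
qed

lemma pushforward_compose:
  assumes P: "charted P" and g: "smooth_map N P g" and p: "p \<in> mcarrier M" and v: "v \<in> tangent_space M p"
  shows "pushforward N P g (pushforward M N f v) = pushforward M P (\<lambda>x. g (f x)) v"
proof -
  obtain U \<phi> where c: "(U, \<phi>) \<in> charts_at M p"
    using charts_at_nonempty[OF M p] .
  obtain V \<psi> where d: "(V, \<psi>) \<in> charts_at N (f p)"
    using charts_at_nonempty[OF N smooth_map_carrier[OF f p]] .
  show ?thesis
    unfolding pushforward_eq[OF N P g pushforward_in[OF p v] d]
      pushforward_eq[OF M P smooth_map_compose[OF M N P f g] v c] pushforward_coord[OF v c d]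
    by (auto simp: jacobian_local_rep_compose[OF M N P f g c d] simp del: charts_at_iff intro!: restrict_ext)
qed

lemma pushforward_add:
  assumes p: "p \<in> mcarrier M" and v: "v \<in> tangent_space M p" and w: "w \<in> tangent_space M p"
  shows "pushforward M N f (tangent_add M v w) = tangent_add N (pushforward M N f v) (pushforward M N f w)"
proof -
  obtain U \<phi> where c: "(U, \<phi>) \<in> charts_at M p"
    using charts_at_nonempty[OF M p] .
  have "(U, \<phi>) \<in> charts_at M (fst v)"
    using c tangent_space_fst[OF v] by simp
  from tangent_add_coord[OF this, of w] show ?thesis
    unfolding pushforward_eq[OF M N f v c] pushforward_eq[OF M N f w c]
      pushforward_eq[OF M N f tangent_add_in[OF v w] c]
    by (auto simp: tangent_add_def[of N] jacobian_add intro!: restrict_ext)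
qed

lemma pushforward_scale:
  assumes p: "p \<in> mcarrier M" and v: "v \<in> tangent_space M p"
  shows "pushforward M N f (tangent_scale M r v) = tangent_scale N r (pushforward M N f v)"
proof -
  obtain U \<phi> where c: "(U, \<phi>) \<in> charts_at M p"
    using charts_at_nonempty[OF M p] .
  have "(U, \<phi>) \<in> charts_at M (fst v)"
    using c tangent_space_fst[OF v] by simp
  from tangent_scale_coord[OF this, of r] show ?thesis
    unfolding pushforward_eq[OF M N f v c] pushforward_eq[OF M N f tangent_scale_in[OF v] c]
    by (auto simp: tangent_scale_def[of N] jacobian_scale intro!: restrict_ext)
qed

lemma pushforward_zero:
  assumes p: "p \<in> mcarrier M"
  shows "pushforward M N f (tangent_zero M p) = tangent_zero N (f p)"
proof -
  obtain U \<phi> where c: "(U, \<phi>) \<in> charts_at M p"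
    using charts_at_nonempty[OF M p] .
  show ?thesis
    unfolding pushforward_eq[OF M N f tangent_zero_in c] tangent_zero_coord[OF c]
    by (simp add: tangent_zero_def jacobian_zero)
qed

lemma pushforward_cong:
  assumes p: "p \<in> mcarrier M" and v: "v \<in> tangent_space M p"
    and eq: "\<And>x. x \<in> mcarrier M \<Longrightarrow> f x = g x"
  shows "pushforward M N f v = pushforward M N g v"
proof -
  obtain U \<phi> where c: "(U, \<phi>) \<in> charts_at M p"
    using charts_at_nonempty[OF M p] .
  then have c': "(U, \<phi>) \<in> atlas M" "p \<in> U"
    by auto
  have "jacobian (mdim M) (\<lambda>y. \<psi> (f (inv_into U \<phi> y))) (\<phi> p) u = jacobian (mdim M) (\<lambda>y. \<psi> (g (inv_into U \<phi> y))) (\<phi> p) u"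
    for u and \<psi> :: "'b \<Rightarrow> nat \<Rightarrow> real"
    by (rule jacobian_cong[OF chart_image[OF charted_chart[OF M c'(1)]]])
      (use c'(2) atlas_inv[OF M c'(1)] atlas_subset[OF M c'(1)] eq in auto)
  moreover have "smooth_map M N g"
    by (rule smooth_map_cong[OF M N _ f]) (rule eq)
  ultimately show ?thesis
    using pushforward_eq[OF M N f v c] pushforward_eq[OF M N _ v c, of g] eq[OF p] by simp
qed

end

lemma pushforward_id:
  assumes M: "charted M" and p: "p \<in> mcarrier M" and v: "v \<in> tangent_space M p"
  shows "pushforward M M (\<lambda>x. x) v = v"
proof -
  obtain U \<phi> where c: "(U, \<phi>) \<in> charts_at M p"
    using charts_at_nonempty[OF M p] .
  show ?thesis
    by (rule tangent_space_coords_eqI[OF pushforward_in[OF M M smooth_map_id[OF M] p v] v])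
      (use pushforward_coord[OF M M smooth_map_id[OF M] v c] tangent_space_transition[OF v c] in auto)
qed

lemma tangent_scale_zero: "tangent_scale M r (tangent_zero M p) = tangent_zero M p"
  by (rule tangent_space_coords_eqI[OF tangent_scale_in[OF tangent_zero_in] tangent_zero_in])
    (simp add: tangent_scale_coord tangent_zero_coord del: charts_at_iff)

definition unit_vector :: "nat \<Rightarrow> nat \<Rightarrow> real" where
  "unit_vector i = (\<lambda>k. if k = i then 1 else 0)"

lemma unit_vector_in_Euclidean_space: "i < n \<Longrightarrow> unit_vector i \<in> topspace (Euclidean_space n)"
  by (auto simp: unit_vector_def topspace_Euclidean_space)

text \<open>A tangent space carries its operations as explicit functions, so a linear combination is
  built up coordinate by coordinate: \<open>?w k\<close> keeps the first k coordinates of v and each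
  step adds one multiple of a basis vector. Applied with L a fibre coordinate of a linear family of
  sections.\<close>

lemma tangent_linear_expansion:
  assumes M: "charted M" and c: "(U, \<phi>) \<in> charts_at M p"
    and add: "\<And>v w. v \<in> tangent_space M p \<Longrightarrow> w \<in> tangent_space M p \<Longrightarrow> L (tangent_add M v w) = L v + L w"
    and scale: "\<And>r v. v \<in> tangent_space M p \<Longrightarrow> L (tangent_scale M r v) = r * L v"
    and v: "v \<in> tangent_space M p"
  shows "L v = (\<Sum>i<mdim M. snd v (U, \<phi>) i * (L (tangent_of M p (U, \<phi>) (unit_vector i)) :: real))"
proof -
  let ?n = "mdim M"
  let ?b = "\<lambda>i. tangent_of M p (U, \<phi>) (unit_vector i)"
  let ?u = "\<lambda>k i. if i < k then snd v (U, \<phi>) i else 0"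
  let ?w = "\<lambda>k. tangent_of M p (U, \<phi>) (?u k)"
  have u: "?u k \<in> topspace (Euclidean_space ?n)" for k
    using tangent_space_coord[OF v c] by (auto simp: topspace_Euclidean_space)
  note w = tangent_of_in[OF M c u] and w_coord = tangent_of_coord[OF M c u]
  have partial_sum: "L (?w k) = (\<Sum>i<k. snd v (U, \<phi>) i * L (?b i))" if "k \<le> ?n" for k
    using that
  proof (induction k)
    case 0
    \<comment> \<open>Writing the zero vector as 0 times v gives it the value 0 by
      homogeneity.\<close>
    have "?w 0 = tangent_scale M 0 v"
      by (rule tangent_space_eqI[OF w tangent_scale_in[OF v] c])
        (use tangent_scale_coord[of "(U, \<phi>)" M v 0] w_coord[of 0] c tangent_space_fst[OF v] in simp)
    then show ?case
      using scale[OF v, of 0] by simp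
  next
    case (Suc k)
    then have "k < ?n"
      by simp
    note b = tangent_of_in[OF M c unit_vector_in_Euclidean_space[OF this]]
      and b_coord = tangent_of_coord[OF M c unit_vector_in_Euclidean_space[OF this]]
    let ?s = "tangent_scale M (snd v (U, \<phi>) k) (?b k)"
    have fst: "(U, \<phi>) \<in> charts_at M (fst (?b k))" "(U, \<phi>) \<in> charts_at M (fst (?w k))"
      using c tangent_space_fst[OF b] tangent_space_fst[OF w] by auto
    have "?w (Suc k) = tangent_add M (?w k) ?s"
    proof (rule tangent_space_eqI[OF w tangent_add_in[OF w tangent_scale_in[OF b]] c])
      show "snd (?w (Suc k)) (U, \<phi>) = snd (tangent_add M (?w k) ?s) (U, \<phi>)"
        unfolding tangent_add_coord[OF fst(2)] tangent_scale_coord[OF fst(1)] w_coord b_coord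
        by (auto simp: unit_vector_def fun_eq_iff less_Suc_eq)
    qed
    then show ?case
      using Suc add[OF w tangent_scale_in[OF b]] scale[OF b] by simp
  qed
  have "?w ?n = v"
    by (rule tangent_space_eqI[OF w v c])
      (use w_coord[of ?n] tangent_space_coord[OF v c] in \<open>auto simp: topspace_Euclidean_space fun_eq_iff\<close>)
  then show ?thesis
    using partial_sum[OF order.refl] by simp
qed


subsection \<open>The tangent bundle as a manifold\<close>

definition tangent_chart :: "'a manifold \<Rightarrow> 'a chart \<Rightarrow> 'a tangent \<Rightarrow> nat \<Rightarrow> real" where
  "tangent_chart M c = (\<lambda>v\<in>(\<Union>p\<in>fst c. tangent_space M p). juxtapose (mdim M) (snd c (fst v)) (snd v c))"

context
  fixes M :: "'a manifold"
  assumes M: "charted M"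
begin

private abbreviation (input) "TS U \<equiv> \<Union>p\<in>U. tangent_space M p"
private abbreviation (input) "n \<equiv> mdim M"
private abbreviation (input) "E \<equiv> topspace (Euclidean_space n)"

lemma tangent_manifold_eq:
  "tangent_manifold M = manifold_of_charts (TS (mcarrier M)) (n + n)
     {(TS (fst c), tangent_chart M c) | c. c \<in> atlas M}"
proof -
  have "{(TS U, \<lambda>v\<in>TS U. juxtapose n (\<phi> (fst v)) (snd v (U, \<phi>))) | U \<phi>. (U, \<phi>) \<in> atlas M} =
      {(TS (fst c), tangent_chart M c) | c. c \<in> atlas M}"
    unfolding tangent_chart_def by force
  then show ?thesis
    by (simp add: tangent_manifold_def)
qed

lemma mem_TS: "v \<in> TS U \<longleftrightarrow> fst v \<in> U \<and> v \<in> tangent_space M (fst v)"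
  by (auto dest: tangent_space_fst)

lemma TS_Int: "TS U \<inter> TS V = TS (U \<inter> V)"
  by (auto dest: tangent_space_fst)

context
  fixes U \<phi>
  assumes c: "(U, \<phi>) \<in> atlas M"
begin

lemma tangent_chart_tangent_of:
  assumes "p \<in> U" "u \<in> E"
  shows "tangent_of M p (U, \<phi>) u \<in> tangent_space M p"
    and "tangent_chart M (U, \<phi>) (tangent_of M p (U, \<phi>) u) = juxtapose n (\<phi> p) u"
proof -
  have c': "(U, \<phi>) \<in> charts_at M p"
    using c assms by simp
  show *: "tangent_of M p (U, \<phi>) u \<in> tangent_space M p"
    using tangent_of_in[OF M c' assms(2)] .
  then show "tangent_chart M (U, \<phi>) (tangent_of M p (U, \<phi>) u) = juxtapose n (\<phi> p) u"
    using tangent_of_coord[OF M c' assms(2)] tangent_space_fst[OF *] assms(1) by (auto simp: tangent_chart_def)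
qed

lemma tangent_chart_inverse:
  assumes "v \<in> TS U"
  shows "tangent_of M (inv_into U \<phi> (fst_coords n (tangent_chart M (U, \<phi>) v))) (U, \<phi>)
    (snd_coords n (tangent_chart M (U, \<phi>) v)) = v"
proof -
  have v: "fst v \<in> U" "v \<in> tangent_space M (fst v)"
    using assms unfolding mem_TS by auto
  have c': "(U, \<phi>) \<in> charts_at M (fst v)"
    using c v by simp
  have E: "snd v (U, \<phi>) \<in> E" "\<phi> (fst v) \<in> E"
    using tangent_space_coord[OF v(2) c'] chart_in_Euclidean_space[OF charted_chart[OF M c] v(1)] by auto
  then have coords: "fst_coords n (tangent_chart M (U, \<phi>) v) = \<phi> (fst v)"
      "snd_coords n (tangent_chart M (U, \<phi>) v) = snd v (U, \<phi>)"
    using assms by (simp_all add: tangent_chart_def fst_coords_juxtapose snd_coords_juxtapose)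
  show ?thesis
    unfolding coords atlas_inv[OF M c v(1)]
    by (rule tangent_space_eqI[OF tangent_of_in[OF M c' E(1)] v(2) c'])
      (rule tangent_of_coord[OF M c' E(1)])
qed

lemma tangent_chart_inj: "inj_on (tangent_chart M (U, \<phi>)) (TS U)"
  by (rule inj_on_inverseI[where g = "\<lambda>z. tangent_of M (inv_into U \<phi> (fst_coords n z)) (U, \<phi>) (snd_coords n z)"])
    (rule tangent_chart_inverse)

lemma tangent_chart_image:
  assumes "W \<subseteq> U"
  shows "tangent_chart M (U, \<phi>) ` TS W = (\<lambda>(x, y). juxtapose n x y) ` (\<phi> ` W \<times> E)"
proof (intro equalityI subsetI)
  fix z assume "z \<in> tangent_chart M (U, \<phi>) ` TS W"
  then obtain v where v: "fst v \<in> W" "v \<in> tangent_space M (fst v)" "z = tangent_chart M (U, \<phi>) v"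
    by (auto dest: tangent_space_fst)
  then have "z = juxtapose n (\<phi> (fst v)) (snd v (U, \<phi>))"
    using assms by (auto simp: tangent_chart_def)
  moreover have "snd v (U, \<phi>) \<in> E"
    using tangent_space_coord[OF v(2)] c v(1) assms by auto
  ultimately show "z \<in> (\<lambda>(x, y). juxtapose n x y) ` (\<phi> ` W \<times> E)"
    using v(1) by auto
next
  fix z assume "z \<in> (\<lambda>(x, y). juxtapose n x y) ` (\<phi> ` W \<times> E)"
  then obtain p u where "p \<in> W" "u \<in> E" "z = juxtapose n (\<phi> p) u"
    by auto
  then show "z \<in> tangent_chart M (U, \<phi>) ` TS W"
    using tangent_chart_tangent_of[of p u] assms
    by (intro image_eqI[of _ _ "tangent_of M p (U, \<phi>) u"]) auto
qed

lemma tangent_chart_image_open: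
  assumes "openin (mtop M) W" "W \<subseteq> U"
  shows "openin (Euclidean_space (n + n)) (tangent_chart M (U, \<phi>) ` TS W)"
  unfolding tangent_chart_image[OF assms(2)]
  using chart_image_open[OF charted_chart[OF M c] assms] by (intro juxtapose_image_open) auto

lemma tangent_chart_inv:
  assumes "z \<in> tangent_chart M (U, \<phi>) ` TS U"
  shows "inv_into (TS U) (tangent_chart M (U, \<phi>)) z =
    tangent_of M (inv_into U \<phi> (fst_coords n z)) (U, \<phi>) (snd_coords n z)"
proof -
  obtain v where v: "v \<in> TS U" "z = tangent_chart M (U, \<phi>) v"
    using assms by blast
  show ?thesis
    unfolding v(2) tangent_chart_inverse[OF v(1)] by (rule inv_into_f_f[OF tangent_chart_inj v(1)])
qed

end

text \<open>For a transition map F the induced one sends (x, u) to F x and the derivative of F at x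
  applied to u. Its second half is linear in u with partial derivatives of F as coefficients, which
  are smooth again.\<close>

lemma tangent_chart_transition:
  assumes c: "(U, \<phi>) \<in> atlas M" and d: "(V, \<psi>) \<in> atlas M"
  shows "euclid_smooth (n + n) (tangent_chart M (U, \<phi>) ` TS (U \<inter> V))
    (\<lambda>z. tangent_chart M (V, \<psi>) (inv_into (TS U) (tangent_chart M (U, \<phi>)) z))"
proof -
  let ?J = "tangent_chart M (U, \<phi>) ` TS (U \<inter> V)" and ?A = "\<phi> ` (U \<inter> V)"
  let ?F = "\<lambda>y. \<psi> (inv_into U \<phi> y)"
  let ?G = "\<lambda>z. juxtapose n (?F (fst_coords n z)) (jacobian n ?F (fst_coords n z) (snd_coords n z))"
  have J: "openin (Euclidean_space (n + n)) ?J"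
    by (rule tangent_chart_image_open[OF c]) (use atlas_open[OF M c] atlas_open[OF M d] in auto)
  have A: "openin (Euclidean_space n) ?A"
    by (rule atlas_image_open[OF M c atlas_open[OF M d]])
  have J_coords: "fst_coords n z \<in> ?A" "snd_coords n z \<in> E" if "z \<in> ?J" for z
    using that openin_subset[OF A] unfolding tangent_chart_image[OF c Int_lower1]
    by (auto simp: fst_coords_juxtapose snd_coords_juxtapose image_subset_iff)
  have F: "smooth_real n ?A (\<lambda>y. ?F y j)" for j
    using charted_transition[OF M c d] by (simp add: euclid_smooth_iff)
  have "smooth_real (n + n) ?J (\<lambda>z. ?G z j)" for j
  proof (cases "j < n")
    case True
    then show ?thesis
      using smooth_real_fst_coords[OF J A F J_coords(1)] by (simp add: juxtapose_def)
  next
    case False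
    have "smooth_real (n + n) ?J (\<lambda>z. \<Sum>i<n. partial i (\<lambda>y. ?F y k) (fst_coords n z) * snd_coords n z i)" for k
    proof (rule smooth_real_sum[OF J finite_lessThan], rule smooth_real_mult[OF J])
      fix i assume "i \<in> {..<n}"
      then have "smooth_real n ?A (partial i (\<lambda>y. ?F y k))"
        by (intro smooth_real_partial[OF F]) simp
      then show "smooth_real (n + n) ?J (\<lambda>z. partial i (\<lambda>y. ?F y k) (fst_coords n z))"
        by (rule smooth_real_fst_coords[OF J A _ J_coords(1)])
      show "smooth_real (n + n) ?J (\<lambda>z. snd_coords n z i)"
        by (simp add: snd_coords_def smooth_real_coordinate)
    qed
    then show ?thesis
      using False by (simp add: juxtapose_def jacobian_def)
  qed
  then have "euclid_smooth (n + n) ?J ?G"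
    by (simp add: euclid_smooth_iff)
  then show ?thesis
  proof (rule euclid_smooth_cong[OF J, rotated])
    fix z assume z: "z \<in> ?J"
    obtain p where p: "p \<in> U" "p \<in> V" "fst_coords n z = \<phi> p"
      using J_coords(1)[OF z] by blast
    let ?v = "tangent_of M p (U, \<phi>) (snd_coords n z)"
    have c': "(U, \<phi>) \<in> charts_at M p" and d': "(V, \<psi>) \<in> charts_at M p"
      using c d p by auto
    have v: "?v \<in> tangent_space M p" "snd ?v (U, \<phi>) = snd_coords n z"
      using tangent_of_in[OF M c' J_coords(2)[OF z]] tangent_of_coord[OF M c' J_coords(2)[OF z]] by auto
    have "z \<in> tangent_chart M (U, \<phi>) ` TS U"
      using z by blast
    from tangent_chart_inv[OF c this]
    have "inv_into (TS U) (tangent_chart M (U, \<phi>)) z = ?v"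
      by (simp add: p atlas_inv[OF M c])
    moreover have "tangent_chart M (V, \<psi>) ?v = juxtapose n (\<psi> p) (snd ?v (V, \<psi>))"
      using v(1) p(2) tangent_space_fst[OF v(1)] by (auto simp: tangent_chart_def)
    ultimately show "?G z = tangent_chart M (V, \<psi>) (inv_into (TS U) (tangent_chart M (U, \<phi>)) z)"
      using tangent_space_transition[OF v(1) c' d'] v(2) by (simp add: p atlas_inv[OF M c])
  qed
qed

lemma tangent_chart_family:
  "chart_family (TS (mcarrier M)) (n + n) {(TS (fst c), tangent_chart M c) | c. c \<in> atlas M}"
proof -
  let ?A = "{(TS (fst c), tangent_chart M c) | c. c \<in> atlas M}"
  have A: "\<exists>U \<phi>. (U, \<phi>) \<in> atlas M \<and> U' = TS U \<and> \<phi>' = tangent_chart M (U, \<phi>)" if "(U', \<phi>') \<in> ?A" for U' \<phi>'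
    using that by auto
  show ?thesis
  proof (rule chart_familyI)
    fix U' \<phi>' assume "(U', \<phi>') \<in> ?A"
    then obtain U \<phi> where c: "(U, \<phi>) \<in> atlas M" "U' = TS U" "\<phi>' = tangent_chart M (U, \<phi>)"
      using A by blast
    have "TS U \<subseteq> TS (mcarrier M)"
      using atlas_subset[OF M c(1)] by blast
    then show "U' \<subseteq> TS (mcarrier M) \<and> \<phi>' \<in> extensional U' \<and> inj_on \<phi>' U' \<and> openin (Euclidean_space (n + n)) (\<phi>' ` U')"
      using tangent_chart_image_open[OF c(1) atlas_open[OF M c(1)] order.refl] tangent_chart_inj[OF c(1)]
      unfolding c(2,3) by (simp add: tangent_chart_def)
  next
    fix v assume "v \<in> TS (mcarrier M)"
    then obtain p where p: "p \<in> mcarrier M" "v \<in> tangent_space M p"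
      by blast
    obtain U \<phi> where c: "(U, \<phi>) \<in> atlas M" "p \<in> U"
      using charted_cover[OF M p(1)] .
    have "(TS U, tangent_chart M (U, \<phi>)) \<in> ?A"
      using c(1) by (intro CollectI exI[of _ "(U, \<phi>)"]) simp
    then show "\<exists>U' \<phi>'. (U', \<phi>') \<in> ?A \<and> v \<in> U'"
      using p(2) c(2) by blast
  next
    fix U' \<phi>' V' \<psi>' assume "(U', \<phi>') \<in> ?A" "(V', \<psi>') \<in> ?A"
    then obtain U \<phi> V \<psi> where c: "(U, \<phi>) \<in> atlas M" "U' = TS U" "\<phi>' = tangent_chart M (U, \<phi>)"
        and d: "(V, \<psi>) \<in> atlas M" "V' = TS V" "\<psi>' = tangent_chart M (V, \<psi>)"
      using A by meson
    have "openin (Euclidean_space (n + n)) (tangent_chart M (U, \<phi>) ` TS (U \<inter> V))"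
      using atlas_open[OF M c(1)] atlas_open[OF M d(1)] by (intro tangent_chart_image_open[OF c(1)]) auto
    then show "openin (Euclidean_space (n + n)) (\<phi>' ` (U' \<inter> V')) \<and>
        euclid_smooth (n + n) (\<phi>' ` (U' \<inter> V')) (\<lambda>y. \<psi>' (inv_into U' \<phi>' y))"
      using tangent_chart_transition[OF c(1) d(1)] unfolding c(2,3) d(2,3) TS_Int by blast
  qed
qed

lemma charted_tangent_manifold: "charted (tangent_manifold M)"
  unfolding tangent_manifold_eq by (rule charted_manifold_of_charts[OF tangent_chart_family])

lemma mcarrier_tangent_manifold: "mcarrier (tangent_manifold M) = TS (mcarrier M)"
  unfolding tangent_manifold_eq by (rule mcarrier_manifold_of_charts[OF tangent_chart_family])

lemma mem_tangent_manifold: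
  "v \<in> mcarrier (tangent_manifold M) \<longleftrightarrow> fst v \<in> mcarrier M \<and> v \<in> tangent_space M (fst v)"
  unfolding mcarrier_tangent_manifold by (rule mem_TS)

lemma tangent_chart_in_atlas: "c \<in> atlas M \<Longrightarrow> (TS (fst c), tangent_chart M c) \<in> atlas (tangent_manifold M)"
  unfolding tangent_manifold_eq by (rule subsetD[OF chart_family_in_atlas[OF tangent_chart_family]]) blast

text \<open>The two halves of a tangent chart: coordinates of the foot and coordinates of the
  vector.\<close>

lemma
  assumes c: "(U, \<phi>) \<in> atlas M"
  shows tangent_chart_domain_open: "openin (mtop (tangent_manifold M)) (TS U)"
    and smooth_fn_tangent_base: "\<And>j. j < n \<Longrightarrow> smooth_fn (tangent_manifold M) (TS U) (\<lambda>v. \<phi> (fst v) j)"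
    and smooth_fn_tangent_coord: "\<And>j. smooth_fn (tangent_manifold M) (TS U) (\<lambda>v. snd v (U, \<phi>) j)"
proof -
  have d: "(TS U, tangent_chart M (U, \<phi>)) \<in> atlas (tangent_manifold M)"
    using tangent_chart_in_atlas[OF c] by simp
  show op: "openin (mtop (tangent_manifold M)) (TS U)"
    by (rule atlas_open[OF charted_tangent_manifold d])
  have sm: "smooth_fn (tangent_manifold M) (TS U) (\<lambda>v. juxtapose n (\<phi> (fst v)) (snd v (U, \<phi>)) j)" for j
  proof (rule smooth_fn_cong[OF charted_tangent_manifold op])
    show "smooth_fn (tangent_manifold M) (TS U) (\<lambda>v. tangent_chart M (U, \<phi>) v j)"
      by (rule smooth_fn_coordinate[OF charted_tangent_manifold d])
    show "tangent_chart M (U, \<phi>) v j = juxtapose n (\<phi> (fst v)) (snd v (U, \<phi>)) j" if "v \<in> TS U" for v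
      using that unfolding tangent_chart_def by (subst restrict_apply') simp_all
  qed
  show "smooth_fn (tangent_manifold M) (TS U) (\<lambda>v. \<phi> (fst v) j)" if "j < n" for j
    using sm[of j] that by (simp add: juxtapose_def)
  show "smooth_fn (tangent_manifold M) (TS U) (\<lambda>v. snd v (U, \<phi>) j)" for j
    using sm[of "n + j"] by (simp add: juxtapose_def)
qed

lemma smooth_map_tangent_fst: "smooth_map (tangent_manifold M) M fst"
  unfolding smooth_map_iff[OF charted_tangent_manifold M]
proof (rule smooth_onI)
  fix v assume "v \<in> mcarrier (tangent_manifold M)"
  then have v: "fst v \<in> mcarrier M" "v \<in> tangent_space M (fst v)"
    by (auto simp: mem_tangent_manifold)
  then obtain U \<phi> where c: "(U, \<phi>) \<in> atlas M" "fst v \<in> U"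
    using charted_cover[OF M] by metis
  show "smooth_at (tangent_manifold M) (mcarrier (tangent_manifold M)) M fst v"
    using c v openin_subset[OF tangent_chart_domain_open[OF c(1)]] tangent_chart_domain_open[OF c(1)]
      smooth_fn_tangent_base[OF c(1)]
    by (intro exI[of _ U] exI[of _ \<phi>] exI[of _ "TS U"]) (auto dest: tangent_space_fst)
qed (rule openin_topspace)

lemma smooth_map_tangent_zero: "smooth_map M (tangent_manifold M) (tangent_zero M)"
  unfolding smooth_map_iff[OF M charted_tangent_manifold]
proof (rule smooth_onI)
  fix p assume "p \<in> mcarrier M"
  then obtain U \<phi> where c: "(U, \<phi>) \<in> atlas M" "p \<in> U"
    using charted_cover[OF M] by metis
  have "smooth_fn M U (\<lambda>p. tangent_chart M (U, \<phi>) (tangent_zero M p) j)" for j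
  proof (rule smooth_fn_cong[OF M atlas_open[OF M c(1)]])
    show "smooth_fn M U (\<lambda>p. juxtapose n (\<phi> p) (\<lambda>i. 0) j)"
      using smooth_fn_coordinate[OF M c(1)] by (cases "j < n") (simp_all add: juxtapose_def smooth_fn_const)
    show "juxtapose n (\<phi> p) (\<lambda>i. 0) j = tangent_chart M (U, \<phi>) (tangent_zero M p) j" if "p \<in> U" for p
      using that tangent_zero_in[of M p] c(1) by (auto simp: tangent_chart_def tangent_zero_coord)
  qed
  moreover have "tangent_zero M ` U \<subseteq> TS U"
    using tangent_zero_in by (intro image_subsetI UN_I)
  ultimately show "smooth_at M (mcarrier M) (tangent_manifold M) (tangent_zero M) p"
    using c(2) tangent_chart_in_atlas[OF c(1)] atlas_open[OF M c(1)] atlas_subset[OF M c(1)]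
    by (intro exI[of _ "TS U"] exI[of _ "tangent_chart M (U, \<phi>)"] exI[of _ U]) (simp del: UN_simps)
qed (rule openin_topspace)

section \<open>A single tangent space as a manifold\<close>

context
  fixes p
  assumes p: "p \<in> mcarrier M"
begin

lemma tangent_space_coord_image:
  assumes c: "c \<in> charts_at M p"
  shows "(\<lambda>v. snd v c) ` tangent_space M p = E"
proof (intro equalityI subsetI)
  fix u assume u: "u \<in> E"
  obtain U \<phi> where c': "c = (U, \<phi>)"
    by (cases c)
  show "u \<in> (\<lambda>v. snd v c) ` tangent_space M p"
    using tangent_of_in[OF M c[unfolded c'] u] tangent_of_coord[OF M c[unfolded c'] u] unfolding c'
    by (intro image_eqI[of _ _ "tangent_of M p (U, \<phi>) u"]) auto
qed (use tangent_space_coord[OF _ c] in auto)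

lemma tangent_space_coord_inj: "c \<in> charts_at M p \<Longrightarrow> inj_on (\<lambda>v. snd v c) (tangent_space M p)"
  by (cases c) (rule inj_onI, rule tangent_space_eqI, simp_all del: charts_at_iff)

text \<open>Each chart covers the whole tangent space, and a transition is the Jacobian at the fixed
  point p, a linear map with constant coefficients.\<close>

lemma tangent_space_chart_family:
  "chart_family (tangent_space M p) n {(tangent_space M p, \<lambda>v\<in>tangent_space M p. snd v c) | c. c \<in> charts_at M p}"
proof -
  let ?T = "tangent_space M p"
  have inj: "inj_on (\<lambda>v\<in>?T. snd v c) ?T" if "c \<in> charts_at M p" for c
    using tangent_space_coord_inj[OF that] by (simp add: inj_on_def)
  have img: "(\<lambda>v\<in>?T. snd v c) ` ?T = E" if "c \<in> charts_at M p" for c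
    using tangent_space_coord_image[OF that] by simp
  have "euclid_smooth n E (\<lambda>y. (\<lambda>v\<in>?T. snd v d) (inv_into ?T (\<lambda>v\<in>?T. snd v c) y))"
    if c: "c \<in> charts_at M p" and d: "d \<in> charts_at M p" for c d
  proof -
    obtain U \<phi> V \<psi> where cd: "c = (U, \<phi>)" "d = (V, \<psi>)"
      by (metis surj_pair)
    let ?j = "jacobian n (\<lambda>y. \<psi> (inv_into U \<phi> y)) (\<phi> p)"
    have "euclid_smooth n E ?j"
      unfolding euclid_smooth_iff jacobian_def
      by (intro allI smooth_real_sum smooth_real_mult smooth_real_const smooth_real_coordinate) auto
    then show ?thesis
    proof (rule euclid_smooth_cong[rotated 2])
      fix y assume y: "y \<in> E"
      let ?v = "inv_into ?T (\<lambda>v\<in>?T. snd v c) y"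
      have "y \<in> (\<lambda>v\<in>?T. snd v c) ` ?T"
        using y img[OF c] by simp
      from inv_into_into[OF this] f_inv_into_f[OF this] have v: "?v \<in> ?T" "snd ?v c = y"
        by simp_all
      then show "?j y = (\<lambda>v\<in>?T. snd v d) ?v"
        using tangent_space_transition[OF v(1), of U \<phi> V \<psi>] c d cd by simp
    qed auto
  qed
  moreover obtain U \<phi> where "(U, \<phi>) \<in> charts_at M p"
    using charts_at_nonempty[OF M p] .
  ultimately show ?thesis
    unfolding chart_family_def using inj img by (auto simp del: charts_at_iff restrict_apply)
qed

lemma tangent_space_manifold_eq:
  "tangent_space_manifold M p = manifold_of_charts (tangent_space M p) n
     {(tangent_space M p, \<lambda>v\<in>tangent_space M p. snd v c) | c. c \<in> charts_at M p}"
  by (simp add: tangent_space_manifold_def)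

lemma charted_tangent_space_manifold: "charted (tangent_space_manifold M p)"
  unfolding tangent_space_manifold_eq by (rule charted_manifold_of_charts[OF tangent_space_chart_family])

lemma mcarrier_tangent_space_manifold: "mcarrier (tangent_space_manifold M p) = tangent_space M p"
  unfolding tangent_space_manifold_eq by (rule mcarrier_manifold_of_charts[OF tangent_space_chart_family])

lemma smooth_fn_tangent_space_coord:
  assumes "c \<in> charts_at M p"
  shows "smooth_fn (tangent_space_manifold M p) (tangent_space M p) (\<lambda>v. snd v c j)"
proof -
  have d: "(tangent_space M p, \<lambda>v\<in>tangent_space M p. snd v c) \<in> atlas (tangent_space_manifold M p)"
    unfolding tangent_space_manifold_eq using chart_family_in_atlas[OF tangent_space_chart_family] assms by blast
  show ?thesis
    by (rule smooth_fn_cong[OF charted_tangent_space_manifold atlas_open[OF charted_tangent_space_manifold d] _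
          smooth_fn_coordinate[OF charted_tangent_space_manifold d, where j = j]]) simp
qed

end

end

subsection \<open>Vector bundles in fibre coordinates\<close>

text \<open>
  A local trivialization over \<open>U\<close>, in curried form: \<open>c\<close> gives the coordinates of a vector in its
  fibre and \<open>h x\<close> the vector over \<open>x\<close> with given coordinates.
\<close>

definition fibre_coords ::
    "'x manifold \<Rightarrow> ('e, 'x) vbundle \<Rightarrow> 'x set \<Rightarrow> nat \<Rightarrow> ('e \<Rightarrow> nat \<Rightarrow> real) \<Rightarrow> ('x \<Rightarrow> (nat \<Rightarrow> real) \<Rightarrow> 'e) \<Rightarrow> bool" where
  "fibre_coords X E U r c h \<longleftrightarrow>
     openin (mtop X) U \<and>
     (\<forall>e\<in>tcarrier E. proj E e \<in> U \<longrightarrow> c e \<in> topspace (Euclidean_space r) \<and> h (proj E e) (c e) = e) \<and>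
     (\<forall>x\<in>U. \<forall>u\<in>topspace (Euclidean_space r). h x u \<in> tcarrier E \<and> proj E (h x u) = x \<and> c (h x u) = u) \<and>
     (\<forall>e\<in>tcarrier E. \<forall>e'\<in>tcarrier E. proj E e \<in> U \<longrightarrow> proj E e = proj E e' \<longrightarrow>
        vadd E e e' \<in> tcarrier E \<and> proj E (vadd E e e') = proj E e \<and> c (vadd E e e') = (\<lambda>i. c e i + c e' i)) \<and>
     (\<forall>s. \<forall>e\<in>tcarrier E. proj E e \<in> U \<longrightarrow>
        vscale E s e \<in> tcarrier E \<and> proj E (vscale E s e) = proj E e \<and> c (vscale E s e) = (\<lambda>i. s * c e i)) \<and>
     (\<forall>j<r. smooth_fn (total E) {e \<in> tcarrier E. proj E e \<in> U} (\<lambda>e. c e j)) \<and>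
     smooth_on (prod_manifold X (euclid_manifold r)) (U \<times> topspace (Euclidean_space r)) (total E) (\<lambda>p. h (fst p) (snd p))"

text \<open>The record of a bundle has no zero section. The zero of a fibre is 0 times any of its
  vectors; \<open>vscale_0\<close> shows that the choice does not matter.\<close>

definition vzero :: "('e, 'x) vbundle \<Rightarrow> 'x \<Rightarrow> 'e" where
  "vzero E x = vscale E 0 (SOME e. e \<in> tcarrier E \<and> proj E e = x)"

context
  fixes X :: "'x manifold" and E :: "('e, 'x) vbundle"
  assumes E: "vector_bundle X E"
begin

lemma bundle_charted: "charted X" "charted (total E)"
  using E smooth_manifold_charted by (auto simp: vector_bundle_def)

lemma bundle_proj_smooth: "smooth_map (total E) X (proj E)"
  using E by (simp add: vector_bundle_def)

lemma bundle_proj_smooth_on: "smooth_on (total E) (tcarrier E) X (proj E)"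
  using bundle_proj_smooth smooth_map_iff[OF bundle_charted(2,1)] by blast

lemma bundle_proj_carrier: "e \<in> tcarrier E \<Longrightarrow> proj E e \<in> mcarrier X"
  by (rule smooth_map_carrier[OF bundle_proj_smooth])

lemma bundle_preimage_open: "openin (mtop X) U \<Longrightarrow> openin (mtop (total E)) {e \<in> tcarrier E. proj E e \<in> U}"
  by (rule smooth_on_preimage_open[OF bundle_charted(2,1) bundle_proj_smooth_on])

text \<open>A trivialization is a diffeomorphism between open submanifolds. Composing with the
  identity maps into and out of them turns it into statements about smoothness on open subsets of
  the total space and of the product with Euclidean space, so later arguments never meet a
  submanifold.\<close>

lemma fibre_coords_of_trivialization:
  assumes U: "openin (mtop X) U" and triv: "local_trivialization X E r U \<Phi>"
  shows "\<exists>h. fibre_coords X E U r (\<lambda>e. snd (\<Phi> e)) h"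
proof -
  define P where "P = {e \<in> tcarrier E. proj E e \<in> U}"
  define R where "R = topspace (Euclidean_space r)"
  let ?EP = "open_submanifold (total E) P" and ?XU = "open_submanifold X U" and ?Rr = "euclid_manifold r"
  have X: "smooth_manifold X" and TE: "smooth_manifold (total E)"
    using E by (auto simp: vector_bundle_def)
  have P: "openin (mtop (total E)) P"
    unfolding P_def by (rule bundle_preimage_open[OF U])
  have cEP: "charted ?EP" and cXU: "charted ?XU" and cR: "charted ?Rr"
    using charted_open_submanifold[OF TE P] charted_open_submanifold[OF X U] charted_euclid_manifold by auto
  have carP: "mcarrier ?EP = P" and carU: "mcarrier ?XU = U"
    using mcarrier_open_submanifold[OF TE P] mcarrier_open_submanifold[OF X U] by auto
  note cprod = charted_prod_manifold[OF cXU cR]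
  have carprod: "mcarrier (prod_manifold ?XU ?Rr) = U \<times> R"
    using carU by (simp add: R_def)
  have triv': "diffeomorphism ?EP (prod_manifold ?XU ?Rr) \<Phi>" "\<And>e. e \<in> P \<Longrightarrow> fst (\<Phi> e) = proj E e"
    "\<And>e e'. e \<in> P \<Longrightarrow> e' \<in> P \<Longrightarrow> proj E e = proj E e' \<Longrightarrow>
       vadd E e e' \<in> P \<and> \<Phi> (vadd E e e') = (proj E e, \<lambda>i. snd (\<Phi> e) i + snd (\<Phi> e') i)"
    "\<And>s e. e \<in> P \<Longrightarrow> vscale E s e \<in> P \<and> \<Phi> (vscale E s e) = (proj E e, \<lambda>i. s * snd (\<Phi> e) i)"
    using triv unfolding local_trivialization_def Let_def P_def[symmetric] by blast+
  then obtain h where \<Phi>: "smooth_map ?EP (prod_manifold ?XU ?Rr) \<Phi>" and h: "smooth_map (prod_manifold ?XU ?Rr) ?EP h"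
    and h\<Phi>: "\<And>e. e \<in> P \<Longrightarrow> h (\<Phi> e) = e" and \<Phi>h: "\<And>q. q \<in> U \<times> R \<Longrightarrow> \<Phi> (h q) = q"
    unfolding diffeomorphism_def carP carprod by blast
  have \<Phi>_in: "\<Phi> e \<in> U \<times> R" if "e \<in> P" for e
    using smooth_map_carrier[OF \<Phi>] that unfolding carP carprod by blast
  have h_in: "h q \<in> P" if "q \<in> U \<times> R" for q
    using smooth_map_carrier[OF h] that unfolding carP carprod by blast
  have add: "vadd E e e' \<in> P \<and> proj E (vadd E e e') = proj E e \<and> snd (\<Phi> (vadd E e e')) = (\<lambda>i. snd (\<Phi> e) i + snd (\<Phi> e') i)"
    if "e \<in> P" "e' \<in> P" "proj E e = proj E e'" for e e'
    using triv'(3)[OF that] triv'(2)[of "vadd E e e'"] by simp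
  have scale: "vscale E s e \<in> P \<and> proj E (vscale E s e) = proj E e \<and> snd (\<Phi> (vscale E s e)) = (\<lambda>i. s * snd (\<Phi> e) i)"
    if "e \<in> P" for s e
    using triv'(4)[OF that, of s] triv'(2)[of "vscale E s e"] by simp
  have "smooth_fn (total E) P (\<lambda>e. snd (\<Phi> e) j)" for j
  proof (rule smooth_fn_pullback[OF bundle_charted(2) cR _ _ smooth_fn_euclid_coordinate])
    have 1: "smooth_on ?EP P (prod_manifold ?XU ?Rr) \<Phi>"
      using \<Phi> unfolding smooth_map_iff[OF cEP cprod] carP .
    have 2: "smooth_on (prod_manifold ?XU ?Rr) (U \<times> R) ?Rr snd"
      using smooth_map_snd[OF cXU cR] unfolding smooth_map_iff[OF cprod cR] carprod .
    have "smooth_on (total E) P (prod_manifold ?XU ?Rr) \<Phi>"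
      by (rule smooth_on_compose[OF bundle_charted(2) cEP smooth_on_into_open_submanifold[OF TE P] 1])
    then show "smooth_on (total E) P ?Rr (\<lambda>e. snd (\<Phi> e))"
      by (rule smooth_on_compose[OF bundle_charted(2) cprod _ 2]) (rule \<Phi>_in)
    show "snd (\<Phi> e) \<in> topspace (Euclidean_space r)" if "e \<in> P" for e
      using \<Phi>_in[OF that] by (auto simp: R_def)
  qed auto
  moreover have "smooth_on (prod_manifold X ?Rr) (U \<times> R) (total E) h"
  proof -
    let ?XR = "prod_manifold X ?Rr"
    note cXR = charted_prod_manifold[OF bundle_charted(1) cR]
    have UR: "openin (mtop ?XR) (U \<times> R)"
      using U by (simp add: openin_prod_Times_iff R_def)
    have fst: "smooth_on ?XR (U \<times> R) X fst" and snd: "smooth_on ?XR (U \<times> R) ?Rr snd"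
      using smooth_map_fst[OF bundle_charted(1) cR] smooth_map_snd[OF bundle_charted(1) cR] openin_subset[OF UR] UR
      by (auto simp: smooth_map_iff[OF cXR bundle_charted(1)] smooth_map_iff[OF cXR cR] intro: smooth_on_subset)
    have "smooth_on ?XR (U \<times> R) ?XU fst"
      by (rule smooth_on_compose[OF cXR bundle_charted(1) fst smooth_on_into_open_submanifold[OF X U]]) auto
    from smooth_on_Pair[OF cXR cXU cR this snd]
    have "smooth_on ?XR (U \<times> R) (prod_manifold ?XU ?Rr) (\<lambda>q. q)"
      by simp
    moreover have "smooth_on (prod_manifold ?XU ?Rr) (U \<times> R) ?EP h"
      using h unfolding smooth_map_iff[OF cprod cEP] carprod .
    ultimately have "smooth_on ?XR (U \<times> R) ?EP h"
      by (rule smooth_on_compose[OF cXR cprod]) auto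
    then show ?thesis
      by (rule smooth_on_compose[OF cXR cEP _ smooth_on_from_open_submanifold[OF TE P]]) (rule h_in)
  qed
  moreover have "snd (\<Phi> e) \<in> R \<and> h (proj E e, snd (\<Phi> e)) = e" if "e \<in> P" for e
    using \<Phi>_in[OF that] h\<Phi>[OF that] triv'(2)[OF that] by (metis mem_Times_iff prod.collapse)
  moreover have "h (x, u) \<in> P \<and> proj E (h (x, u)) = x \<and> snd (\<Phi> (h (x, u))) = u" if "x \<in> U" "u \<in> R" for x u
    using h_in[of "(x, u)"] \<Phi>h[of "(x, u)"] triv'(2)[of "h (x, u)"] that by simp
  ultimately have "fibre_coords X E U r (\<lambda>e. snd (\<Phi> e)) (\<lambda>x u. h (x, u))"
    unfolding fibre_coords_def P_def[symmetric] R_def[symmetric] using U add scale by (auto simp: P_def)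
  then show ?thesis
    by blast
qed

lemma fibre_coords_exist:
  assumes "x \<in> mcarrier X"
  obtains U r c h where "x \<in> U" "fibre_coords X E U r c h"
proof -
  obtain r U \<Phi> where "x \<in> U" "openin (mtop X) U" "local_trivialization X E r U \<Phi>"
    using E assms unfolding vector_bundle_def by blast
  then show ?thesis
    using fibre_coords_of_trivialization that by blast
qed

lemma fibre_coordsD:
  assumes "fibre_coords X E U r c h"
  shows "openin (mtop X) U"
    and "\<And>e. e \<in> tcarrier E \<Longrightarrow> proj E e \<in> U \<Longrightarrow> c e \<in> topspace (Euclidean_space r)"
    and "\<And>e. e \<in> tcarrier E \<Longrightarrow> proj E e \<in> U \<Longrightarrow> h (proj E e) (c e) = e"
    and "\<And>x u. x \<in> U \<Longrightarrow> u \<in> topspace (Euclidean_space r) \<Longrightarrow> h x u \<in> tcarrier E \<and> proj E (h x u) = x \<and> c (h x u) = u"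
    and "\<And>e e'. e \<in> tcarrier E \<Longrightarrow> e' \<in> tcarrier E \<Longrightarrow> proj E e = proj E e' \<Longrightarrow> proj E e \<in> U \<Longrightarrow>
        vadd E e e' \<in> tcarrier E \<and> proj E (vadd E e e') = proj E e"
    and "\<And>e e'. e \<in> tcarrier E \<Longrightarrow> e' \<in> tcarrier E \<Longrightarrow> proj E e = proj E e' \<Longrightarrow> proj E e \<in> U \<Longrightarrow>
        c (vadd E e e') = (\<lambda>i. c e i + c e' i)"
    and "\<And>s e. e \<in> tcarrier E \<Longrightarrow> proj E e \<in> U \<Longrightarrow> vscale E s e \<in> tcarrier E \<and> proj E (vscale E s e) = proj E e"
    and "\<And>s e. e \<in> tcarrier E \<Longrightarrow> proj E e \<in> U \<Longrightarrow> c (vscale E s e) = (\<lambda>i. s * c e i)"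
    and "\<And>j. j < r \<Longrightarrow> smooth_fn (total E) {e \<in> tcarrier E. proj E e \<in> U} (\<lambda>e. c e j)"
    and "smooth_on (prod_manifold X (euclid_manifold r)) (U \<times> topspace (Euclidean_space r)) (total E) (\<lambda>p. h (fst p) (snd p))"
  using assms unfolding fibre_coords_def by blast+

text \<open>All vector space laws in the fibres are derived through this: compare base points, then
  coordinates, where the law holds for real numbers.\<close>

lemma fibre_coords_eqI:
  assumes "fibre_coords X E U r c h" "e \<in> tcarrier E" "e' \<in> tcarrier E" "proj E e \<in> U" "proj E e = proj E e'" "c e = c e'"
  shows "e = e'"
  using fibre_coordsD(3)[OF assms(1)] assms(2-6) by metis

lemma vadd_in:
  assumes "e \<in> tcarrier E" "e' \<in> tcarrier E" "proj E e = proj E e'"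
  shows "vadd E e e' \<in> tcarrier E" "proj E (vadd E e e') = proj E e"
proof -
  obtain U r c h where "proj E e \<in> U" "fibre_coords X E U r c h"
    using fibre_coords_exist[OF bundle_proj_carrier[OF assms(1)]] .
  then show "vadd E e e' \<in> tcarrier E" "proj E (vadd E e e') = proj E e"
    using fibre_coordsD(5) assms by blast+
qed

lemma vscale_in:
  assumes "e \<in> tcarrier E"
  shows "vscale E s e \<in> tcarrier E" "proj E (vscale E s e) = proj E e"
proof -
  obtain U r c h where "proj E e \<in> U" "fibre_coords X E U r c h"
    using fibre_coords_exist[OF bundle_proj_carrier[OF assms(1)]] .
  then show "vscale E s e \<in> tcarrier E" "proj E (vscale E s e) = proj E e"
    using fibre_coordsD(7) assms by blast+
qed

lemma vzero_some:
  assumes "x \<in> mcarrier X"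
  obtains e where "e \<in> tcarrier E" "proj E e = x" "vzero E x = vscale E 0 e"
proof -
  obtain U r c h where c: "x \<in> U" "fibre_coords X E U r c h"
    using fibre_coords_exist[OF assms] .
  have "h x (\<lambda>i. 0) \<in> tcarrier E \<and> proj E (h x (\<lambda>i. 0)) = x"
    using fibre_coordsD(4)[OF c(2,1), of "\<lambda>i. 0"] by (simp add: topspace_Euclidean_space)
  from someI[of "\<lambda>e. e \<in> tcarrier E \<and> proj E e = x", OF this] show ?thesis
    using that unfolding vzero_def by blast
qed

lemma vzero_in:
  assumes "x \<in> mcarrier X"
  shows "vzero E x \<in> tcarrier E" "proj E (vzero E x) = x"
  using vzero_some[OF assms] vscale_in by metis+

lemma vzero_coord:
  assumes "fibre_coords X E U r c h" "x \<in> U"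
  shows "c (vzero E x) = (\<lambda>i. 0)"
proof -
  have "x \<in> mcarrier X"
    using fibre_coordsD(1)[OF assms(1)] assms(2) openin_subset by blast
  then obtain e where "e \<in> tcarrier E" "proj E e = x" "vzero E x = vscale E 0 e"
    by (rule vzero_some)
  then show ?thesis
    using fibre_coordsD(8)[OF assms(1)] assms(2) by simp
qed

lemma vscale_0: "e \<in> tcarrier E \<Longrightarrow> vscale E 0 e = vzero E (proj E e)"
proof -
  assume e: "e \<in> tcarrier E"
  obtain U r c h where c: "proj E e \<in> U" "fibre_coords X E U r c h"
    using fibre_coords_exist[OF bundle_proj_carrier[OF e]] .
  show ?thesis
    by (rule fibre_coords_eqI[OF c(2)])
      (simp_all add: vscale_in[OF e] vzero_in[OF bundle_proj_carrier[OF e]] c(1) vzero_coord[OF c(2,1)]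
        fibre_coordsD(8)[OF c(2) e c(1)])
qed

lemma vadd_commute:
  assumes "e \<in> tcarrier E" "e' \<in> tcarrier E" "proj E e = proj E e'"
  shows "vadd E e e' = vadd E e' e"
proof -
  obtain U r c h where c: "proj E e \<in> U" "fibre_coords X E U r c h"
    using fibre_coords_exist[OF bundle_proj_carrier[OF assms(1)]] .
  then show ?thesis
    using assms vadd_in[OF assms] vadd_in[OF assms(2,1) assms(3)[symmetric]] fibre_coordsD(6)[OF c(2)]
    by (intro fibre_coords_eqI[OF c(2)]) (simp_all add: add.commute)
qed

lemma vadd_assoc:
  assumes "e1 \<in> tcarrier E" "e2 \<in> tcarrier E" "e3 \<in> tcarrier E" "proj E e1 = proj E e2" "proj E e2 = proj E e3"
  shows "vadd E (vadd E e1 e2) e3 = vadd E e1 (vadd E e2 e3)"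
proof -
  obtain U r c h where c: "proj E e1 \<in> U" "fibre_coords X E U r c h"
    using fibre_coords_exist[OF bundle_proj_carrier[OF assms(1)]] .
  show ?thesis
    using assms c(1) vadd_in fibre_coordsD(6)[OF c(2)]
    by (intro fibre_coords_eqI[OF c(2)]) (simp_all add: add.assoc)
qed

lemma vadd_vzero:
  assumes "e \<in> tcarrier E"
  shows "vadd E e (vzero E (proj E e)) = e" "vadd E (vzero E (proj E e)) e = e"
proof -
  obtain U r c h where c: "proj E e \<in> U" "fibre_coords X E U r c h"
    using fibre_coords_exist[OF bundle_proj_carrier[OF assms(1)]] .
  note z = vzero_in[OF bundle_proj_carrier[OF assms]]
  show "vadd E e (vzero E (proj E e)) = e"
    using assms c(1) vadd_in[OF assms z(1)] z fibre_coordsD(6)[OF c(2) assms z(1)] vzero_coord[OF c(2,1)]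
    by (intro fibre_coords_eqI[OF c(2)]) simp_all
  then show "vadd E (vzero E (proj E e)) e = e"
    using vadd_commute[OF assms z(1)] z(2) by simp
qed

text \<open>The sum of two additive maps is additive by this exchange; it serves for
  \<open>affine_of\<close>, which is such a sum.\<close>

lemma vadd_interchange:
  assumes "a \<in> tcarrier E" "b \<in> tcarrier E" "c \<in> tcarrier E" "d \<in> tcarrier E"
    "proj E a = proj E b" "proj E a = proj E c" "proj E a = proj E d"
  shows "vadd E (vadd E a b) (vadd E c d) = vadd E (vadd E a c) (vadd E b d)"
proof -
  obtain U r k h where k: "proj E a \<in> U" "fibre_coords X E U r k h"
    using fibre_coords_exist[OF bundle_proj_carrier[OF assms(1)]] .
  have p: "proj E b = proj E a" "proj E c = proj E a" "proj E d = proj E a"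
    using assms by auto
  show ?thesis
    using assms(1-4) p k(1) vadd_in fibre_coordsD(6)[OF k(2)]
    by (intro fibre_coords_eqI[OF k(2)]) (simp_all add: add.assoc add.left_commute)
qed

lemma vscale_vadd:
  assumes "e \<in> tcarrier E" "e' \<in> tcarrier E" "proj E e = proj E e'"
  shows "vscale E s (vadd E e e') = vadd E (vscale E s e) (vscale E s e')"
proof -
  obtain U r c h where c: "proj E e \<in> U" "fibre_coords X E U r c h"
    using fibre_coords_exist[OF bundle_proj_carrier[OF assms(1)]] .
  have "proj E e' \<in> U"
    using assms c by simp
  then show ?thesis
    using assms c(1) vadd_in vscale_in fibre_coordsD(6,8)[OF c(2)]
    by (intro fibre_coords_eqI[OF c(2)]) (simp_all add: distrib_left)
qed

lemma smooth_fn_fibre_coords: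
  assumes M: "charted M" and c: "fibre_coords X E U r c h" and s: "smooth_on M W (total E) s"
    and sU: "\<And>y. y \<in> W \<Longrightarrow> proj E (s y) \<in> U" and j: "j < r"
  shows "smooth_fn M W (\<lambda>y. c (s y) j)"
  by (rule smooth_fn_pullback[OF M bundle_charted(2) s bundle_preimage_open[OF fibre_coordsD(1)[OF c]] fibre_coordsD(9)[OF c j]])
    (use sU smooth_on_carrier[OF bundle_charted(2) s] in auto)

text \<open>Locally s is recovered as h applied to its base point and its fibre coordinates, and h
  is smooth in both. So smoothness into the total space reduces to the base map and real-valued
  functions.\<close>

lemma smooth_into_bundleI:
  assumes M: "charted M" and p: "smooth_on M W X p"
    and s: "\<And>y. y \<in> W \<Longrightarrow> s y \<in> tcarrier E" "\<And>y. y \<in> W \<Longrightarrow> proj E (s y) = p y"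
    and coords: "\<And>U r c h j W'. fibre_coords X E U r c h \<Longrightarrow> j < r \<Longrightarrow> openin (mtop M) W' \<Longrightarrow> W' \<subseteq> W \<Longrightarrow>
      (\<And>y. y \<in> W' \<Longrightarrow> p y \<in> U) \<Longrightarrow> smooth_fn M W' (\<lambda>y. c (s y) j)"
  shows "smooth_on M W (total E) s"
proof (rule smooth_on_local[OF smooth_on_open[OF p]])
  fix y assume y: "y \<in> W"
  obtain U r c h where c: "p y \<in> U" "fibre_coords X E U r c h"
    using fibre_coords_exist[OF smooth_on_carrier[OF bundle_charted(1) p y]] .
  let ?W = "{y \<in> W. p y \<in> U}"
  note W = smooth_on_preimage_open[OF M bundle_charted(1) p fibre_coordsD(1)[OF c(2)]]
  have "smooth_on M ?W (euclid_manifold r) (\<lambda>y. c (s y))"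
  proof (rule smooth_on_euclid_manifold[OF M W])
    show "c (s y) \<in> topspace (Euclidean_space r)" if "y \<in> ?W" for y
      using fibre_coordsD(2)[OF c(2)] s that by simp
    show "smooth_fn M ?W (\<lambda>y. c (s y) j)" if "j < r" for j
      by (rule coords[OF c(2) that W]) auto
  qed
  from smooth_on_Pair[OF M bundle_charted(1) charted_euclid_manifold smooth_on_subset[OF p W] this]
  have pair: "smooth_on M ?W (prod_manifold X (euclid_manifold r)) (\<lambda>y. (p y, c (s y)))"
    by auto
  have "smooth_on M ?W (total E) (\<lambda>y. h (fst (p y, c (s y))) (snd (p y, c (s y))))"
    by (rule smooth_on_compose[OF M charted_prod_manifold[OF bundle_charted(1) charted_euclid_manifold] pair fibre_coordsD(10)[OF c(2)]])
      (use fibre_coordsD(2)[OF c(2)] s in auto)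
  then have "smooth_on M ?W (total E) s"
    by (rule smooth_on_cong[OF M]) (use fibre_coordsD(3)[OF c(2)] s in fastforce)
  then show "\<exists>W'. y \<in> W' \<and> W' \<subseteq> W \<and> smooth_on M W' (total E) s"
    using y c(1) by (intro exI[of _ ?W]) auto
qed

lemma smooth_map_vzero: "smooth_map X (total E) (vzero E)"
  unfolding smooth_map_iff[OF bundle_charted]
proof (rule smooth_into_bundleI[OF bundle_charted(1) smooth_on_id[OF bundle_charted(1)]])
  fix U r c h j W' assume c: "fibre_coords X E U r c h" and W': "openin (mtop X) W'" "\<And>y. y \<in> W' \<Longrightarrow> y \<in> U"
  show "smooth_fn X W' (\<lambda>y. c (vzero E y) j)"
    by (rule smooth_fn_cong[OF bundle_charted(1) W'(1) _ smooth_fn_const[where c = 0]])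
      (use vzero_coord[OF c] W'(2) in simp)
qed (auto intro: vzero_in)

end

section \<open>Fibrewise linear maps and bundle morphisms\<close>

lemma fibrewise_linear_vzero:
  assumes E: "vector_bundle X E" and F: "vector_bundle Y F" and lin: "fibrewise_linear E F \<psi>"
    and \<psi>: "\<And>e. e \<in> tcarrier E \<Longrightarrow> \<psi> e \<in> tcarrier F" and x: "x \<in> mcarrier X"
  shows "\<psi> (vzero E x) = vzero F (proj F (\<psi> (vzero E x)))"
proof -
  note z = vzero_in[OF E x]
  \<comment> \<open>A zero vector is 0 times itself, and \<open>\<psi>\<close> commutes with this
    factor.\<close>
  have "vzero E x = vscale E 0 (vzero E x)"
    using vscale_0[OF E z(1)] z(2) by simp
  then have "\<psi> (vzero E x) = vscale F 0 (\<psi> (vzero E x))"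
    using lin z(1) unfolding fibrewise_linear_def by metis
  also have "\<dots> = vzero F (proj F (\<psi> (vzero E x)))"
    by (rule vscale_0[OF F \<psi>[OF z(1)]])
  finally show ?thesis .
qed

lemma vscale_vzero:
  assumes E: "vector_bundle X E" and x: "x \<in> mcarrier X"
  shows "vscale E s (vzero E x) = vzero E x"
proof -
  note z = vzero_in[OF E x]
  obtain U r c h where c: "x \<in> U" "fibre_coords X E U r c h"
    using fibre_coords_exist[OF E x] .
  show ?thesis
    by (rule fibre_coords_eqI[OF E c(2)])
      (simp_all add: vscale_in[OF E z(1)] z c(1) vzero_coord[OF E c(2,1)] fibre_coordsD(8)[OF E c(2)])
qed

lemma smooth_on_vadd:
  assumes E: "vector_bundle X E" and M: "charted M"
    and s: "smooth_on M W (total E) s" and s': "smooth_on M W (total E) s'"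
    and eq: "\<And>y. y \<in> W \<Longrightarrow> proj E (s y) = proj E (s' y)"
  shows "smooth_on M W (total E) (\<lambda>y. vadd E (s y) (s' y))"
proof (rule smooth_into_bundleI[OF E M])
  note in_E = smooth_on_carrier[OF bundle_charted(2)[OF E] s] smooth_on_carrier[OF bundle_charted(2)[OF E] s']
  show "smooth_on M W X (\<lambda>y. proj E (s y))"
    by (rule smooth_on_compose[OF M bundle_charted(2)[OF E] s bundle_proj_smooth_on[OF E]]) (rule in_E(1))
  show "vadd E (s y) (s' y) \<in> tcarrier E" "proj E (vadd E (s y) (s' y)) = proj E (s y)" if "y \<in> W" for y
    using vadd_in[OF E] in_E eq that by auto
  fix U r c h j W'
  assume c: "fibre_coords X E U r c h" and j: "j < r" and W': "openin (mtop M) W'" "W' \<subseteq> W"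
    and U: "\<And>y. y \<in> W' \<Longrightarrow> proj E (s y) \<in> U"
  have "smooth_fn M W' (\<lambda>y. c (s y) j)" "smooth_fn M W' (\<lambda>y. c (s' y) j)"
    using U W'(2) eq
    by (auto intro!: smooth_fn_fibre_coords[OF E M c _ _ j] intro: smooth_on_subset[OF s W'] smooth_on_subset[OF s' W']
        simp flip: eq)
  then have "smooth_fn M W' (\<lambda>y. c (s y) j + c (s' y) j)"
    by (rule smooth_fn_add[OF M W'(1)])
  then show "smooth_fn M W' (\<lambda>y. c (vadd E (s y) (s' y)) j)"
    by (rule smooth_fn_cong[OF M W'(1), rotated])
      (use fibre_coordsD(6)[OF E c] in_E eq U W'(2) in \<open>auto simp: subset_iff\<close>)
qed

lemma bundle_homD:
  assumes "\<psi> \<in> bundle_hom E E'"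
  shows "\<psi> \<in> extensional (tcarrier E)" "smooth_map (total E) (total E') \<psi>"
    and "\<And>e. e \<in> tcarrier E \<Longrightarrow> proj E' (\<psi> e) = proj E e"
    and "\<And>e e'. e \<in> tcarrier E \<Longrightarrow> e' \<in> tcarrier E \<Longrightarrow> proj E e = proj E e' \<Longrightarrow> \<psi> (vadd E e e') = vadd E' (\<psi> e) (\<psi> e')"
    and "\<And>s e. e \<in> tcarrier E \<Longrightarrow> \<psi> (vscale E s e) = vscale E' s (\<psi> e)"
    and "\<And>e. e \<in> tcarrier E \<Longrightarrow> \<psi> e \<in> tcarrier E'"
proof -
  show sm: "smooth_map (total E) (total E') \<psi>"
    using assms by (simp add: bundle_hom_def bundle_map_over_def)
  show "\<psi> e \<in> tcarrier E'" if "e \<in> tcarrier E" for e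
    by (rule smooth_map_carrier[OF sm that])
qed (use assms in \<open>auto simp: bundle_hom_def bundle_map_over_def fibrewise_linear_def\<close>)

lemma bundle_hom_vzero:
  assumes "vector_bundle X E" "vector_bundle X E'" "\<psi> \<in> bundle_hom E E'" "x \<in> mcarrier X"
  shows "\<psi> (vzero E x) = vzero E' x"
proof -
  have "fibrewise_linear E E' \<psi>"
    using assms(3) by (simp add: bundle_hom_def bundle_map_over_def)
  from fibrewise_linear_vzero[OF assms(1,2) this bundle_homD(6)[OF assms(3)] assms(4)] show ?thesis
    using bundle_homD(3)[OF assms(3) vzero_in(1)[OF assms(1,4)]] vzero_in(2)[OF assms(1,4)] by simp
qed

lemma bundle_hom_id:
  assumes E: "vector_bundle X E"
  shows "(\<lambda>e\<in>tcarrier E. e) \<in> bundle_hom E E"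
proof -
  note cE = bundle_charted(2)[OF E]
  have "smooth_map (total E) (total E) (\<lambda>e\<in>tcarrier E. e)"
    by (rule smooth_map_cong[OF cE cE _ smooth_map_id[OF cE]]) simp
  then show ?thesis
    using vadd_in(1)[OF E] vscale_in(1)[OF E] by (simp add: bundle_hom_def bundle_map_over_def fibrewise_linear_def)
qed

lemma bundle_hom_compose:
  assumes E: "vector_bundle X E" "vector_bundle X E'" "vector_bundle X E''"
    and \<psi>: "\<psi> \<in> bundle_hom E E'" and \<theta>: "\<theta> \<in> bundle_hom E' E''"
  shows "compose (tcarrier E) \<theta> \<psi> \<in> bundle_hom E E''"
proof -
  note c = bundle_charted(2)[OF E(1)] bundle_charted(2)[OF E(2)] bundle_charted(2)[OF E(3)]
  note \<psi>D = bundle_homD[OF \<psi>] and \<theta>D = bundle_homD[OF \<theta>]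
  have "smooth_map (total E) (total E'') (compose (tcarrier E) \<theta> \<psi>)"
    by (rule smooth_map_cong[OF c(1,3) _ smooth_map_compose[OF c \<psi>D(2) \<theta>D(2)]]) (simp add: compose_def)
  moreover have "compose (tcarrier E) \<theta> \<psi> (vadd E e e') = vadd E'' (compose (tcarrier E) \<theta> \<psi> e) (compose (tcarrier E) \<theta> \<psi> e')"
    if "e \<in> tcarrier E" "e' \<in> tcarrier E" "proj E e = proj E e'" for e e'
    using that vadd_in(1)[OF E(1) that] \<psi>D(3,6) by (simp add: compose_def \<psi>D(4) \<theta>D(4))
  moreover have "compose (tcarrier E) \<theta> \<psi> (vscale E s e) = vscale E'' s (compose (tcarrier E) \<theta> \<psi> e)"
    if "e \<in> tcarrier E" for s e
    using that vscale_in(1)[OF E(1) that] \<psi>D(6) by (simp add: compose_def \<psi>D(5) \<theta>D(5))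
  moreover have "proj E'' (compose (tcarrier E) \<theta> \<psi> e) = proj E e" if "e \<in> tcarrier E" for e
    using that \<psi>D(3,6) \<theta>D(3) by (simp add: compose_def)
  ultimately show ?thesis
    by (simp add: bundle_hom_def bundle_map_over_def fibrewise_linear_def)
qed


subsection \<open>The right trivialization of the tangent group\<close>

text \<open>The Lie algebra component in the splitting of the tangent group into Lie algebra and G,
  with foot \<open>fst v\<close> as the other component. It is a cocycle rather than a homomorphism,
  see \<open>right_triv_mult\<close>.\<close>

definition right_triv :: "'g lie_group \<Rightarrow> 'g tangent \<Rightarrow> 'g tangent" where
  "right_triv G v = pushforward (mfd G) (mfd G) (\<lambda>k. k \<otimes>\<^bsub>G\<^esub> inv\<^bsub>G\<^esub> fst v) v"

context
  fixes G :: "'g lie_group"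
  assumes G: "is_lie_group G"
begin

lemma lie_group_group: "group G"
  and lie_group_charted: "charted (mfd G)"
  and lie_group_carrier: "carrier G = mcarrier (mfd G)"
  and lie_group_mult_smooth: "smooth_map (prod_manifold (mfd G) (mfd G)) (mfd G) (\<lambda>p. fst p \<otimes>\<^bsub>G\<^esub> snd p)"
  and lie_group_inv_smooth: "smooth_map (mfd G) (mfd G) (\<lambda>g. inv\<^bsub>G\<^esub> g)"
  using G smooth_manifold_charted by (auto simp: is_lie_group_def case_prod_unfold)

interpretation group G
  by (rule lie_group_group)

private abbreviation (input) "GM \<equiv> mfd G"

lemma mult_smooth:
  assumes "charted N" "smooth_map N GM f" "smooth_map N GM f'"
  shows "smooth_map N GM (\<lambda>y. f y \<otimes>\<^bsub>G\<^esub> f' y)"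
proof -
  note p = smooth_map_Pair[OF assms(1) lie_group_charted lie_group_charted assms(2,3)]
  have "smooth_map N GM (\<lambda>y. fst (f y, f' y) \<otimes>\<^bsub>G\<^esub> snd (f y, f' y))"
    by (rule smooth_map_compose[OF assms(1) charted_prod_manifold[OF lie_group_charted lie_group_charted] lie_group_charted
          p lie_group_mult_smooth])
  then show ?thesis
    by simp
qed

lemma left_mult_smooth: "g \<in> carrier G \<Longrightarrow> smooth_map GM GM (\<lambda>h. g \<otimes>\<^bsub>G\<^esub> h)"
  by (intro mult_smooth lie_group_charted smooth_map_const smooth_map_id) (simp add: lie_group_carrier)

lemma right_mult_smooth: "g \<in> carrier G \<Longrightarrow> smooth_map GM GM (\<lambda>h. h \<otimes>\<^bsub>G\<^esub> g)"
  by (intro mult_smooth lie_group_charted smooth_map_const smooth_map_id) (simp add: lie_group_carrier)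

lemma conjugation_smooth: "g \<in> carrier G \<Longrightarrow> smooth_map GM GM (\<lambda>h. g \<otimes>\<^bsub>G\<^esub> h \<otimes>\<^bsub>G\<^esub> inv\<^bsub>G\<^esub> g)"
  by (intro mult_smooth lie_group_charted smooth_map_const smooth_map_id) (simp_all add: lie_group_carrier[symmetric])

lemma tangent_group_simps [simp]:
  "mult (tangent_group G) = tangent_mult G" "one (tangent_group G) = tangent_zero GM \<one>\<^bsub>G\<^esub>"
  "mfd (tangent_group G) = tangent_manifold GM"
  by (simp_all add: tangent_group_def)

lemma tangent_group_carrier: "carrier (tangent_group G) = mcarrier (tangent_manifold GM)"
  by (simp add: tangent_group_def)

lemma mem_tangent_group: "v \<in> carrier (tangent_group G) \<longleftrightarrow> fst v \<in> carrier G \<and> v \<in> tangent_space GM (fst v)"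
  by (simp add: tangent_group_carrier mem_tangent_manifold[OF lie_group_charted] lie_group_carrier)

lemma one_in: "\<one>\<^bsub>G\<^esub> \<in> mcarrier GM"
  using one_closed by (simp add: lie_group_carrier)

lemma lie_algebra_in_tangent_group: "\<alpha> \<in> lie_algebra G \<Longrightarrow> \<alpha> \<in> carrier (tangent_group G)"
  using tangent_space_fst[of \<alpha> GM "\<one>\<^bsub>G\<^esub>"] by (simp add: mem_tangent_group)

lemma tangent_zero_in_tangent_group: "g \<in> carrier G \<Longrightarrow> tangent_zero GM g \<in> carrier (tangent_group G)"
  by (simp add: mem_tangent_group tangent_zero_in)

lemma Ad_in:
  assumes "g \<in> carrier G" "\<alpha> \<in> lie_algebra G"
  shows "Ad G g \<alpha> \<in> lie_algebra G"
  using pushforward_in[OF lie_group_charted lie_group_charted conjugation_smooth[OF assms(1)] one_in assms(2)] assms(1)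
  by (simp add: Ad_def)

lemma right_triv_in:
  assumes "v \<in> carrier (tangent_group G)"
  shows "right_triv G v \<in> lie_algebra G"
proof -
  have v: "fst v \<in> carrier G" "v \<in> tangent_space GM (fst v)"
    using assms by (auto simp: mem_tangent_group)
  then show ?thesis
    using pushforward_in[OF lie_group_charted lie_group_charted right_mult_smooth[of "inv\<^bsub>G\<^esub> fst v"] _ v(2)]
    by (simp add: right_triv_def lie_group_carrier[symmetric])
qed

lemma right_triv_add:
  assumes "v \<in> carrier (tangent_group G)" "w \<in> carrier (tangent_group G)" "fst v = fst w"
  shows "right_triv G (tangent_add GM v w) = tangent_add GM (right_triv G v) (right_triv G w)"
  using assms pushforward_add[OF lie_group_charted lie_group_charted right_mult_smooth[of "inv\<^bsub>G\<^esub> fst v"], of "fst v" v w]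
  by (simp add: right_triv_def mem_tangent_group lie_group_carrier[symmetric])

lemma right_triv_scale:
  assumes "v \<in> carrier (tangent_group G)"
  shows "right_triv G (tangent_scale GM r v) = tangent_scale GM r (right_triv G v)"
  using assms pushforward_scale[OF lie_group_charted lie_group_charted right_mult_smooth[of "inv\<^bsub>G\<^esub> fst v"], of "fst v" v r]
  by (simp add: right_triv_def mem_tangent_group lie_group_carrier[symmetric])

lemma right_triv_zero: "g \<in> carrier G \<Longrightarrow> right_triv G (tangent_zero GM g) = tangent_zero GM \<one>\<^bsub>G\<^esub>"
  using pushforward_zero[OF lie_group_charted lie_group_charted right_mult_smooth[of "inv\<^bsub>G\<^esub> g"], of g]
  by (simp add: right_triv_def lie_group_carrier[symmetric])

lemma pushforward_id_on:
  assumes f: "smooth_map GM GM f" "\<And>x. x \<in> carrier G \<Longrightarrow> f x = x" and v: "v \<in> carrier (tangent_group G)"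
  shows "pushforward GM GM f v = v"
proof -
  have v': "fst v \<in> mcarrier GM" "v \<in> tangent_space GM (fst v)"
    using v by (auto simp: mem_tangent_group lie_group_carrier)
  show ?thesis
    using pushforward_cong[OF lie_group_charted lie_group_charted f(1) v', of "\<lambda>x. x"]
      pushforward_id[OF lie_group_charted v'] f(2) by (simp add: lie_group_carrier)
qed

lemma right_triv_lie_algebra:
  assumes "\<alpha> \<in> lie_algebra G"
  shows "right_triv G \<alpha> = \<alpha>"
  using pushforward_id_on[OF right_mult_smooth[of "\<one>\<^bsub>G\<^esub>"] _ lie_algebra_in_tangent_group[OF assms]] tangent_space_fst[OF assms]
  by (simp add: right_triv_def)

text \<open>Group laws hold only on the carrier, so composites of translations agree there and not
  as functions. This permits rewriting by group laws inside a pushforward.\<close>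

lemma pushforward_compose_group:
  assumes "smooth_map GM GM f" "smooth_map GM GM f'" "v \<in> carrier (tangent_group G)"
    "smooth_map GM GM f''" "\<And>x. x \<in> carrier G \<Longrightarrow> f' (f x) = f'' x"
  shows "pushforward GM GM f' (pushforward GM GM f v) = pushforward GM GM f'' v"
proof -
  have v': "fst v \<in> mcarrier GM" "v \<in> tangent_space GM (fst v)"
    using assms(3) by (auto simp: mem_tangent_group lie_group_carrier)
  note c = lie_group_charted
  show ?thesis
    using pushforward_compose[OF c c assms(1) c assms(2) v'] 
      pushforward_cong[OF c c smooth_map_compose[OF c c c assms(1,2)] v', of f''] assms(5)
    by (simp add: lie_group_carrier)
qed

lemma pushforward_in_tangent_group:
  assumes f: "smooth_map GM GM f" and v: "v \<in> carrier (tangent_group G)"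
  shows "pushforward GM GM f v \<in> carrier (tangent_group G)" "fst (pushforward GM GM f v) = f (fst v)"
proof -
  have v': "fst v \<in> mcarrier GM" "v \<in> tangent_space GM (fst v)"
    using v by (auto simp: mem_tangent_group lie_group_carrier)
  note p = pushforward_in[OF lie_group_charted lie_group_charted f v']
  show *: "fst (pushforward GM GM f v) = f (fst v)"
    using tangent_space_fst[OF p] .
  show "pushforward GM GM f v \<in> carrier (tangent_group G)"
    using p smooth_map_carrier[OF f v'(1)] * by (simp add: mem_tangent_group lie_group_carrier)
qed

section \<open>Products in the tangent group under right trivialization\<close>

context
  fixes v w
  assumes v: "v \<in> carrier (tangent_group G)" and w: "w \<in> carrier (tangent_group G)"
begin

private lemma fst_in: "fst v \<in> carrier G" "fst w \<in> carrier G"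
  using v w by (auto simp: mem_tangent_group)

lemma tangent_mult_in: "tangent_mult G v w \<in> carrier (tangent_group G)"
  and fst_tangent_mult: "fst (tangent_mult G v w) = fst v \<otimes>\<^bsub>G\<^esub> fst w"
proof -
  note l = pushforward_in_tangent_group[OF left_mult_smooth[OF fst_in(1)] w]
  note r = pushforward_in_tangent_group[OF right_mult_smooth[OF fst_in(2)] v]
  show *: "fst (tangent_mult G v w) = fst v \<otimes>\<^bsub>G\<^esub> fst w"
    using l by (simp add: tangent_mult_def)
  show "tangent_mult G v w \<in> carrier (tangent_group G)"
    using tangent_add_in[of _ GM "fst v \<otimes>\<^bsub>G\<^esub> fst w"] l r fst_in * by (auto simp: tangent_mult_def mem_tangent_group)
qed

text \<open>Right translating \<open>L\<^sub>g w + R\<^sub>h v\<close> back to the identity conjugates the first summand.\<close>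

lemma right_triv_mult:
  "right_triv G (tangent_mult G v w) = tangent_add GM (Ad G (fst v) (right_triv G w)) (right_triv G v)"
proof -
  let ?g = "fst v" and ?h = "fst w"
  let ?R = "pushforward GM GM (\<lambda>k. k \<otimes>\<^bsub>G\<^esub> inv\<^bsub>G\<^esub> (?g \<otimes>\<^bsub>G\<^esub> ?h))"
  have gh: "?g \<in> carrier G" "?h \<in> carrier G" "?g \<otimes>\<^bsub>G\<^esub> ?h \<in> carrier G"
    using fst_in by auto
  note l = pushforward_in_tangent_group[OF left_mult_smooth[OF gh(1)] w]
  note r = pushforward_in_tangent_group[OF right_mult_smooth[OF gh(2)] v]
  have in_space: "pushforward GM GM (\<lambda>k. ?g \<otimes>\<^bsub>G\<^esub> k) w \<in> tangent_space GM (?g \<otimes>\<^bsub>G\<^esub> ?h)"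
      "pushforward GM GM (\<lambda>k. k \<otimes>\<^bsub>G\<^esub> ?h) v \<in> tangent_space GM (?g \<otimes>\<^bsub>G\<^esub> ?h)"
    using l r by (auto simp: mem_tangent_group)
  \<comment> \<open>The simplifier brackets products to the right, which separates h from its
    inverse; this restores the cancellation.\<close>
  have cancel: "?h \<otimes>\<^bsub>G\<^esub> (inv\<^bsub>G\<^esub> ?h \<otimes>\<^bsub>G\<^esub> inv\<^bsub>G\<^esub> ?g) = inv\<^bsub>G\<^esub> ?g"
    using gh by (simp flip: m_assoc)
  have "right_triv G (tangent_mult G v w) = ?R (tangent_mult G v w)"
    by (simp add: right_triv_def fst_tangent_mult)
  also have "\<dots> = tangent_add GM (?R (pushforward GM GM (\<lambda>k. ?g \<otimes>\<^bsub>G\<^esub> k) w)) (?R (pushforward GM GM (\<lambda>k. k \<otimes>\<^bsub>G\<^esub> ?h) v))"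
    unfolding tangent_mult_def
    by (rule pushforward_add[OF lie_group_charted lie_group_charted right_mult_smooth[OF inv_closed[OF gh(3)]] _ in_space])
      (use gh in \<open>simp add: lie_group_carrier\<close>)
  also have "?R (pushforward GM GM (\<lambda>k. k \<otimes>\<^bsub>G\<^esub> ?h) v) = right_triv G v"
    unfolding right_triv_def
    by (rule pushforward_compose_group[OF right_mult_smooth[OF gh(2)] right_mult_smooth[OF inv_closed[OF gh(3)]] v
          right_mult_smooth[OF inv_closed[OF gh(1)]]])
      (use gh in \<open>simp add: inv_mult_group m_assoc cancel\<close>)
  \<comment> \<open>\<open>(g k) (g h)\<^sup>-\<^sup>1 = g (k h\<^sup>-\<^sup>1)
    g\<^sup>-\<^sup>1\<close>: right translation by the inverse of h followed by conjugation with
    g.\<close>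
  also have "?R (pushforward GM GM (\<lambda>k. ?g \<otimes>\<^bsub>G\<^esub> k) w) =
      pushforward GM GM (\<lambda>k. ?g \<otimes>\<^bsub>G\<^esub> (k \<otimes>\<^bsub>G\<^esub> inv\<^bsub>G\<^esub> ?h) \<otimes>\<^bsub>G\<^esub> inv\<^bsub>G\<^esub> ?g) w"
    by (rule pushforward_compose_group[OF left_mult_smooth[OF gh(1)] right_mult_smooth[OF inv_closed[OF gh(3)]] w
          smooth_map_compose[OF lie_group_charted lie_group_charted lie_group_charted right_mult_smooth[OF inv_closed[OF gh(2)]]
            conjugation_smooth[OF gh(1)]]])
      (use gh in \<open>simp add: inv_mult_group m_assoc\<close>)
  also have "\<dots> = Ad G ?g (right_triv G w)"
    unfolding right_triv_def Ad_def
    by (rule pushforward_compose_group[symmetric, OF right_mult_smooth[OF inv_closed[OF gh(2)]] conjugation_smooth[OF gh(1)] w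
          smooth_map_compose[OF lie_group_charted lie_group_charted lie_group_charted right_mult_smooth[OF inv_closed[OF gh(2)]]
            conjugation_smooth[OF gh(1)]]]) simp
  finally show ?thesis .
qed

end

text \<open>The zero section embeds G into the tangent group as a subgroup, so restricting an action
  of the latter along it gives an action of G.\<close>

lemma tangent_mult_zero_zero:
  assumes "g \<in> carrier G" "h \<in> carrier G"
  shows "tangent_mult G (tangent_zero GM g) (tangent_zero GM h) = tangent_zero GM (g \<otimes>\<^bsub>G\<^esub> h)"
  using assms pushforward_zero[OF lie_group_charted lie_group_charted left_mult_smooth[OF assms(1)], of h]
    pushforward_zero[OF lie_group_charted lie_group_charted right_mult_smooth[OF assms(2)], of g]
    tangent_add_zero[OF tangent_zero_in]
  by (simp add: tangent_mult_def lie_group_carrier)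

text \<open>Of the two summands of the product, the one coming from the zero vector vanishes and the
  other translates \<open>right_triv G v\<close> back to the foot of v.\<close>

lemma right_triv_mult_zero:
  assumes v: "v \<in> carrier (tangent_group G)"
  shows "tangent_mult G (right_triv G v) (tangent_zero GM (fst v)) = v"
proof -
  have g: "fst v \<in> carrier G" "v \<in> tangent_space GM (fst v)"
    using v by (auto simp: mem_tangent_group)
  have fst: "fst (right_triv G v) = \<one>\<^bsub>G\<^esub>"
    using tangent_space_fst[OF right_triv_in[OF v]] .
  have "pushforward GM GM (\<lambda>k. k \<otimes>\<^bsub>G\<^esub> fst v) (right_triv G v) = pushforward GM GM (\<lambda>k. k) v"
    unfolding right_triv_def
    by (rule pushforward_compose_group[OF right_mult_smooth[OF inv_closed[OF g(1)]] right_mult_smooth[OF g(1)] v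
          smooth_map_id[OF lie_group_charted]]) (use g in \<open>simp add: m_assoc\<close>)
  also have "\<dots> = v"
    using pushforward_id_on[OF smooth_map_id[OF lie_group_charted] _ v] by simp
  finally have "pushforward GM GM (\<lambda>k. k \<otimes>\<^bsub>G\<^esub> fst v) (right_triv G v) = v" .
  moreover have "pushforward GM GM (\<lambda>h. \<one>\<^bsub>G\<^esub> \<otimes>\<^bsub>G\<^esub> h) (tangent_zero GM (fst v)) = tangent_zero GM (fst v)"
    using pushforward_zero[OF lie_group_charted lie_group_charted left_mult_smooth[OF one_closed], of "fst v"] g
    by (simp add: lie_group_carrier[symmetric])
  ultimately show ?thesis
    using tangent_add_zero[OF g(2)] tangent_add_commute[of v "tangent_zero GM (fst v)" GM]
    by (simp add: tangent_mult_def fst)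
qed

text \<open>
  In charts, right translation by \<open>inv g\<close> differentiated at \<open>g\<close> is a partial derivative of the
  multiplication at \<open>(g, inv g)\<close>, which depends smoothly on \<open>g\<close>.
\<close>

lemma smooth_fn_right_triv:
  assumes d: "(V, \<psi>) \<in> charts_at GM \<one>\<^bsub>G\<^esub>"
  shows "smooth_fn (tangent_manifold GM) (mcarrier (tangent_manifold GM)) (\<lambda>v. snd (right_triv G v) (V, \<psi>) j)"
proof (rule smooth_fn_local[OF charted_tangent_manifold[OF lie_group_charted]])
  let ?n = "mdim GM" and ?T = "tangent_manifold GM" and ?P = "prod_manifold GM GM"
  note cM = lie_group_charted and cT = charted_tangent_manifold[OF lie_group_charted]
  note cP = charted_prod_manifold[OF cM cM]
  fix v0 assume v0: "v0 \<in> mcarrier ?T"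
  then have g0: "fst v0 \<in> mcarrier GM" "fst v0 \<in> carrier G" "v0 \<in> tangent_space GM (fst v0)"
    by (auto simp: mem_tangent_manifold[OF cM] lie_group_carrier)
  then have "inv\<^bsub>G\<^esub> fst v0 \<in> mcarrier GM"
    by (simp add: lie_group_carrier[symmetric])
  then obtain U' \<phi>' where c': "(U', \<phi>') \<in> atlas GM" "inv\<^bsub>G\<^esub> fst v0 \<in> U'"
    using charted_cover[OF cM] by metis
  obtain U \<phi> where c: "(U, \<phi>) \<in> atlas GM" "fst v0 \<in> U"
    using charted_cover[OF cM g0(1)] by metis
  have d': "(V, \<psi>) \<in> atlas GM" "\<one>\<^bsub>G\<^esub> \<in> V"
    using d by auto
  define TU where "TU = (\<Union>p\<in>U. tangent_space GM p)"
  have TU: "openin (mtop ?T) TU"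
    unfolding TU_def by (rule tangent_chart_domain_open[OF cM c(1)])
  have "smooth_on ?T (mcarrier ?T) GM fst"
    using smooth_map_tangent_fst[OF cM] unfolding smooth_map_iff[OF cT cM] .
  then have fst_smooth: "smooth_on ?T TU GM fst"
    by (rule smooth_on_subset[OF _ TU openin_subset[OF TU]])
  have "smooth_on GM (mcarrier GM) GM (\<lambda>g. inv\<^bsub>G\<^esub> g)"
    using lie_group_inv_smooth unfolding smooth_map_iff[OF cM cM] .
  from smooth_on_compose[OF cT cM fst_smooth this smooth_on_carrier[OF cM fst_smooth]]
  have inv_smooth: "smooth_on ?T TU GM (\<lambda>v. inv\<^bsub>G\<^esub> fst v)" .
  \<comment> \<open>Over W the foot g and its inverse lie in the chosen charts, so the pair of them
    lies in one product chart.\<close>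
  define W where "W = {v \<in> TU. inv\<^bsub>G\<^esub> fst v \<in> U'}"
  have W: "openin (mtop ?T) W"
    unfolding W_def by (rule smooth_on_preimage_open[OF cT cM inv_smooth atlas_open[OF cM c'(1)]])
  have WD: "fst v \<in> U" "v \<in> tangent_space GM (fst v)" "inv\<^bsub>G\<^esub> fst v \<in> U'" "fst v \<in> carrier G" if "v \<in> W" for v
  proof -
    obtain p where "p \<in> U" "v \<in> tangent_space GM p"
      using \<open>v \<in> W\<close> unfolding W_def TU_def by blast
    then show "fst v \<in> U" "v \<in> tangent_space GM (fst v)" "inv\<^bsub>G\<^esub> fst v \<in> U'" "fst v \<in> carrier G"
      using that tangent_space_fst[of v GM p] atlas_subset[OF cM c(1)] by (auto simp: W_def lie_group_carrier)
  qed
  define pc where "pc = snd (prod_chart ?n (U, \<phi>) (U', \<phi>'))"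
  have pc_eq: "prod_chart ?n (U, \<phi>) (U', \<phi>') = (U \<times> U', pc)"
    by (simp add: pc_def prod_chart_def)
  have pc: "(U \<times> U', pc) \<in> atlas ?P"
    using prod_chart_in_atlas[OF cM cM c(1) c'(1)] by (simp add: pc_eq)
  have pc_juxt: "pc (x, y) = juxtapose ?n (\<phi> x) (\<phi>' y)" if "x \<in> U" "y \<in> U'" for x y
    using that by (simp add: pc_def prod_chart_def)
  \<comment> \<open>The multiplication of G written in the product chart, with values in the chart
    at the identity.\<close>
  define F where "F z = \<psi> (fst (inv_into (U \<times> U') pc z) \<otimes>\<^bsub>G\<^esub> snd (inv_into (U \<times> U') pc z))" for z
  define A where "A = {p \<in> U \<times> U'. fst p \<otimes>\<^bsub>G\<^esub> snd p \<in> V}"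
  have A: "openin (Euclidean_space (?n + ?n)) (pc ` A)"
    and F: "euclid_smooth (?n + ?n) (pc ` A) F"
    using smooth_map_local_rep(2,3)[OF cP cM lie_group_mult_smooth pc d'(1)] unfolding A_def F_def by auto
  have F_pc: "F (juxtapose ?n (\<phi> x) (\<phi>' y)) = \<psi> (x \<otimes>\<^bsub>G\<^esub> y)" if "x \<in> U" "y \<in> U'" for x y
    using atlas_inv[OF cP pc, of "(x, y)"] that by (simp add: F_def flip: pc_juxt)
  let ?D = "\<lambda>i. partial i (\<lambda>z. F z j)"
  let ?z = "\<lambda>v. juxtapose ?n (\<phi> (fst v)) (\<phi>' (inv\<^bsub>G\<^esub> fst v))"
  have eq: "snd (right_triv G v) (V, \<psi>) j = (\<Sum>i<?n. ?D i (?z v) * snd v (U, \<phi>) i)" if v: "v \<in> W" for v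
  proof -
    let ?g = "fst v"
    have "(U, \<phi>) \<in> charts_at GM ?g" "(V, \<psi>) \<in> charts_at GM (?g \<otimes>\<^bsub>G\<^esub> inv\<^bsub>G\<^esub> ?g)"
      using WD[OF v] c(1) d by auto
    from pushforward_coord[OF cM cM right_mult_smooth[OF inv_closed[OF WD(4)[OF v]]] WD(2)[OF v] this]
    have "snd (right_triv G v) (V, \<psi>) j =
        (\<Sum>i<?n. partial i (\<lambda>y. \<psi> (inv_into U \<phi> y \<otimes>\<^bsub>G\<^esub> inv\<^bsub>G\<^esub> ?g) j) (\<phi> ?g) * snd v (U, \<phi>) i)"
      by (simp add: right_triv_def jacobian_def)
    moreover have "partial i (\<lambda>y. \<psi> (inv_into U \<phi> y \<otimes>\<^bsub>G\<^esub> inv\<^bsub>G\<^esub> ?g) j) (\<phi> ?g) = ?D i (?z v)" if i: "i < ?n" for i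
    proof -
      \<comment> \<open>For i below \<open>?n\<close> the partial derivative moves only the first
        block of coordinates. The second block stays at the inverse of g, which is exactly right
        translation by that fixed element.\<close>
      have "?D i (?z v) = partial i (\<lambda>y. F (juxtapose ?n y (\<phi>' (inv\<^bsub>G\<^esub> ?g))) j) (\<phi> ?g)"
      proof -
        have "(?z v)(i := s) = juxtapose ?n ((\<phi> ?g)(i := s)) (\<phi>' (inv\<^bsub>G\<^esub> ?g))" for s
          using i by (auto simp: juxtapose_def fun_eq_iff)
        then show ?thesis
          using i by (simp add: partial_def juxtapose_def)
      qed
      also have "\<dots> = partial i (\<lambda>y. \<psi> (inv_into U \<phi> y \<otimes>\<^bsub>G\<^esub> inv\<^bsub>G\<^esub> ?g) j) (\<phi> ?g)"
        by (rule partial_cong[OF chart_image[OF charted_chart[OF cM c(1)]] _ i])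
          (use WD[OF v] F_pc atlas_inv[OF cM c(1)] in auto)
      finally show ?thesis ..
    qed
    ultimately show ?thesis
      by simp
  qed
  \<comment> \<open>The partial derivatives of F are smooth functions on a fixed open set; the
    dependence on v sits entirely in the point \<open>?z v\<close>, and inversion is smooth.\<close>
  have "smooth_fn ?T W (\<lambda>v. ?D i (?z v))" if i: "i < ?n" for i
  proof (rule smooth_fn_compose_real[OF cT W A, where g = ?z and h = "?D i"])
    show "?z v \<in> pc ` A" if "v \<in> W" for v
    proof -
      have "(fst v, inv\<^bsub>G\<^esub> fst v) \<in> A"
        using WD[OF that] d'(2) by (simp add: A_def)
      then show ?thesis
        using pc_juxt[OF WD(1)[OF that] WD(3)[OF that]] by (metis image_eqI)
    qed
    show "smooth_real (?n + ?n) (pc ` A) (?D i)"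
      using F i by (intro smooth_real_partial) (auto simp: euclid_smooth_iff)
    show "smooth_fn ?T W (\<lambda>v. ?z v k)" if "k < ?n + ?n" for k
    proof (cases "k < ?n")
      case True
      have "smooth_fn ?T W (\<lambda>v. \<phi> (fst v) k)"
        using smooth_fn_tangent_base[OF cM c(1) True] by (rule smooth_fn_subset) (auto simp: W_def TU_def)
      then show ?thesis
        using True by (simp add: juxtapose_def)
    next
      case False
      have "smooth_fn ?T W (\<lambda>v. \<phi>' (inv\<^bsub>G\<^esub> fst v) (k - ?n))"
        by (rule smooth_fn_pullback[OF cT cM smooth_on_subset[OF inv_smooth W] atlas_open[OF cM c'(1)]
              smooth_fn_coordinate[OF cM c'(1)]]) (auto simp: W_def)
      then show ?thesis
        using False by (simp add: juxtapose_def)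
    qed
  qed
  moreover have "smooth_fn ?T W (\<lambda>v. snd v (U, \<phi>) i)" for i
    using smooth_fn_tangent_coord[OF cM c(1)] by (rule smooth_fn_subset) (auto simp: W_def TU_def)
  ultimately have "smooth_fn ?T W (\<lambda>v. \<Sum>i<?n. ?D i (?z v) * snd v (U, \<phi>) i)"
    by (intro smooth_fn_sum smooth_fn_mult cT W) auto
  then have "smooth_fn ?T W (\<lambda>v. snd (right_triv G v) (V, \<psi>) j)"
    by (rule smooth_fn_cong[OF cT W, rotated]) (simp add: eq)
  moreover have "v0 \<in> W"
    using g0 c(2) c'(2) by (auto simp: W_def TU_def)
  ultimately show "\<exists>W'. openin (mtop ?T) W' \<and> v0 \<in> W' \<and> smooth_fn ?T W' (\<lambda>v. snd (right_triv G v) (V, \<psi>) j)"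
    using W by blast
qed

end

subsection \<open>Isomorphisms of categories that are the identity on morphisms\<close>

text \<open>Hom sets, identities and composition are required to be equal and not just in bijection.
  Functoriality is then immediate and the category laws can be rewritten from one side to the
  other.\<close>

definition same_morphisms :: "('o, 'm) category \<Rightarrow> ('p, 'm) category \<Rightarrow> ('o \<Rightarrow> 'p) \<Rightarrow> ('p \<Rightarrow> 'o) \<Rightarrow> bool" where
  "same_morphisms C D F K \<longleftrightarrow>
     (\<forall>a\<in>Obj C. F a \<in> Obj D \<and> K (F a) = a) \<and> (\<forall>b\<in>Obj D. K b \<in> Obj C \<and> F (K b) = b) \<and>
     (\<forall>a\<in>Obj C. Ident C a = Ident D (F a)) \<and>
     (\<forall>a\<in>Obj C. \<forall>b\<in>Obj C. Hom C a b = Hom D (F a) (F b)) \<and>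
     (\<forall>a\<in>Obj C. \<forall>b\<in>Obj C. \<forall>c\<in>Obj C. Comp C a b c = Comp D (F a) (F b) (F c))"

lemma same_morphisms_sym:
  assumes "same_morphisms C D F K"
  shows "same_morphisms D C K F"
  using assms unfolding same_morphisms_def by simp

lemma same_morphisms_trans:
  assumes "same_morphisms C D F K" "same_morphisms D B F' K'"
  shows "same_morphisms C B (\<lambda>a. F' (F a)) (\<lambda>b. K (K' b))"
  using assms unfolding same_morphisms_def by simp

lemma same_morphisms_is_functor:
  "same_morphisms C D F K \<Longrightarrow> is_functor C D F (\<lambda>a b f. f)"
  unfolding same_morphisms_def is_functor_def by simp

lemma same_morphisms_isomorphic:
  assumes "same_morphisms C D F K"
  shows "isomorphic_categories C D"
  unfolding isomorphic_categories_def
proof (intro exI conjI)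
  show "is_functor C D F (\<lambda>a b f. f)" "is_functor D C K (\<lambda>a b f. f)"
    using assms same_morphisms_sym same_morphisms_is_functor by blast+
  show "inverse_to C F (\<lambda>a b f. f) K (\<lambda>a b f. f)" "inverse_to D K (\<lambda>a b f. f) F (\<lambda>a b f. f)"
    using assms by (auto simp: inverse_to_def same_morphisms_def)
qed

text \<open>Each piece of the structure of D equals the one of C at the images under K, so the laws
  of D are those of C.\<close>

lemma same_morphisms_is_category:
  assumes s: "same_morphisms C D F K" and C: "is_category C"
  shows "is_category D"
proof -
  have K: "\<And>b. b \<in> Obj D \<Longrightarrow> K b \<in> Obj C" "\<And>b. b \<in> Obj D \<Longrightarrow> Ident D b = Ident C (K b)"
    "\<And>a b. a \<in> Obj D \<Longrightarrow> b \<in> Obj D \<Longrightarrow> Hom D a b = Hom C (K a) (K b)"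
    "\<And>a b c. a \<in> Obj D \<Longrightarrow> b \<in> Obj D \<Longrightarrow> c \<in> Obj D \<Longrightarrow> Comp D a b c = Comp C (K a) (K b) (K c)"
    using same_morphisms_sym[OF s] unfolding same_morphisms_def by blast+
  show ?thesis
    using C unfolding is_category_def by (simp add: K)
qed


subsection \<open>The three descriptions of an object\<close>

text \<open>
  What an object of the second and one of the third category have in common. The values of \<open>r\<close>
  outside the Lie algebra and outside \<open>X\<close> do not matter.
\<close>

definition equivariant_family ::
    "'g lie_group \<Rightarrow> 'x manifold \<Rightarrow> ('g \<times> 'x \<Rightarrow> 'x) \<Rightarrow> ('e, 'x) vbundle \<Rightarrow> ('g \<times> 'e \<Rightarrow> 'e) \<Rightarrow>
      ('g tangent \<Rightarrow> 'x \<Rightarrow> 'e) \<Rightarrow> bool" where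
  "equivariant_family G X t E a r \<longleftrightarrow>
     (\<forall>\<alpha>\<in>lie_algebra G. smooth_map X (total E) (r \<alpha>)) \<and>
     (\<forall>\<alpha>\<in>lie_algebra G. \<forall>x\<in>mcarrier X. proj E (r \<alpha> x) = x) \<and>
     (\<forall>\<alpha>\<in>lie_algebra G. \<forall>\<beta>\<in>lie_algebra G. \<forall>x\<in>mcarrier X.
        r (tangent_add (mfd G) \<alpha> \<beta>) x = vadd E (r \<alpha> x) (r \<beta> x)) \<and>
     (\<forall>s. \<forall>\<alpha>\<in>lie_algebra G. \<forall>x\<in>mcarrier X. r (tangent_scale (mfd G) s \<alpha>) x = vscale E s (r \<alpha> x)) \<and>
     (\<forall>g\<in>carrier G. \<forall>\<alpha>\<in>lie_algebra G. \<forall>x\<in>mcarrier X. r (Ad G g \<alpha>) (t (g, x)) = a (g, r \<alpha> x))"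

lemma equivariant_familyD:
  assumes "equivariant_family G X t E a r"
  shows "\<And>\<alpha>. \<alpha> \<in> lie_algebra G \<Longrightarrow> smooth_map X (total E) (r \<alpha>)"
    and "\<And>\<alpha> x. \<alpha> \<in> lie_algebra G \<Longrightarrow> x \<in> mcarrier X \<Longrightarrow> proj E (r \<alpha> x) = x"
    and "\<And>\<alpha> \<beta> x. \<alpha> \<in> lie_algebra G \<Longrightarrow> \<beta> \<in> lie_algebra G \<Longrightarrow> x \<in> mcarrier X \<Longrightarrow>
      r (tangent_add (mfd G) \<alpha> \<beta>) x = vadd E (r \<alpha> x) (r \<beta> x)"
    and "\<And>s \<alpha> x. \<alpha> \<in> lie_algebra G \<Longrightarrow> x \<in> mcarrier X \<Longrightarrow> r (tangent_scale (mfd G) s \<alpha>) x = vscale E s (r \<alpha> x)"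
    and "\<And>g \<alpha> x. g \<in> carrier G \<Longrightarrow> \<alpha> \<in> lie_algebra G \<Longrightarrow> x \<in> mcarrier X \<Longrightarrow> r (Ad G g \<alpha>) (t (g, x)) = a (g, r \<alpha> x)"
  using assms unfolding equivariant_family_def by blast+

definition affine_of :: "'g lie_group \<Rightarrow> ('g \<times> 'x \<Rightarrow> 'x) \<Rightarrow> ('e, 'x) vbundle \<Rightarrow> ('g \<times> 'e \<Rightarrow> 'e) \<Rightarrow>
      ('g tangent \<Rightarrow> 'x \<Rightarrow> 'e) \<Rightarrow> 'g tangent \<times> 'e \<Rightarrow> 'e" where
  "affine_of G t E a r = (\<lambda>(v, e)\<in>carrier (tangent_group G) \<times> tcarrier E.
     vadd E (a (fst v, e)) (r (right_triv G v) (t (fst v, proj E e))))"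

definition linear_part :: "'g lie_group \<Rightarrow> ('e, 'x) vbundle \<Rightarrow> ('g tangent \<times> 'e \<Rightarrow> 'e) \<Rightarrow> 'g \<times> 'e \<Rightarrow> 'e" where
  "linear_part G E \<mu> = (\<lambda>(g, e)\<in>carrier G \<times> tcarrier E. \<mu> (tangent_zero (mfd G) g, e))"

definition translation_part ::
    "'g lie_group \<Rightarrow> 'x manifold \<Rightarrow> ('e, 'x) vbundle \<Rightarrow> ('g tangent \<times> 'e \<Rightarrow> 'e) \<Rightarrow> 'g tangent \<Rightarrow> 'x \<Rightarrow> 'e" where
  "translation_part G X E \<mu> = (\<lambda>\<alpha>\<in>lie_algebra G. \<lambda>x\<in>mcarrier X. \<mu> (\<alpha>, vzero E x))"

text \<open>Turns the equation \<open>\<Gamma>(\<psi>) \<circ> \<rho> = \<rho>'\<close> into a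
  pointwise one. The conditions on morphisms in the other two categories reduce to the same
  pointwise form, which is how the Hom sets are compared.\<close>

lemma section_map_compose_eq_iff:
  assumes "\<rho> \<in> extensional A" "\<And>\<alpha>. \<alpha> \<in> A \<Longrightarrow> \<rho> \<alpha> \<in> extensional (mcarrier X)"
    and "\<rho>' \<in> extensional A" "\<And>\<alpha>. \<alpha> \<in> A \<Longrightarrow> \<rho>' \<alpha> \<in> extensional (mcarrier X)"
  shows "compose A (section_map X \<psi>) \<rho> = \<rho>' \<longleftrightarrow> (\<forall>\<alpha>\<in>A. \<forall>x\<in>mcarrier X. \<psi> (\<rho> \<alpha> x) = \<rho>' \<alpha> x)" (is "?L \<longleftrightarrow> ?R")
proof
  assume ?R
  show ?L
  proof (rule extensionalityI[of _ A])
    fix \<alpha> assume \<alpha>: "\<alpha> \<in> A"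
    show "compose A (section_map X \<psi>) \<rho> \<alpha> = \<rho>' \<alpha>"
      by (rule extensionalityI[of _ "mcarrier X"])
        (use \<alpha> \<open>?R\<close> assms(4) in \<open>auto simp: compose_def section_map_def\<close>)
  qed (simp_all add: assms(3))
qed (auto simp: compose_def section_map_def)

section \<open>Equivariant linear maps and affine actions in pointwise form\<close>

context
  fixes G :: "'g lie_group" and X :: "'x manifold" and t :: "'g \<times> 'x \<Rightarrow> 'x"
  assumes G: "is_lie_group G" and X: "smooth_manifold X" and t: "lie_action G X t"
begin

private abbreviation (input) "M \<equiv> mfd G"
private abbreviation (input) "TG \<equiv> carrier (tangent_group G)"
private abbreviation (input) "lie \<equiv> lie_algebra G"

interpretation group G
  by (rule lie_group_group[OF G])

lemma X_charted: "charted X"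
  by (rule smooth_manifold_charted[OF X])

lemma action_smooth: "smooth_map (prod_manifold M X) X t"
  and action_one: "x \<in> mcarrier X \<Longrightarrow> t (\<one>\<^bsub>G\<^esub>, x) = x"
  and action_mult: "g \<in> carrier G \<Longrightarrow> h \<in> carrier G \<Longrightarrow> x \<in> mcarrier X \<Longrightarrow> t (g, t (h, x)) = t (g \<otimes>\<^bsub>G\<^esub> h, x)"
  using t by (auto simp: lie_action_def)

lemma action_in: "g \<in> carrier G \<Longrightarrow> x \<in> mcarrier X \<Longrightarrow> t (g, x) \<in> mcarrier X"
  using smooth_map_carrier[OF action_smooth, of "(g, x)"] by (simp add: lie_group_carrier[OF G])

lemma action_inverse:
  assumes "g \<in> carrier G" "x \<in> mcarrier X"
  shows "t (inv\<^bsub>G\<^esub> g, t (g, x)) = x" "t (g, t (inv\<^bsub>G\<^esub> g, x)) = x"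
  using assms by (simp_all add: action_mult action_one)

lemma equivariant_family_cong:
  assumes "\<And>\<alpha> x. \<alpha> \<in> lie \<Longrightarrow> x \<in> mcarrier X \<Longrightarrow> r \<alpha> x = r' \<alpha> x" and E: "vector_bundle X E"
    and r: "equivariant_family G X t E a r"
  shows "equivariant_family G X t E a r'"
proof -
  note rD = equivariant_familyD[OF r]
  note M_in = tangent_add_in[where M = M] tangent_scale_in[where M = M] Ad_in[OF G] action_in
  have "smooth_map X (total E) (r' \<alpha>)" if "\<alpha> \<in> lie" for \<alpha>
    by (rule smooth_map_cong[OF X_charted bundle_charted(2)[OF E] _ rD(1)[OF that]]) (rule assms(1)[OF that])
  then show ?thesis
    unfolding equivariant_family_def using rD(2-5) M_in by (simp add: assms(1)[symmetric])
qed

text \<open>The action on sections involves the inverse of g in the argument. Substituting g x for x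
  removes it, which gives the shape used in \<open>equivariant_family\<close>; the other way one
  substitutes \<open>t (inv g, x)\<close>.\<close>

lemma equivariant_linear_iff:
  assumes E: "vector_bundle X E"
  shows "equivariant_linear G X t (E, a) \<rho> \<longleftrightarrow>
    \<rho> \<in> extensional lie \<and> (\<forall>\<alpha>\<in>lie. \<rho> \<alpha> \<in> extensional (mcarrier X)) \<and> equivariant_family G X t E a \<rho>"
    (is "?L \<longleftrightarrow> ?R")
proof
  assume L: ?L
  then have sec: "\<rho> \<in> extensional lie" "\<And>\<alpha>. \<alpha> \<in> lie \<Longrightarrow> \<rho> \<alpha> \<in> sections X E"
    by (auto simp: equivariant_linear_def PiE_iff)
  have "\<rho> (Ad G g \<alpha>) (t (g, x)) = a (g, \<rho> \<alpha> x)" if "g \<in> carrier G" "\<alpha> \<in> lie" "x \<in> mcarrier X" for g \<alpha> x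
  proof -
    have "\<rho> (Ad G g \<alpha>) = section_action G X t a g (\<rho> \<alpha>)"
      using L that by (simp add: equivariant_linear_def)
    then show ?thesis
      using that action_in by (simp add: section_action_def action_inverse)
  qed
  then show ?R
    using L sec by (auto simp: equivariant_linear_def equivariant_family_def sections_def section_add_def section_scale_def)
next
  assume R: ?R
  then have r: "equivariant_family G X t E a \<rho>" and ext: "\<And>\<alpha>. \<alpha> \<in> lie \<Longrightarrow> \<rho> \<alpha> \<in> extensional (mcarrier X)"
    by auto
  note rD = equivariant_familyD[OF r]
  have "\<rho> (tangent_add M \<alpha> \<beta>) = section_add X E (\<rho> \<alpha>) (\<rho> \<beta>)" if "\<alpha> \<in> lie" "\<beta> \<in> lie" for \<alpha> \<beta>
    by (rule extensionalityI[OF ext[OF tangent_add_in[OF that]]]) (use rD(3) that in \<open>auto simp: section_add_def\<close>)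
  moreover have "\<rho> (tangent_scale M s \<alpha>) = section_scale X E s (\<rho> \<alpha>)" if "\<alpha> \<in> lie" for s \<alpha>
    by (rule extensionalityI[OF ext[OF tangent_scale_in[OF that]]]) (use rD(4) that in \<open>auto simp: section_scale_def\<close>)
  moreover have "\<rho> (Ad G g \<alpha>) = section_action G X t a g (\<rho> \<alpha>)" if "g \<in> carrier G" "\<alpha> \<in> lie" for g \<alpha>
  proof (rule extensionalityI[OF ext[OF Ad_in[OF G that]]])
    fix x assume x: "x \<in> mcarrier X"
    then show "\<rho> (Ad G g \<alpha>) x = section_action G X t a g (\<rho> \<alpha>) x"
      using rD(5)[OF that, of "t (inv\<^bsub>G\<^esub> g, x)"] that action_in action_inverse(2)[OF that(1) x]
      by (simp add: section_action_def)
  qed (simp add: section_action_def)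
  ultimately show ?L
    using R rD(1,2) by (auto simp: equivariant_linear_def sections_def PiE_iff)
qed

lemma equivariant_bundleD:
  assumes "equivariant_bundle G X t (E, a)"
  shows "vector_bundle X E" "a \<in> extensional (carrier G \<times> tcarrier E)"
    and "smooth_map (prod_manifold M (total E)) (total E) a"
    and "\<And>e. e \<in> tcarrier E \<Longrightarrow> a (\<one>\<^bsub>G\<^esub>, e) = e"
    and "\<And>g h e. g \<in> carrier G \<Longrightarrow> h \<in> carrier G \<Longrightarrow> e \<in> tcarrier E \<Longrightarrow> a (g, a (h, e)) = a (g \<otimes>\<^bsub>G\<^esub> h, e)"
    and "\<And>g e. g \<in> carrier G \<Longrightarrow> e \<in> tcarrier E \<Longrightarrow> proj E (a (g, e)) = t (g, proj E e)"
    and "\<And>g e e'. g \<in> carrier G \<Longrightarrow> e \<in> tcarrier E \<Longrightarrow> e' \<in> tcarrier E \<Longrightarrow> proj E e = proj E e' \<Longrightarrow>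
      a (g, vadd E e e') = vadd E (a (g, e)) (a (g, e'))"
    and "\<And>g s e. g \<in> carrier G \<Longrightarrow> e \<in> tcarrier E \<Longrightarrow> a (g, vscale E s e) = vscale E s (a (g, e))"
    and "\<And>g e. g \<in> carrier G \<Longrightarrow> e \<in> tcarrier E \<Longrightarrow> a (g, e) \<in> tcarrier E"
proof -
  show sm: "smooth_map (prod_manifold M (total E)) (total E) a"
    using assms by (simp add: equivariant_bundle_def lie_action_def)
  show "a (g, e) \<in> tcarrier E" if "g \<in> carrier G" "e \<in> tcarrier E" for g e
    using smooth_map_carrier[OF sm, of "(g, e)"] that by (simp add: lie_group_carrier[OF G])
qed (use assms in \<open>auto simp: equivariant_bundle_def lie_action_def fibrewise_linear_def\<close>)

text \<open>Unfolds the external sum, whose operations are componentwise on the sum of a tangent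
  space of G and a fibre of E. Linearity is joint in v and e, and this is what separates
  \<open>\<mu>\<close> into two summands.\<close>

lemma affine_action_iff:
  "affine_action G X t (E, \<mu>) \<longleftrightarrow>
    vector_bundle X E \<and> \<mu> \<in> extensional (TG \<times> tcarrier E) \<and>
    smooth_map (prod_manifold (tangent_manifold M) (total E)) (total E) \<mu> \<and>
    (\<forall>e\<in>tcarrier E. \<mu> (tangent_zero M \<one>\<^bsub>G\<^esub>, e) = e) \<and>
    (\<forall>v\<in>TG. \<forall>w\<in>TG. \<forall>e\<in>tcarrier E. \<mu> (v, \<mu> (w, e)) = \<mu> (tangent_mult G v w, e)) \<and>
    (\<forall>v\<in>TG. \<forall>e\<in>tcarrier E. proj E (\<mu> (v, e)) = t (fst v, proj E e)) \<and>
    (\<forall>v\<in>TG. \<forall>w\<in>TG. \<forall>e\<in>tcarrier E. \<forall>e'\<in>tcarrier E. fst v = fst w \<longrightarrow> proj E e = proj E e' \<longrightarrow>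
       \<mu> (tangent_add M v w, vadd E e e') = vadd E (\<mu> (v, e)) (\<mu> (w, e'))) \<and>
    (\<forall>s. \<forall>v\<in>TG. \<forall>e\<in>tcarrier E. \<mu> (tangent_scale M s v, vscale E s e) = vscale E s (\<mu> (v, e)))"
proof -
  let ?S = "external_sum (tangent_bundle M) E"
  have TG: "mcarrier (tangent_manifold M) = TG"
    by (simp add: tangent_group_carrier[OF G])
  have total: "total ?S = prod_manifold (tangent_manifold M) (total E)"
    by (simp add: external_sum_def make_bundle_def tangent_bundle_def)
  have proj: "proj ?S (v, e) = (fst v, proj E e)" if "v \<in> TG" "e \<in> tcarrier E" for v e
    using that by (simp add: external_sum_def make_bundle_def tangent_bundle_def TG)
  have add: "vadd ?S (v, e) (w, e') = (tangent_add M v w, vadd E e e')"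
    if "v \<in> TG" "w \<in> TG" "e \<in> tcarrier E" "e' \<in> tcarrier E" "fst v = fst w" "proj E e = proj E e'" for v w e e'
    using that by (simp add: external_sum_def make_bundle_def tangent_bundle_def TG)
  have scale: "vscale ?S s (v, e) = (tangent_scale M s v, vscale E s e)" if "v \<in> TG" "e \<in> tcarrier E" for s v e
    using that by (simp add: external_sum_def make_bundle_def tangent_bundle_def TG)
  have "bundle_map_over t ?S E \<mu> \<longleftrightarrow>
      smooth_map (prod_manifold (tangent_manifold M) (total E)) (total E) \<mu> \<and>
      (\<forall>v\<in>TG. \<forall>e\<in>tcarrier E. proj E (\<mu> (v, e)) = t (fst v, proj E e)) \<and>
      (\<forall>v\<in>TG. \<forall>w\<in>TG. \<forall>e\<in>tcarrier E. \<forall>e'\<in>tcarrier E. fst v = fst w \<longrightarrow> proj E e = proj E e' \<longrightarrow>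
         \<mu> (tangent_add M v w, vadd E e e') = vadd E (\<mu> (v, e)) (\<mu> (w, e'))) \<and>
      (\<forall>s. \<forall>v\<in>TG. \<forall>e\<in>tcarrier E. \<mu> (tangent_scale M s v, vscale E s e) = vscale E s (\<mu> (v, e)))"
    unfolding bundle_map_over_def fibrewise_linear_def total prod_manifold_simps topspace_prod_topology TG
    by (auto simp: proj add scale)
  \<comment> \<open>Smoothness of \<open>\<mu>\<close> occurs in the action as well as in the bundle
    map; the two occurrences are merged.\<close>
  then show ?thesis
    unfolding affine_action_def lie_action_def prod.case tangent_group_simps[OF G] by (simp only: conj_ac conj_left_absorb)
qed

lemma affine_actionD:
  assumes "affine_action G X t (E, \<mu>)"
  shows "vector_bundle X E" "\<mu> \<in> extensional (TG \<times> tcarrier E)"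
    and "smooth_map (prod_manifold (tangent_manifold M) (total E)) (total E) \<mu>"
    and "\<And>e. e \<in> tcarrier E \<Longrightarrow> \<mu> (tangent_zero M \<one>\<^bsub>G\<^esub>, e) = e"
    and "\<And>v w e. v \<in> TG \<Longrightarrow> w \<in> TG \<Longrightarrow> e \<in> tcarrier E \<Longrightarrow> \<mu> (v, \<mu> (w, e)) = \<mu> (tangent_mult G v w, e)"
    and "\<And>v e. v \<in> TG \<Longrightarrow> e \<in> tcarrier E \<Longrightarrow> proj E (\<mu> (v, e)) = t (fst v, proj E e)"
    and "\<And>v w e e'. v \<in> TG \<Longrightarrow> w \<in> TG \<Longrightarrow> e \<in> tcarrier E \<Longrightarrow> e' \<in> tcarrier E \<Longrightarrow> fst v = fst w \<Longrightarrow>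
      proj E e = proj E e' \<Longrightarrow> \<mu> (tangent_add M v w, vadd E e e') = vadd E (\<mu> (v, e)) (\<mu> (w, e'))"
    and "\<And>s v e. v \<in> TG \<Longrightarrow> e \<in> tcarrier E \<Longrightarrow> \<mu> (tangent_scale M s v, vscale E s e) = vscale E s (\<mu> (v, e))"
    and "\<And>v e. v \<in> TG \<Longrightarrow> e \<in> tcarrier E \<Longrightarrow> \<mu> (v, e) \<in> tcarrier E"
proof -
  show sm: "smooth_map (prod_manifold (tangent_manifold M) (total E)) (total E) \<mu>"
    using assms by (simp add: affine_action_iff)
  show "\<mu> (v, e) \<in> tcarrier E" if "v \<in> TG" "e \<in> tcarrier E" for v e
    using smooth_map_carrier[OF sm, of "(v, e)"] that by (simp add: tangent_group_carrier[OF G])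
qed (use assms in \<open>unfold affine_action_iff, blast+\<close>)

section \<open>From an affine action to its linear and translation parts\<close>

context
  fixes E :: "('e, 'x) vbundle" and \<mu>
  assumes \<mu>: "affine_action G X t (E, \<mu>)"
begin

private lemmas \<mu>D = affine_actionD[OF \<mu>]
private lemmas E = \<mu>D(1)
private lemmas z = vzero_in[OF E]

text \<open>The pair of zero vectors is the zero of its fibre in the external sum, so a fibrewise
  linear map sends it to a zero vector.\<close>

lemma affine_vzero:
  assumes "g \<in> carrier G" "x \<in> mcarrier X"
  shows "\<mu> (tangent_zero M g, vzero E x) = vzero E (t (g, x))"
proof -
  note g = tangent_zero_in_tangent_group[OF G assms(1)]
  have "\<mu> (tangent_zero M g, vzero E x) = vscale E 0 (\<mu> (tangent_zero M g, vzero E x))"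
    using \<mu>D(8)[OF g z(1)[OF assms(2)], of 0] by (simp add: tangent_scale_zero vscale_vzero[OF E assms(2)])
  then show ?thesis
    using vscale_0[OF E \<mu>D(9)[OF g z(1)[OF assms(2)]]] \<mu>D(6)[OF g z(1)[OF assms(2)]] z(2)[OF assms(2)] by simp
qed

text \<open>Factor v as its right trivialization times a zero tangent vector; the latter only moves
  the zero vector over x to the one over g x.\<close>

lemma affine_on_vzero:
  assumes v: "v \<in> TG" and x: "x \<in> mcarrier X"
  shows "\<mu> (v, vzero E x) = \<mu> (right_triv G v, vzero E (t (fst v, x)))"
proof -
  have g: "fst v \<in> carrier G"
    using v by (simp add: mem_tangent_group[OF G])
  have "\<mu> (v, vzero E x) = \<mu> (tangent_mult G (right_triv G v) (tangent_zero M (fst v)), vzero E x)"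
    by (simp add: right_triv_mult_zero[OF G v])
  also have "\<dots> = \<mu> (right_triv G v, \<mu> (tangent_zero M (fst v), vzero E x))"
    using \<mu>D(5)[OF lie_algebra_in_tangent_group[OF G right_triv_in[OF G v]] tangent_zero_in_tangent_group[OF G g] z(1)[OF x]] ..
  finally show ?thesis
    by (simp add: affine_vzero[OF g x])
qed

lemma affine_of_parts: "affine_of G t E (linear_part G E \<mu>) (translation_part G X E \<mu>) = \<mu>"
proof (rule extensionalityI[of _ "TG \<times> tcarrier E"])
  fix q assume "q \<in> TG \<times> tcarrier E"
  then obtain v e where q: "q = (v, e)" "v \<in> TG" "e \<in> tcarrier E"
    by auto
  have g: "fst v \<in> carrier G" "v \<in> tangent_space M (fst v)"
    using q(2) by (auto simp: mem_tangent_group[OF G])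
  note x = bundle_proj_carrier[OF E q(3)]
  note g0 = tangent_zero_in_tangent_group[OF G g(1)]
  have "\<mu> (v, e) = \<mu> (tangent_add M (tangent_zero M (fst v)) v, vadd E e (vzero E (proj E e)))"
    using tangent_add_zero[OF g(2)] tangent_add_commute[of v "tangent_zero M (fst v)" M] vadd_vzero(1)[OF E q(3)] by simp
  also have "\<dots> = vadd E (\<mu> (tangent_zero M (fst v), e)) (\<mu> (v, vzero E (proj E e)))"
    using z(2)[OF x] by (intro \<mu>D(7) g0 q z(1) x) simp_all
  also have "\<mu> (v, vzero E (proj E e)) = translation_part G X E \<mu> (right_triv G v) (t (fst v, proj E e))"
    using right_triv_in[OF G q(2)] action_in[OF g(1) x] affine_on_vzero[OF q(2) x] by (simp add: translation_part_def)
  finally show "affine_of G t E (linear_part G E \<mu>) (translation_part G X E \<mu>) q = \<mu> q"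
    using q g(1) by (simp add: affine_of_def linear_part_def)
qed (simp_all add: affine_of_def \<mu>D(2))

text \<open>\<open>\<mu>\<close> is restricted along the zero section of the tangent bundle of G.
  That section is smooth and multiplicative, and zero vectors are stable under the fibre operations,
  which yields smoothness, the action law and linearity in turn.\<close>

lemma equivariant_bundle_linear_part: "equivariant_bundle G X t (E, linear_part G E \<mu>)"
proof -
  let ?a = "linear_part G E \<mu>"
  note cM = lie_group_charted[OF G] and cE = bundle_charted(2)[OF E]
  note cT = charted_tangent_manifold[OF cM]
  let ?P = "prod_manifold M (total E)"
  note cP = charted_prod_manifold[OF cM cE]
  have a: "?a (g, e) = \<mu> (tangent_zero M g, e)" if "g \<in> carrier G" "e \<in> tcarrier E" for g e
    using that by (simp add: linear_part_def)
  note g0 = tangent_zero_in_tangent_group[OF G]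
  have "smooth_map ?P (prod_manifold (tangent_manifold M) (total E)) (\<lambda>q. (tangent_zero M (fst q), snd q))"
    by (intro smooth_map_Pair cP cT cE smooth_map_snd cM smooth_map_compose[OF cP cM cT smooth_map_fst[OF cM cE] smooth_map_tangent_zero[OF cM]])
  from smooth_map_compose[OF cP charted_prod_manifold[OF cT cE] cE this \<mu>D(3)]
  have "smooth_map ?P (total E) (\<lambda>q. \<mu> (tangent_zero M (fst q), snd q))" .
  then have smooth: "smooth_map ?P (total E) ?a"
    by (rule smooth_map_cong[OF cP cE, rotated]) (auto simp: a lie_group_carrier[OF G])
  have "lie_action G (total E) ?a"
    unfolding lie_action_def
  proof (intro conjI ballI smooth)
    fix g h e assume *: "g \<in> carrier G" "h \<in> carrier G" "e \<in> tcarrier E"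
    then show "?a (g, ?a (h, e)) = ?a (g \<otimes>\<^bsub>G\<^esub> h, e)"
      using \<mu>D(9)[OF g0[OF *(2)] *(3)] \<mu>D(5)[OF g0[OF *(1)] g0[OF *(2)] *(3)]
      by (simp add: a tangent_mult_zero_zero[OF G])
  qed (simp add: a \<mu>D(4))
  moreover have "fibrewise_linear E E (\<lambda>e. ?a (g, e))" if g: "g \<in> carrier G" for g
    unfolding fibrewise_linear_def
  proof (intro conjI allI ballI impI)
    fix e e' assume e: "e \<in> tcarrier E" "e' \<in> tcarrier E" "proj E e = proj E e'"
    then show "?a (g, vadd E e e') = vadd E (?a (g, e)) (?a (g, e'))"
      using \<mu>D(7)[OF g0[OF g] g0[OF g] e(1,2) refl e(3)] vadd_in[OF E e] g
      by (simp add: a tangent_add_zero[OF tangent_zero_in])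
  next
    fix s e assume e: "e \<in> tcarrier E"
    then show "?a (g, vscale E s e) = vscale E s (?a (g, e))"
      using \<mu>D(8)[OF g0[OF g] e, of s] vscale_in[OF E e] g by (simp add: a tangent_scale_zero)
  qed
  moreover have "proj E (?a (g, e)) = t (g, proj E e)" if "g \<in> carrier G" "e \<in> tcarrier E" for g e
    using \<mu>D(6)[OF g0 that(2)] that by (simp add: a)
  ultimately show ?thesis
    using E by (simp add: equivariant_bundle_def linear_part_def)
qed

lemma equivariant_linear_translation_part: "equivariant_linear G X t (E, linear_part G E \<mu>) (translation_part G X E \<mu>)"
proof -
  let ?r = "translation_part G X E \<mu>"
  note cM = lie_group_charted[OF G] and cE = bundle_charted(2)[OF E]
  note cT = charted_tangent_manifold[OF cM]
  note TG = lie_algebra_in_tangent_group[OF G]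
  have r: "?r \<alpha> x = \<mu> (\<alpha>, vzero E x)" if "\<alpha> \<in> lie" "x \<in> mcarrier X" for \<alpha> x
    using that by (simp add: translation_part_def)
  have "smooth_map X (total E) (?r \<alpha>)" if \<alpha>: "\<alpha> \<in> lie" for \<alpha>
  proof -
    have "\<alpha> \<in> mcarrier (tangent_manifold M)"
      using TG[OF \<alpha>] by (simp add: tangent_group_carrier[OF G])
    then have "smooth_map X (prod_manifold (tangent_manifold M) (total E)) (\<lambda>x. (\<alpha>, vzero E x))"
      by (intro smooth_map_Pair X_charted cT cE smooth_map_const smooth_map_vzero[OF E])
    from smooth_map_compose[OF X_charted charted_prod_manifold[OF cT cE] cE this \<mu>D(3)]
    show ?thesis
      by (rule smooth_map_cong[OF X_charted cE, rotated]) (simp add: r \<alpha>)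
  qed
  moreover have "proj E (?r \<alpha> x) = x" if "\<alpha> \<in> lie" "x \<in> mcarrier X" for \<alpha> x
    using \<mu>D(6)[OF TG z(1)] that tangent_space_fst[OF that(1)] z(2) by (simp add: r action_one)
  moreover have "?r (tangent_add M \<alpha> \<beta>) x = vadd E (?r \<alpha> x) (?r \<beta> x)" if "\<alpha> \<in> lie" "\<beta> \<in> lie" "x \<in> mcarrier X" for \<alpha> \<beta> x
    using \<mu>D(7)[OF TG[OF that(1)] TG[OF that(2)] z(1)[OF that(3)] z(1)[OF that(3)]]
      tangent_space_fst[OF that(1)] tangent_space_fst[OF that(2)] vadd_vzero(1)[OF E z(1)[OF that(3)]] z(2)[OF that(3)] that
    by (simp add: r tangent_add_in)
  moreover have "?r (tangent_scale M s \<alpha>) x = vscale E s (?r \<alpha> x)" if "\<alpha> \<in> lie" "x \<in> mcarrier X" for s \<alpha> x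
    using \<mu>D(8)[OF TG[OF that(1)] z(1)[OF that(2)], of s] that
    by (simp add: r tangent_scale_in vscale_vzero[OF E])
  \<comment> \<open>The product of the zero vector at g with \<open>\<alpha>\<close> acts on the
    zero vector over x. Through its right trivialization the result is the left side; by the action
    law it is g applied to the section.\<close>
  moreover have "?r (Ad G g \<alpha>) (t (g, x)) = linear_part G E \<mu> (g, ?r \<alpha> x)"
    if g: "g \<in> carrier G" and \<alpha>: "\<alpha> \<in> lie" and x: "x \<in> mcarrier X" for g \<alpha> x
  proof -
    note g0 = tangent_zero_in_tangent_group[OF G g]
    let ?v = "tangent_mult G (tangent_zero M g) \<alpha>"
    have v: "?v \<in> TG" "fst ?v = g"
      using tangent_mult_in[OF G g0 TG[OF \<alpha>]] fst_tangent_mult[OF G g0 TG[OF \<alpha>]] tangent_space_fst[OF \<alpha>] g by simp_all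
    have "right_triv G ?v = Ad G g \<alpha>"
      using right_triv_mult[OF G g0 TG[OF \<alpha>]] right_triv_zero[OF G g] right_triv_lie_algebra[OF G \<alpha>]
        tangent_add_zero[OF Ad_in[OF G g \<alpha>]] by simp
    then have "\<mu> (Ad G g \<alpha>, vzero E (t (g, x))) = \<mu> (?v, vzero E x)"
      using affine_on_vzero[OF v(1) x] v(2) by simp
    also have "\<dots> = \<mu> (tangent_zero M g, \<mu> (\<alpha>, vzero E x))"
      using \<mu>D(5)[OF g0 TG[OF \<alpha>] z(1)[OF x]] ..
    finally show ?thesis
      using g \<alpha> x Ad_in[OF G g \<alpha>] action_in[OF g x] \<mu>D(9)[OF TG[OF \<alpha>] z(1)[OF x]] by (simp add: r linear_part_def)
  qed
  ultimately have "equivariant_family G X t E (linear_part G E \<mu>) ?r"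
    unfolding equivariant_family_def by blast
  then show ?thesis
    unfolding equivariant_linear_iff[OF E] by (simp add: translation_part_def)
qed

end

text \<open>
  A family of sections linear in \<open>\<alpha>\<close> is a combination of finitely many sections, so it depends
  smoothly on \<open>\<alpha>\<close> and the base point together.
\<close>

lemma equivariant_family_smooth:
  assumes E: "vector_bundle X E" and r: "equivariant_family G X t E a r" and N: "charted N"
    and p: "smooth_on N W X p" and \<alpha>: "\<And>y. y \<in> W \<Longrightarrow> \<alpha> y \<in> lie"
    and d: "(V, \<psi>) \<in> charts_at M \<one>\<^bsub>G\<^esub>" and coords: "\<And>i. i < mdim M \<Longrightarrow> smooth_fn N W (\<lambda>y. snd (\<alpha> y) (V, \<psi>) i)"
  shows "smooth_on N W (total E) (\<lambda>y. r (\<alpha> y) (p y))"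
proof (rule smooth_into_bundleI[OF E N p])
  note rD = equivariant_familyD[OF r]
  note cM = lie_group_charted[OF G] and cE = bundle_charted(2)[OF E]
  note p_in = smooth_on_carrier[OF X_charted p]
  have r_in: "r \<beta> x \<in> tcarrier E" if "\<beta> \<in> lie" "x \<in> mcarrier X" for \<beta> x
    using smooth_map_carrier[OF rD(1)] that by blast
  show "r (\<alpha> y) (p y) \<in> tcarrier E" "proj E (r (\<alpha> y) (p y)) = p y" if "y \<in> W" for y
    using r_in rD(2) \<alpha> p_in that by auto
  fix U k c h j W'
  assume c: "fibre_coords X E U k c h" and j: "j < k" and W': "openin (mtop N) W'" "W' \<subseteq> W"
    and U: "\<And>y. y \<in> W' \<Longrightarrow> p y \<in> U"
  \<comment> \<open>The basis of the Lie algebra belonging to the chart at the identity. In the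
    expansion below, \<open>\<alpha> y\<close> enters only through real coefficients and
    \<open>p y\<close> only through the fixed sections of the basis vectors.\<close>
  let ?b = "\<lambda>i. tangent_of M \<one>\<^bsub>G\<^esub> (V, \<psi>) (unit_vector i)"
  have b: "?b i \<in> lie" if "i < mdim M" for i
    using tangent_of_in[OF cM d unit_vector_in_Euclidean_space[OF that]] .
  have eq: "c (r (\<alpha> y) (p y)) j = (\<Sum>i<mdim M. snd (\<alpha> y) (V, \<psi>) i * c (r (?b i) (p y)) j)" if y: "y \<in> W'" for y
  proof (rule tangent_linear_expansion[OF cM d, where L = "\<lambda>\<beta>. c (r \<beta> (p y)) j"])
    have py: "p y \<in> mcarrier X" "p y \<in> U"
      using y W'(2) p_in U by auto
    show "\<alpha> y \<in> lie"
      using y W'(2) \<alpha> by auto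
    show "c (r (tangent_add M \<beta> \<gamma>) (p y)) j = c (r \<beta> (p y)) j + c (r \<gamma> (p y)) j" if "\<beta> \<in> lie" "\<gamma> \<in> lie" for \<beta> \<gamma>
      using fibre_coordsD(6)[OF E c r_in r_in] rD(2,3) that py by simp
    show "c (r (tangent_scale M s \<beta>) (p y)) j = s * c (r \<beta> (p y)) j" if "\<beta> \<in> lie" for s \<beta>
      using fibre_coordsD(8)[OF E c r_in] rD(2,4) that py by simp
  qed
  have "smooth_fn N W' (\<lambda>y. c (r (?b i) (p y)) j)" if i: "i < mdim M" for i
  proof (rule smooth_fn_fibre_coords[OF E N c _ _ j])
    have "smooth_on X (mcarrier X) (total E) (r (?b i))"
      using rD(1)[OF b[OF i]] unfolding smooth_map_iff[OF X_charted cE] .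
    then show "smooth_on N W' (total E) (\<lambda>y. r (?b i) (p y))"
      by (rule smooth_on_compose[OF N X_charted smooth_on_subset[OF p W']]) (use p_in W'(2) in auto)
    show "proj E (r (?b i) (p y)) \<in> U" if "y \<in> W'" for y
      using rD(2)[OF b[OF i] p_in] W'(2) U that by auto
  qed
  then have "smooth_fn N W' (\<lambda>y. \<Sum>i<mdim M. snd (\<alpha> y) (V, \<psi>) i * c (r (?b i) (p y)) j)"
    using smooth_fn_subset[OF coords W'(2)] by (intro smooth_fn_sum smooth_fn_mult N W'(1)) auto
  then show "smooth_fn N W' (\<lambda>y. c (r (\<alpha> y) (p y)) j)"
    by (rule smooth_fn_cong[OF N W'(1), rotated]) (simp add: eq)
qed

lemma unit_chart:
  obtains V \<psi> where "(V, \<psi>) \<in> charts_at M \<one>\<^bsub>G\<^esub>"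
  using charts_at_nonempty[OF lie_group_charted[OF G] one_in[OF G]] .

section \<open>From an equivariant family to an affine action\<close>

context
  fixes E :: "('e, 'x) vbundle" and a r
  assumes a: "equivariant_bundle G X t (E, a)" and r: "equivariant_family G X t E a r"
begin

private lemmas aD = equivariant_bundleD[OF a]
private lemmas rD = equivariant_familyD[OF r]

lemma equivariant_family_in: "\<alpha> \<in> lie \<Longrightarrow> x \<in> mcarrier X \<Longrightarrow> r \<alpha> x \<in> tcarrier E"
  using smooth_map_carrier[OF rD(1)] by blast

lemma equivariant_family_zero:
  assumes x: "x \<in> mcarrier X"
  shows "r (tangent_zero M \<one>\<^bsub>G\<^esub>) x = vzero E x"
proof -
  have "r (tangent_zero M \<one>\<^bsub>G\<^esub>) x = vscale E 0 (r (tangent_zero M \<one>\<^bsub>G\<^esub>) x)"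
    using rD(4)[OF tangent_zero_in x, of 0] by (simp add: tangent_scale_zero)
  then show ?thesis
    using vscale_0[OF aD(1) equivariant_family_in[OF tangent_zero_in x]] rD(2)[OF tangent_zero_in x] by simp
qed

lemma affine_of_apply: "v \<in> TG \<Longrightarrow> e \<in> tcarrier E \<Longrightarrow>
    affine_of G t E a r (v, e) = vadd E (a (fst v, e)) (r (right_triv G v) (t (fst v, proj E e)))"
  by (simp add: affine_of_def)

text \<open>Both summands of \<open>affine_of\<close> lie over the same point g x, so that their sum
  is defined in one fibre.\<close>

private lemma summands:
  assumes v: "v \<in> TG" and e: "e \<in> tcarrier E"
  shows "fst v \<in> carrier G" "a (fst v, e) \<in> tcarrier E" "r (right_triv G v) (t (fst v, proj E e)) \<in> tcarrier E"
    "proj E (a (fst v, e)) = t (fst v, proj E e)" "proj E (r (right_triv G v) (t (fst v, proj E e))) = t (fst v, proj E e)"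
    "t (fst v, proj E e) \<in> mcarrier X" "right_triv G v \<in> lie"
proof -
  show g: "fst v \<in> carrier G"
    using v by (simp add: mem_tangent_group[OF G])
  show x: "t (fst v, proj E e) \<in> mcarrier X"
    by (rule action_in[OF g bundle_proj_carrier[OF aD(1) e]])
  show rt: "right_triv G v \<in> lie"
    by (rule right_triv_in[OF G v])
  show "a (fst v, e) \<in> tcarrier E" "proj E (a (fst v, e)) = t (fst v, proj E e)"
    using aD(6,9) g e by auto
  show "r (right_triv G v) (t (fst v, proj E e)) \<in> tcarrier E" "proj E (r (right_triv G v) (t (fst v, proj E e))) = t (fst v, proj E e)"
    using equivariant_family_in[OF rt x] rD(2)[OF rt x] by auto
qed

private lemma affine_of_in:
  assumes "v \<in> TG" "e \<in> tcarrier E"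
  shows "affine_of G t E a r (v, e) \<in> tcarrier E" "proj E (affine_of G t E a r (v, e)) = t (fst v, proj E e)"
  using vadd_in[OF aD(1) summands(2,3)[OF assms]] summands(4,5)[OF assms] by (simp_all add: affine_of_apply[OF assms])

text \<open>The first summand is the given action after projections. The second is a linear family
  evaluated at a smoothly varying Lie algebra element and a smoothly varying base point, so it falls
  under \<open>equivariant_family_smooth\<close>.\<close>

lemma affine_of_smooth: "smooth_map (prod_manifold (tangent_manifold M) (total E)) (total E) (affine_of G t E a r)"
proof -
  note cM = lie_group_charted[OF G] and cE = bundle_charted(2)[OF aD(1)]
  note cT = charted_tangent_manifold[OF cM]
  let ?T = "tangent_manifold M"
  let ?P = "prod_manifold ?T (total E)"
  note cP = charted_prod_manifold[OF cT cE]
  have TG: "mcarrier ?T = TG"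
    by (simp add: tangent_group_carrier[OF G])
  have car: "mcarrier ?P = TG \<times> tcarrier E"
    by (simp add: TG)
  obtain V \<psi> where d: "(V, \<psi>) \<in> charts_at M \<one>\<^bsub>G\<^esub>"
    using unit_chart .
  note pr1 = smooth_map_fst[OF cT cE] and pr2 = smooth_map_snd[OF cT cE]
  have g: "smooth_map ?P M (\<lambda>q. fst (fst q))"
    by (rule smooth_map_compose[OF cP cT cM pr1 smooth_map_tangent_fst[OF cM]])
  have a_smooth: "smooth_map ?P (total E) (\<lambda>q. a (fst (fst q), snd q))"
    by (rule smooth_map_compose[OF cP charted_prod_manifold[OF cM cE] cE smooth_map_Pair[OF cP cM cE g pr2] aD(3)])
  have "smooth_map ?P X (\<lambda>q. proj E (snd q))"
    by (rule smooth_map_compose[OF cP cE X_charted pr2 bundle_proj_smooth[OF aD(1)]])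
  then have p: "smooth_map ?P X (\<lambda>q. t (fst (fst q), proj E (snd q)))"
    by (intro smooth_map_compose[OF cP charted_prod_manifold[OF cM X_charted] X_charted _ action_smooth]
        smooth_map_Pair[OF cP cM X_charted g])
  have "smooth_on ?P (mcarrier ?P) (total E) (\<lambda>q. r (right_triv G (fst q)) (t (fst (fst q), proj E (snd q))))"
  proof (rule equivariant_family_smooth[OF aD(1) r cP _ _ d])
    show "smooth_on ?P (mcarrier ?P) X (\<lambda>q. t (fst (fst q), proj E (snd q)))"
      using p unfolding smooth_map_iff[OF cP X_charted] .
    show "right_triv G (fst q) \<in> lie" if "q \<in> mcarrier ?P" for q
      using that unfolding car by (auto intro: right_triv_in[OF G])
    have "smooth_on ?P (mcarrier ?P) ?T fst"
      using pr1 unfolding smooth_map_iff[OF cP cT] .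
    then show "smooth_fn ?P (mcarrier ?P) (\<lambda>q. snd (right_triv G (fst q)) (V, \<psi>) i)" for i
      by (rule smooth_fn_pullback[OF cP cT _ openin_topspace smooth_fn_right_triv[OF G d]]) auto
  qed
  moreover have "smooth_on ?P (mcarrier ?P) (total E) (\<lambda>q. a (fst (fst q), snd q))"
    using a_smooth unfolding smooth_map_iff[OF cP cE] .
  ultimately have "smooth_on ?P (mcarrier ?P) (total E)
      (\<lambda>q. vadd E (a (fst (fst q), snd q)) (r (right_triv G (fst q)) (t (fst (fst q), proj E (snd q)))))"
    by (intro smooth_on_vadd[OF aD(1) cP]) (use summands(4,5) in \<open>auto simp: TG\<close>)
  then have "smooth_on ?P (mcarrier ?P) (total E) (affine_of G t E a r)"
    by (rule smooth_on_cong[OF cP]) (auto simp: TG affine_of_apply)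
  then show ?thesis
    unfolding smooth_map_iff[OF cP cE] .
qed

lemma affine_action_affine_of: "affine_action G X t (E, affine_of G t E a r)"
  unfolding affine_action_iff
proof (intro conjI allI ballI impI aD(1) affine_of_smooth)
  let ?\<mu> = "affine_of G t E a r"
  show "?\<mu> \<in> extensional (TG \<times> tcarrier E)"
    by (simp add: affine_of_def)
  fix e assume e: "e \<in> tcarrier E"
  note x = bundle_proj_carrier[OF aD(1) e]
  show "?\<mu> (tangent_zero M \<one>\<^bsub>G\<^esub>, e) = e"
    using affine_of_apply[OF tangent_zero_in_tangent_group[OF G one_closed] e] right_triv_zero[OF G one_closed]
    by (simp add: action_one[OF x] aD(4)[OF e] equivariant_family_zero[OF x] vadd_vzero(1)[OF aD(1) e])
  fix v assume v: "v \<in> TG"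
  note sv = summands[OF v e]
  show "proj E (?\<mu> (v, e)) = t (fst v, proj E e)"
    by (rule affine_of_in(2)[OF v e])
  {
    fix w assume w: "w \<in> TG"
    note sw = summands[OF w e]
    let ?x = "t (fst w, proj E e)" and ?y = "t (fst v, t (fst w, proj E e))"
    let ?g = "fst v"
    have y: "?y \<in> mcarrier X"
      by (rule action_in[OF sv(1) sw(6)])
    have "?\<mu> (v, ?\<mu> (w, e)) = vadd E (a (?g, ?\<mu> (w, e))) (r (right_triv G v) ?y)"
      using affine_of_apply[OF v affine_of_in(1)[OF w e]] affine_of_in(2)[OF w e] by simp
    also have "a (?g, ?\<mu> (w, e)) = vadd E (a (?g, a (fst w, e))) (a (?g, r (right_triv G w) ?x))"
      using aD(7)[OF sv(1) sw(2,3)] sw(4,5) by (simp add: affine_of_apply[OF w e])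
    \<comment> \<open>Equivariance moves the section past g at the cost of \<open>Ad\<close>, which
      is the twist that \<open>right_triv_mult\<close> expects.\<close>
    also have "a (?g, r (right_triv G w) ?x) = r (Ad G ?g (right_triv G w)) ?y"
      using rD(5)[OF sv(1) sw(7,6)] by simp
    also have "vadd E (vadd E (a (?g, a (fst w, e))) (r (Ad G ?g (right_triv G w)) ?y)) (r (right_triv G v) ?y) =
        vadd E (a (?g, a (fst w, e))) (vadd E (r (Ad G ?g (right_triv G w)) ?y) (r (right_triv G v) ?y))"
      using aD(6,9)[OF sv(1) sw(2)] sw(4) rD(2)[OF _ y] equivariant_family_in[OF _ y] Ad_in[OF G sv(1) sw(7)] sv(7)
      by (intro vadd_assoc[OF aD(1)]) simp_all
    also have "vadd E (r (Ad G ?g (right_triv G w)) ?y) (r (right_triv G v) ?y) = r (right_triv G (tangent_mult G v w)) ?y"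
      using rD(3)[OF Ad_in[OF G sv(1) sw(7)] sv(7) y] by (simp add: right_triv_mult[OF G v w])
    also have "a (?g, a (fst w, e)) = a (fst (tangent_mult G v w), e)"
      using aD(5)[OF sv(1) sw(1) e] by (simp add: fst_tangent_mult[OF G v w])
    also have "?y = t (fst (tangent_mult G v w), proj E e)"
      using action_mult[OF sv(1) sw(1) x] by (simp add: fst_tangent_mult[OF G v w])
    finally show "?\<mu> (v, ?\<mu> (w, e)) = ?\<mu> (tangent_mult G v w, e)"
      by (simp add: affine_of_apply[OF tangent_mult_in[OF G v w] e])
  }
  {
    fix w e' assume w: "w \<in> TG" and e': "e' \<in> tcarrier E" and eq: "fst v = fst w" "proj E e = proj E e'"
    note sw = summands[OF w e']
    have "tangent_add M v w \<in> TG"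
      using v w eq(1) tangent_add_in[of v M "fst v" w] by (simp add: mem_tangent_group[OF G])
    then have "?\<mu> (tangent_add M v w, vadd E e e') =
        vadd E (vadd E (a (fst v, e)) (a (fst w, e')))
          (vadd E (r (right_triv G v) (t (fst v, proj E e))) (r (right_triv G w) (t (fst w, proj E e'))))"
      using affine_of_apply[of "tangent_add M v w" "vadd E e e'"] vadd_in[OF aD(1) e e' eq(2)] aD(7)[OF sv(1) e e' eq(2)]
        right_triv_add[OF G v w eq(1)] rD(3)[OF sv(7) sw(7) sv(6)] eq by simp
    \<comment> \<open>Additivity of each summand gives the four vectors grouped by summand; they are
      regrouped by argument.\<close>
    also have "\<dots> = vadd E (?\<mu> (v, e)) (?\<mu> (w, e'))"
      unfolding affine_of_apply[OF v e] affine_of_apply[OF w e']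
      using sv sw eq by (intro vadd_interchange[OF aD(1)]) simp_all
    finally show "?\<mu> (tangent_add M v w, vadd E e e') = vadd E (?\<mu> (v, e)) (?\<mu> (w, e'))" .
  }
  fix s
  have "tangent_scale M s v \<in> TG"
    using v tangent_scale_in[of v M "fst v" s] by (simp add: mem_tangent_group[OF G])
  then show "?\<mu> (tangent_scale M s v, vscale E s e) = vscale E s (?\<mu> (v, e))"
    using affine_of_apply[of "tangent_scale M s v" "vscale E s e"] vscale_in[OF aD(1) e] aD(8)[OF sv(1) e]
      right_triv_scale[OF G v] rD(4)[OF sv(7,6)] vscale_vadd[OF aD(1) sv(2,3)] sv(4,5)
    by (simp add: affine_of_apply[OF v e])
qed

text \<open>At a zero tangent vector the right trivialization is zero, so the family contributes
  only the zero vector of the fibre.\<close>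

lemma linear_part_affine_of: "linear_part G E (affine_of G t E a r) = a"
proof (rule extensionalityI[of _ "carrier G \<times> tcarrier E"])
  fix q assume "q \<in> carrier G \<times> tcarrier E"
  then obtain g e where q: "q = (g, e)" "g \<in> carrier G" "e \<in> tcarrier E"
    by auto
  note x = action_in[OF q(2) bundle_proj_carrier[OF aD(1) q(3)]]
  show "linear_part G E (affine_of G t E a r) q = a q"
    using q affine_of_apply[OF tangent_zero_in_tangent_group[OF G q(2)] q(3)] right_triv_zero[OF G q(2)]
      equivariant_family_zero[OF x] vadd_vzero(1)[OF aD(1) aD(9)[OF q(2,3)]] aD(6)[OF q(2,3)]
    by (simp add: linear_part_def)
qed (simp_all add: linear_part_def aD(2))

text \<open>A Lie algebra element has the identity as foot and is its own right trivialization. Its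
  action on a zero vector therefore leaves just the value of the section.\<close>

lemma translation_part_affine_of:
  assumes "r \<in> extensional lie" "\<And>\<alpha>. \<alpha> \<in> lie \<Longrightarrow> r \<alpha> \<in> extensional (mcarrier X)"
  shows "translation_part G X E (affine_of G t E a r) = r"
proof (rule extensionalityI[of _ lie])
  fix \<alpha> assume \<alpha>: "\<alpha> \<in> lie"
  show "translation_part G X E (affine_of G t E a r) \<alpha> = r \<alpha>"
  proof (rule extensionalityI[of _ "mcarrier X"])
    fix x assume x: "x \<in> mcarrier X"
    note z = vzero_in[OF aD(1) x]
    show "translation_part G X E (affine_of G t E a r) \<alpha> x = r \<alpha> x"
      using affine_of_apply[OF lie_algebra_in_tangent_group[OF G \<alpha>] z(1)] tangent_space_fst[OF \<alpha>] aD(4)[OF z(1)] z(2)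
        action_one[OF x] right_triv_lie_algebra[OF G \<alpha>] vadd_vzero(2)[OF aD(1) equivariant_family_in[OF \<alpha> x]] rD(2)[OF \<alpha> x] \<alpha> x
      by (simp add: translation_part_def)
  qed (use assms(2)[OF \<alpha>] \<alpha> in \<open>simp_all add: translation_part_def\<close>)
qed (simp_all add: assms(1) translation_part_def)

end

section \<open>Morphisms, and the comparison of affine actions with pairs\<close>

lemma affine_hom_iff:
  assumes \<mu>: "affine_action G X t (E, \<mu>)" and \<mu>': "affine_action G X t (E', \<mu>')" and \<psi>: "\<psi> \<in> bundle_hom E E'"
  shows "(\<forall>v\<in>TG. \<forall>e\<in>tcarrier E. \<psi> (\<mu> (v, e)) = \<mu>' (v, \<psi> e)) \<longleftrightarrow>
    (\<forall>g\<in>carrier G. \<forall>e\<in>tcarrier E. \<psi> (linear_part G E \<mu> (g, e)) = linear_part G E' \<mu>' (g, \<psi> e)) \<and>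
    (\<forall>\<alpha>\<in>lie. \<forall>x\<in>mcarrier X. \<psi> (translation_part G X E \<mu> \<alpha> x) = translation_part G X E' \<mu>' \<alpha> x)" (is "?L \<longleftrightarrow> ?R")
proof
  note E = affine_actionD(1)[OF \<mu>] and E' = affine_actionD(1)[OF \<mu>']
  assume L: ?L
  \<comment> \<open>Specialize v to zero vectors for the linear parts, and e to zero vectors for the
    translation parts; \<open>\<psi>\<close> preserves the latter.\<close>
  then show ?R
    using bundle_homD(6)[OF \<psi>] bundle_hom_vzero[OF E E' \<psi>] vzero_in[OF E] tangent_zero_in_tangent_group[OF G]
      lie_algebra_in_tangent_group[OF G]
    by (auto simp: linear_part_def translation_part_def)
next
  note E = affine_actionD(1)[OF \<mu>]
  note a = equivariant_bundle_linear_part[OF \<mu>] and a' = equivariant_bundle_linear_part[OF \<mu>']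
  have r: "equivariant_family G X t E (linear_part G E \<mu>) (translation_part G X E \<mu>)"
    using equivariant_linear_translation_part[OF \<mu>] unfolding equivariant_linear_iff[OF E] by blast
  assume R: ?R
  show ?L
  proof (intro ballI)
    fix v e assume v: "v \<in> TG" and e: "e \<in> tcarrier E"
    have g: "fst v \<in> carrier G"
      using v by (simp add: mem_tangent_group[OF G])
    note x = action_in[OF g bundle_proj_carrier[OF E e]] and rt = right_triv_in[OF G v]
    let ?a = "linear_part G E \<mu> (fst v, e)" and ?r = "translation_part G X E \<mu> (right_triv G v) (t (fst v, proj E e))"
    have "\<psi> (\<mu> (v, e)) = \<psi> (vadd E ?a ?r)"
      using v e by (subst affine_of_parts[OF \<mu>, symmetric]) (simp add: affine_of_def)
    \<comment> \<open>Each action is the sum of its two parts over one point, and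
      \<open>\<psi>\<close> is additive there, so compatibility with the parts is enough.\<close>
    also have "\<dots> = vadd E' (\<psi> ?a) (\<psi> ?r)"
      using equivariant_bundleD(6,9)[OF a g e] equivariant_family_in[OF a r rt x] equivariant_familyD(2)[OF r rt x]
      by (intro bundle_homD(4)[OF \<psi>]) simp_all
    also have "\<dots> = \<mu>' (v, \<psi> e)"
      using v e g R rt x bundle_homD(3,6)[OF \<psi> e]
      by (subst affine_of_parts[OF \<mu>', symmetric]) (simp add: affine_of_def)
    finally show "\<psi> (\<mu> (v, e)) = \<mu>' (v, \<psi> e)" .
  qed
qed

text \<open>Splitting and recombining are inverse as functions on objects, and a bundle morphism
  respects \<open>\<mu>\<close> exactly when it respects both parts; hence the Hom sets
  coincide.\<close>

lemma Vect_aff_pairs: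
  "same_morphisms (Vect_aff G X t :: (('g tangent, 'e, 'x) equivariant_bundle, 'e \<Rightarrow> 'e) category) (Vect_pairs G X t)
    (\<lambda>(E, \<mu>). ((E, linear_part G E \<mu>), translation_part G X E \<mu>)) (\<lambda>((E, a), r). (E, affine_of G t E a r))"
proof -
  let ?C = "Vect_aff G X t :: (('g tangent, 'e, 'x) equivariant_bundle, 'e \<Rightarrow> 'e) category" and ?D = "Vect_pairs G X t"
  have objC: "(E, \<mu>) \<in> Obj ?C \<longleftrightarrow> affine_action G X t (E, \<mu>)" for E \<mu>
    by (simp add: Vect_aff_def)
  have objD: "((E, a), \<rho>) \<in> Obj ?D \<longleftrightarrow> equivariant_bundle G X t (E, a) \<and> equivariant_linear G X t (E, a) \<rho>" for E a \<rho>
    by (simp add: Vect_pairs_def Vect_def)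
  have "affine_action G X t (E, affine_of G t E a \<rho>) \<and>
      linear_part G E (affine_of G t E a \<rho>) = a \<and> translation_part G X E (affine_of G t E a \<rho>) = \<rho>"
    if a: "equivariant_bundle G X t (E, a)" and "equivariant_linear G X t (E, a) \<rho>"
    for E :: "('e, 'x) vbundle" and a \<rho>
  proof -
    have "equivariant_family G X t E a \<rho>" "\<rho> \<in> extensional lie" "\<And>\<alpha>. \<alpha> \<in> lie \<Longrightarrow> \<rho> \<alpha> \<in> extensional (mcarrier X)"
      using that(2) unfolding equivariant_linear_iff[OF equivariant_bundleD(1)[OF a]] by auto
    then show ?thesis
      using affine_action_affine_of[OF a] linear_part_affine_of[OF a] translation_part_affine_of[OF a] by blast
  qed
  moreover have "Hom ?C (E, \<mu>) (E', \<mu>') =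
      Hom ?D ((E, linear_part G E \<mu>), translation_part G X E \<mu>) ((E', linear_part G E' \<mu>'), translation_part G X E' \<mu>')"
    if "affine_action G X t (E, \<mu>)" "affine_action G X t (E', \<mu>')" for E \<mu> E' \<mu>'
  proof -
    have *: "compose lie (section_map X \<psi>) (translation_part G X E \<mu>) = translation_part G X E' \<mu>' \<longleftrightarrow>
        (\<forall>\<alpha>\<in>lie. \<forall>x\<in>mcarrier X. \<psi> (translation_part G X E \<mu> \<alpha> x) = translation_part G X E' \<mu>' \<alpha> x)" for \<psi>
      by (rule section_map_compose_eq_iff) (simp_all add: translation_part_def)
    show ?thesis
    proof (rule Set.set_eqI)
      fix \<psi>
      show "\<psi> \<in> Hom ?C (E, \<mu>) (E', \<mu>') \<longleftrightarrow> \<psi> \<in> Hom ?D ((E, linear_part G E \<mu>), translation_part G X E \<mu>)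
          ((E', linear_part G E' \<mu>'), translation_part G X E' \<mu>')"
        using affine_hom_iff[OF that, of \<psi>]
        by (cases "\<psi> \<in> bundle_hom E E'") (simp_all add: Vect_aff_def Vect_pairs_def Vect_def *)
    qed
  qed
  moreover have "Ident ?C (E, \<mu>) = Ident ?D ((E, a), \<rho>)" "Comp ?C (E, \<mu>) B1 B2 = Comp ?D ((E, a), \<rho>) B3 B4"
    for E \<mu> a \<rho> B1 B2 B3 B4
    by (simp_all add: Vect_aff_def Vect_pairs_def Vect_def case_prod_unfold)
  ultimately show ?thesis
    unfolding same_morphisms_def
    by (simp add: Ball_def split_paired_All objC objD affine_of_parts equivariant_bundle_linear_part
        equivariant_linear_translation_part)
qed

text \<open>The laws are verified directly here only; the categories of pairs and of the slice
  receive theirs through \<open>same_morphisms_is_category\<close>.\<close>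

lemma is_category_Vect_aff: "is_category (Vect_aff G X t :: (('g tangent, 'e, 'x) equivariant_bundle, 'e \<Rightarrow> 'e) category)"
proof -
  let ?C = "Vect_aff G X t :: (('g tangent, 'e, 'x) equivariant_bundle, 'e \<Rightarrow> 'e) category"
  let ?TG = "carrier (tangent_group G)"
  have obj: "(E, \<mu>) \<in> Obj ?C \<longleftrightarrow> affine_action G X t (E, \<mu>)" for E \<mu>
    by (simp add: Vect_aff_def)
  have hom: "\<psi> \<in> Hom ?C (E, \<mu>) (E', \<mu>') \<longleftrightarrow>
      \<psi> \<in> bundle_hom E E' \<and> (\<forall>v\<in>?TG. \<forall>e\<in>tcarrier E. \<psi> (\<mu> (v, e)) = \<mu>' (v, \<psi> e))" for \<psi> E \<mu> E' \<mu>'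
    by (simp add: Vect_aff_def)
  have ident: "Ident ?C (E, \<mu>) = (\<lambda>e\<in>tcarrier E. e)" and comp: "Comp ?C (E, \<mu>) b c \<theta> \<psi> = compose (tcarrier E) \<theta> \<psi>"
    for E \<mu> b c \<theta> \<psi>
    by (simp_all add: Vect_aff_def)
  note aff = affine_actionD
  show ?thesis
    unfolding is_category_def
  proof (intro conjI ballI)
    fix A assume "A \<in> Obj ?C"
    then obtain E \<mu> where A: "A = (E, \<mu>)" "affine_action G X t (E, \<mu>)"
      by (cases A) (simp add: obj)
    show "Ident ?C A \<in> Hom ?C A A"
      using bundle_hom_id[OF aff(1)[OF A(2)]] aff(9)[OF A(2)] by (simp add: A hom ident)
  next
    fix A B C \<psi> \<theta> assume *: "A \<in> Obj ?C" "B \<in> Obj ?C" "C \<in> Obj ?C" "\<psi> \<in> Hom ?C A B" "\<theta> \<in> Hom ?C B C"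
    obtain E \<mu> where A: "A = (E, \<mu>)" "affine_action G X t (E, \<mu>)"
      using *(1) by (cases A) (simp add: obj)
    obtain E' \<mu>' where B: "B = (E', \<mu>')" "affine_action G X t (E', \<mu>')"
      using *(2) by (cases B) (simp add: obj)
    obtain E'' \<mu>'' where C: "C = (E'', \<mu>'')" "affine_action G X t (E'', \<mu>'')"
      using *(3) by (cases C) (simp add: obj)
    have \<psi>: "\<psi> \<in> bundle_hom E E'" "\<And>v e. v \<in> ?TG \<Longrightarrow> e \<in> tcarrier E \<Longrightarrow> \<psi> (\<mu> (v, e)) = \<mu>' (v, \<psi> e)"
      using *(4) by (auto simp: A B hom)
    have \<theta>: "\<theta> \<in> bundle_hom E' E''" "\<And>v e. v \<in> ?TG \<Longrightarrow> e \<in> tcarrier E' \<Longrightarrow> \<theta> (\<mu>' (v, e)) = \<mu>'' (v, \<theta> e)"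
      using *(5) by (auto simp: B C hom)
    have "compose (tcarrier E) \<theta> \<psi> \<in> bundle_hom E E''"
      by (rule bundle_hom_compose[OF aff(1)[OF A(2)] aff(1)[OF B(2)] aff(1)[OF C(2)] \<psi>(1) \<theta>(1)])
    then show "Comp ?C A B C \<theta> \<psi> \<in> Hom ?C A C"
      using aff(9)[OF A(2)] bundle_homD(6)[OF \<psi>(1)] by (simp add: A C hom comp compose_def \<psi>(2) \<theta>(2))
  next
    fix A B \<psi> assume *: "A \<in> Obj ?C" "B \<in> Obj ?C" "\<psi> \<in> Hom ?C A B"
    obtain E \<mu> E' \<mu>' where A: "A = (E, \<mu>)" and B: "B = (E', \<mu>')"
      by (cases A, cases B)
    have \<psi>: "\<psi> \<in> bundle_hom E E'"
      using *(3) by (simp add: A B hom)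
    \<comment> \<open>Morphisms are \<open>extensional\<close> on the total space of their source,
      so composing with a restricted identity gives back the same function everywhere.\<close>
    show "Comp ?C A A B \<psi> (Ident ?C A) = \<psi>" "Comp ?C A B B (Ident ?C B) \<psi> = \<psi>"
      unfolding A B ident comp using bundle_homD(1,6)[OF \<psi>]
      by (auto simp: compose_def extensional_def fun_eq_iff)
  next
    fix A B C D \<psi> \<theta> \<kappa> assume *: "A \<in> Obj ?C" "B \<in> Obj ?C" "C \<in> Obj ?C" "D \<in> Obj ?C"
      "\<psi> \<in> Hom ?C A B" "\<theta> \<in> Hom ?C B C" "\<kappa> \<in> Hom ?C C D"
    obtain E \<mu> E' \<mu>' where A: "A = (E, \<mu>)" and B: "B = (E', \<mu>')"
      by (cases A, cases B)
    have "\<psi> \<in> bundle_hom E E'"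
      using *(5) by (simp add: A B hom)
    from bundle_homD(6)[OF this] show "Comp ?C A C D \<kappa> (Comp ?C A B C \<theta> \<psi>) = Comp ?C A B D (Comp ?C B C D \<kappa> \<theta>) \<psi>"
      unfolding A B comp by (auto simp: compose_def fun_eq_iff)
  qed
qed

section \<open>The slice category under the trivial adjoint bundle\<close>

context
  fixes \<iota> :: "'x \<times> 'g tangent \<Rightarrow> 'e"
  assumes inj: "inj_on \<iota> (mcarrier X \<times> lie)"
begin

private abbreviation (input) "N \<equiv> prod_manifold X (tangent_space_manifold M \<one>\<^bsub>G\<^esub>)"
private abbreviation (input) "D \<equiv> mcarrier X \<times> lie"
private abbreviation (input) "adj \<equiv> image_equivariant_bundle \<iota> G (adjoint_bundle G X t)"

lemma adjoint_carrier: "mcarrier N = D"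
  using mcarrier_tangent_space_manifold[OF lie_group_charted[OF G] one_in[OF G]] by simp

lemma adjoint_charted: "charted N"
  by (intro charted_prod_manifold smooth_manifold_charted[OF X] charted_tangent_space_manifold[OF lie_group_charted[OF G] one_in[OF G]])

lemma inj_adjoint: "inj_on \<iota> (mcarrier N)"
  using inj unfolding adjoint_carrier .

lemma adj_total: "total (fst adj) = image_manifold \<iota> N"
  by (simp add: image_equivariant_bundle_def adjoint_bundle_def image_bundle_def make_bundle_def Let_def)

lemma adj_carrier: "tcarrier (fst adj) = \<iota> ` D"
  unfolding adj_total using mcarrier_image_manifold[OF adjoint_charted inj_adjoint] unfolding adjoint_carrier .

lemma adj_inverse: "p \<in> D \<Longrightarrow> inv_into D \<iota> (\<iota> p) = p"
  using inj by simp

lemma adj_proj: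
  assumes "p \<in> D"
  shows "proj (fst adj) (\<iota> p) = fst p"
proof -
  have "\<iota> p \<in> mcarrier (image_manifold \<iota> N)"
    using assms mcarrier_image_manifold[OF adjoint_charted inj_adjoint] unfolding adjoint_carrier by blast
  then show ?thesis
    using assms adj_inverse[OF assms]
    unfolding image_equivariant_bundle_def adjoint_bundle_def image_bundle_def make_bundle_def Let_def
    by (simp add: adjoint_carrier del: prod_manifold_simps)
qed

lemma adj_vadd:
  assumes "x \<in> mcarrier X" "\<alpha> \<in> lie" "\<beta> \<in> lie"
  shows "vadd (fst adj) (\<iota> (x, \<alpha>)) (\<iota> (x, \<beta>)) = \<iota> (x, tangent_add M \<alpha> \<beta>)"
proof -
  \<comment> \<open>\<open>make_bundle\<close> leaves the addition \<open>undefined\<close> off the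
    carrier, so both arguments are first placed in it.\<close>
  have "\<iota> (x, \<alpha>) \<in> mcarrier (image_manifold \<iota> N)" "\<iota> (x, \<beta>) \<in> mcarrier (image_manifold \<iota> N)"
    using assms mcarrier_image_manifold[OF adjoint_charted inj_adjoint] unfolding adjoint_carrier by blast+
  then show ?thesis
    using assms adj_inverse
    unfolding image_equivariant_bundle_def adjoint_bundle_def image_bundle_def make_bundle_def Let_def
    by (simp add: adjoint_carrier del: prod_manifold_simps)
qed

lemma adj_vscale:
  assumes "x \<in> mcarrier X" "\<alpha> \<in> lie"
  shows "vscale (fst adj) s (\<iota> (x, \<alpha>)) = \<iota> (x, tangent_scale M s \<alpha>)"
proof -
  have "\<iota> (x, \<alpha>) \<in> mcarrier (image_manifold \<iota> N)"
    using assms mcarrier_image_manifold[OF adjoint_charted inj_adjoint] unfolding adjoint_carrier by blast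
  then show ?thesis
    using assms adj_inverse
    unfolding image_equivariant_bundle_def adjoint_bundle_def image_bundle_def make_bundle_def Let_def
    by (simp add: adjoint_carrier del: prod_manifold_simps)
qed

lemma adj_action:
  assumes "g \<in> carrier G" "x \<in> mcarrier X" "\<alpha> \<in> lie"
  shows "snd adj (g, \<iota> (x, \<alpha>)) = \<iota> (t (g, x), Ad G g \<alpha>)"
  using assms adj_inverse
  unfolding image_equivariant_bundle_def adjoint_bundle_def make_bundle_def Let_def
  by (simp add: adjoint_carrier del: prod_manifold_simps)

text \<open>A morphism out of the trivial bundle is a family of sections in curried form:
  restricting to constant \<open>\<alpha>\<close> gives the sections, and linearity and equivariance
  match term by term. The substance is in the converse, where smoothness of each section must yield
  joint smoothness in x and \<open>\<alpha>\<close>.\<close>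

lemma hom_from_adjoint_iff:
  assumes a: "equivariant_bundle G X t (E, a)"
  shows "f \<in> Hom (Vect G X t) adj (E, a) \<longleftrightarrow>
    f \<in> extensional (\<iota> ` D) \<and> equivariant_family G X t E a (\<lambda>\<alpha> x. f (\<iota> (x, \<alpha>)))" (is "?L \<longleftrightarrow> ?R")
proof -
  note aD = equivariant_bundleD[OF a]
  note cX = smooth_manifold_charted[OF X] and cM = lie_group_charted[OF G] and cE = bundle_charted(2)[OF aD(1)]
  note one = one_in[OF G]
  note cT = charted_tangent_space_manifold[OF cM one]
  note cI = charted_image_manifold[OF adjoint_charted inj_adjoint]
  have hom: "f \<in> Hom (Vect G X t) adj (E, a) \<longleftrightarrow> f \<in> bundle_hom (fst adj) E \<and>
      (\<forall>g\<in>carrier G. \<forall>y\<in>tcarrier (fst adj). f (snd adj (g, y)) = a (g, f y))"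
    by (simp add: Vect_def case_prod_unfold)
  show ?thesis
  proof
    assume ?L
    then have f: "f \<in> bundle_hom (fst adj) E" and eqv: "\<And>g y. g \<in> carrier G \<Longrightarrow> y \<in> \<iota> ` D \<Longrightarrow> f (snd adj (g, y)) = a (g, f y)"
      unfolding hom adj_carrier by auto
    note fD = bundle_homD[OF f, unfolded adj_carrier]
    have "smooth_map X (total E) (\<lambda>x. f (\<iota> (x, \<alpha>)))" if \<alpha>: "\<alpha> \<in> lie" for \<alpha>
    proof -
      have "smooth_map X N (\<lambda>x. (x, \<alpha>))"
        using \<alpha> by (intro smooth_map_Pair cX cT smooth_map_id smooth_map_const)
          (simp add: mcarrier_tangent_space_manifold[OF cM one])
      from smooth_map_compose[OF cX adjoint_charted cI this smooth_map_to_image[OF adjoint_charted inj_adjoint]]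
      have "smooth_map X (image_manifold \<iota> N) (\<lambda>x. \<iota> (x, \<alpha>))" .
      from smooth_map_compose[OF cX cI cE this fD(2)[unfolded adj_total]] show ?thesis .
    qed
    moreover have "proj E (f (\<iota> (x, \<alpha>))) = x" if "\<alpha> \<in> lie" "x \<in> mcarrier X" for x \<alpha>
      using fD(3)[of "\<iota> (x, \<alpha>)"] adj_proj[of "(x, \<alpha>)"] that by simp
    moreover have "f (\<iota> (x, tangent_add M \<alpha> \<beta>)) = vadd E (f (\<iota> (x, \<alpha>))) (f (\<iota> (x, \<beta>)))"
      if "\<alpha> \<in> lie" "\<beta> \<in> lie" "x \<in> mcarrier X" for x \<alpha> \<beta>
      using fD(4)[of "\<iota> (x, \<alpha>)" "\<iota> (x, \<beta>)"] adj_proj[of "(x, \<alpha>)"] adj_proj[of "(x, \<beta>)"] that by (simp add: adj_vadd)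
    moreover have "f (\<iota> (x, tangent_scale M s \<alpha>)) = vscale E s (f (\<iota> (x, \<alpha>)))" if "\<alpha> \<in> lie" "x \<in> mcarrier X" for s x \<alpha>
      using fD(5)[of "\<iota> (x, \<alpha>)" s] that by (simp add: adj_vscale)
    moreover have "f (\<iota> (t (g, x), Ad G g \<alpha>)) = a (g, f (\<iota> (x, \<alpha>)))" if "g \<in> carrier G" "\<alpha> \<in> lie" "x \<in> mcarrier X" for g x \<alpha>
      using eqv[of g "\<iota> (x, \<alpha>)"] that by (simp add: adj_action)
    ultimately show ?R
      using fD(1) unfolding equivariant_family_def by blast
  next
    assume R: ?R
    then have r: "equivariant_family G X t E a (\<lambda>\<alpha> x. f (\<iota> (x, \<alpha>)))" and ext: "f \<in> extensional (\<iota> ` D)"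
      by auto
    note rD = equivariant_familyD[OF r]
    obtain V \<psi> where d: "(V, \<psi>) \<in> charts_at M \<one>\<^bsub>G\<^esub>"
      using charts_at_nonempty[OF cM one] .
    \<comment> \<open>Joint smoothness follows from linearity in \<open>\<alpha>\<close>; the
      coordinates of \<open>\<alpha>\<close> are smooth on the Lie algebra since they are its
      charts.\<close>
    have "smooth_on N (mcarrier N) (total E) (\<lambda>p. f (\<iota> (fst p, snd p)))"
    proof (rule equivariant_family_smooth[OF aD(1) r adjoint_charted _ _ d])
      show "smooth_on N (mcarrier N) X fst"
        using smooth_map_fst[OF cX cT] unfolding smooth_map_iff[OF adjoint_charted cX] .
      show "snd p \<in> lie" if "p \<in> mcarrier N" for p
        using that unfolding adjoint_carrier by auto
      have "smooth_on N (mcarrier N) (tangent_space_manifold M \<one>\<^bsub>G\<^esub>) snd"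
        using smooth_map_snd[OF cX cT] unfolding smooth_map_iff[OF adjoint_charted cT] .
      then show "smooth_fn N (mcarrier N) (\<lambda>p. snd (snd p) (V, \<psi>) i)" for i
        by (rule smooth_fn_pullback[OF adjoint_charted cT _ _ smooth_fn_tangent_space_coord[OF cM one d]])
          (use openin_topspace[of "mtop (tangent_space_manifold M \<one>\<^bsub>G\<^esub>)"] in
            \<open>auto simp: mcarrier_tangent_space_manifold[OF cM one]\<close>)
    qed
    then have "smooth_map N (total E) (\<lambda>p. f (\<iota> p))"
      by (simp add: smooth_map_iff[OF adjoint_charted cE])
    \<comment> \<open>So far f is known to be smooth after \<open>\<iota>\<close>; the smooth
      inverse of \<open>\<iota>\<close> carries this to the copy of the bundle.\<close>
    from smooth_map_compose[OF cI adjoint_charted cE smooth_map_from_image[OF adjoint_charted inj_adjoint] this]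
    have smooth: "smooth_map (image_manifold \<iota> N) (total E) f"
      by (rule smooth_map_cong[OF cI cE, rotated])
        (auto simp: mcarrier_image_manifold[OF adjoint_charted inj_adjoint] adjoint_carrier adj_inverse simp del: prod_manifold_simps)
    have "fibrewise_linear (fst adj) E f"
      unfolding fibrewise_linear_def adj_carrier
    proof (intro conjI allI ballI impI)
      fix y y' assume y: "y \<in> \<iota> ` D" "y' \<in> \<iota> ` D" "proj (fst adj) y = proj (fst adj) y'"
      then obtain x \<alpha> x' \<beta> where *: "y = \<iota> (x, \<alpha>)" "y' = \<iota> (x', \<beta>)" "x \<in> mcarrier X" "x' \<in> mcarrier X" "\<alpha> \<in> lie" "\<beta> \<in> lie"
        by blast
      then have "x = x'"
        using y(3) adj_proj[of "(x, \<alpha>)"] adj_proj[of "(x', \<beta>)"] by simp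
      then show "f (vadd (fst adj) y y') = vadd E (f y) (f y')"
        using * rD(3) by (simp add: adj_vadd)
    next
      fix s y assume "y \<in> \<iota> ` D"
      then show "f (vscale (fst adj) s y) = vscale E s (f y)"
        using rD(4) by (auto simp: adj_vscale)
    qed
    moreover have "proj E (f y) = proj (fst adj) y" if "y \<in> \<iota> ` D" for y
    proof -
      obtain x \<alpha> where "y = \<iota> (x, \<alpha>)" "x \<in> mcarrier X" "\<alpha> \<in> lie"
        using \<open>y \<in> \<iota> ` D\<close> by blast
      then show ?thesis
        using rD(2) adj_proj[of "(x, \<alpha>)"] by simp
    qed
    moreover have "f (snd adj (g, y)) = a (g, f y)" if "g \<in> carrier G" "y \<in> \<iota> ` D" for g y
    proof -
      obtain x \<alpha> where "y = \<iota> (x, \<alpha>)" "x \<in> mcarrier X" "\<alpha> \<in> lie"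
        using \<open>y \<in> \<iota> ` D\<close> by blast
      then show ?thesis
        using rD(5) \<open>g \<in> carrier G\<close> by (simp add: adj_action)
    qed
    ultimately show ?L
      using smooth[folded adj_total] ext unfolding hom bundle_hom_def bundle_map_over_def adj_carrier by simp
  qed
qed

text \<open>The two maps on objects are uncurrying and currying, with \<open>\<iota>\<close>
  inserted. Restriction to the copy, to the Lie algebra and to X keeps the results extensional,
  which makes the maps inverse to each other exactly.\<close>

lemma pairs_slice:
  "same_morphisms (Vect_pairs G X t) (slice_category adj (Vect G X t))
    (\<lambda>(A, \<rho>). (A, \<lambda>y\<in>\<iota> ` D. \<rho> (snd (inv_into D \<iota> y)) (fst (inv_into D \<iota> y))))
    (\<lambda>(A, f). (A, \<lambda>\<alpha>\<in>lie. \<lambda>x\<in>mcarrier X. f (\<iota> (x, \<alpha>))))"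
proof -
  let ?V = "Vect G X t" and ?S = "slice_category adj (Vect G X t)"
  let ?P = "Vect_pairs G X t :: (('g, 'e, 'x) equivariant_bundle \<times> ('g tangent \<Rightarrow> 'x \<Rightarrow> 'e), 'e \<Rightarrow> 'e) category"
  let ?F = "\<lambda>\<rho>. \<lambda>y\<in>\<iota> ` D. \<rho> (snd (inv_into D \<iota> y)) (fst (inv_into D \<iota> y))"
  let ?K = "\<lambda>f. \<lambda>\<alpha>\<in>lie. \<lambda>x\<in>mcarrier X. f (\<iota> (x, \<alpha>))"
  have F: "?F \<rho> (\<iota> (x, \<alpha>)) = \<rho> \<alpha> x" if "\<alpha> \<in> lie" "x \<in> mcarrier X" for \<rho> \<alpha> x
    using that adj_inverse[of "(x, \<alpha>)"] by simp
  have obj: "A \<in> Obj ?V \<longleftrightarrow> equivariant_bundle G X t A" for A :: "('g, 'e, 'x) equivariant_bundle"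
    by (simp add: Vect_def)
  have objP: "(A, \<rho>) \<in> Obj ?P \<longleftrightarrow> equivariant_bundle G X t A \<and> equivariant_linear G X t A \<rho>"
    for A :: "('g, 'e, 'x) equivariant_bundle" and \<rho>
    by (simp add: Vect_pairs_def obj)
  have objS: "(A, f) \<in> Obj ?S \<longleftrightarrow> equivariant_bundle G X t A \<and> f \<in> Hom ?V adj A" for A f
    by (simp add: slice_category_def obj)
  have to_slice: "?F \<rho> \<in> Hom ?V adj A \<and> ?K (?F \<rho>) = \<rho>"
    if A: "equivariant_bundle G X t A" and \<rho>: "equivariant_linear G X t A \<rho>" for A \<rho>
  proof -
    obtain E a where Ea: "A = (E, a)"
      by (cases A)
    note A' = A[unfolded Ea]
    note E = equivariant_bundleD(1)[OF A']
    have r: "\<rho> \<in> extensional lie" "\<And>\<alpha>. \<alpha> \<in> lie \<Longrightarrow> \<rho> \<alpha> \<in> extensional (mcarrier X)" "equivariant_family G X t E a \<rho>"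
      using \<rho> unfolding Ea equivariant_linear_iff[OF E] by auto
    have "equivariant_family G X t E a (\<lambda>\<alpha> x. ?F \<rho> (\<iota> (x, \<alpha>)))"
      by (rule equivariant_family_cong[OF _ E r(3)]) (simp only: F)
    then have "?F \<rho> \<in> Hom ?V adj A"
      unfolding Ea hom_from_adjoint_iff[OF A'] by simp
    moreover have "?K (?F \<rho>) = \<rho>"
    proof (rule extensionalityI[of _ lie])
      fix \<alpha> assume \<alpha>: "\<alpha> \<in> lie"
      show "?K (?F \<rho>) \<alpha> = \<rho> \<alpha>"
        by (rule extensionalityI[of _ "mcarrier X"]) (use \<alpha> r(2) F[OF \<alpha>] in simp_all)
    qed (use r(1) in simp_all)
    ultimately show ?thesis
      by blast
  qed
  have from_slice: "equivariant_linear G X t A (?K f) \<and> ?F (?K f) = f"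
    if A: "equivariant_bundle G X t A" and f: "f \<in> Hom ?V adj A" for A f
  proof -
    obtain E a where Ea: "A = (E, a)"
      by (cases A)
    note A' = A[unfolded Ea]
    note E = equivariant_bundleD(1)[OF A']
    have r: "f \<in> extensional (\<iota> ` D)" "equivariant_family G X t E a (\<lambda>\<alpha> x. f (\<iota> (x, \<alpha>)))"
      using f unfolding Ea hom_from_adjoint_iff[OF A'] by auto
    have "equivariant_family G X t E a (?K f)"
      by (rule equivariant_family_cong[OF _ E r(2)]) simp
    then have "equivariant_linear G X t A (?K f)"
      unfolding Ea equivariant_linear_iff[OF E] by simp
    moreover have "?F (?K f) = f"
    proof (rule extensionalityI[of _ "\<iota> ` D"])
      fix y assume "y \<in> \<iota> ` D"
      then obtain x \<alpha> where "y = \<iota> (x, \<alpha>)" "\<alpha> \<in> lie" "x \<in> mcarrier X"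
        by blast
      then show "?F (?K f) y = f y"
        using F[of \<alpha> x "?K f"] by simp
    qed (use r(1) in simp_all)
    ultimately show ?thesis
      by blast
  qed
  have hom: "Hom ?P (A, \<rho>) (A', \<rho>') = Hom ?S (A, ?F \<rho>) (A', ?F \<rho>')"
    if "equivariant_bundle G X t A" "equivariant_linear G X t A \<rho>" "equivariant_bundle G X t A'" "equivariant_linear G X t A' \<rho>'"
    for A A' \<rho> \<rho>'
  proof -
    obtain E a E' a' where Ea: "A = (E, a)" "A' = (E', a')"
      by (cases A, cases A')
    have ext: "\<rho> \<in> extensional lie" "\<And>\<alpha>. \<alpha> \<in> lie \<Longrightarrow> \<rho> \<alpha> \<in> extensional (mcarrier X)"
        "\<rho>' \<in> extensional lie" "\<And>\<alpha>. \<alpha> \<in> lie \<Longrightarrow> \<rho>' \<alpha> \<in> extensional (mcarrier X)"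
      using that equivariant_linear_iff[OF equivariant_bundleD(1)] unfolding Ea by blast+
    have P: "compose lie (section_map X \<theta>) \<rho> = \<rho>' \<longleftrightarrow> (\<forall>\<alpha>\<in>lie. \<forall>x\<in>mcarrier X. \<theta> (\<rho> \<alpha> x) = \<rho>' \<alpha> x)" for \<theta>
      by (rule section_map_compose_eq_iff[OF ext])
    \<comment> \<open>The slice triangle, evaluated at the points of the copied bundle, is the same
      pointwise condition as for pairs.\<close>
    have S: "compose (\<iota> ` D) \<theta> (?F \<rho>) = ?F \<rho>' \<longleftrightarrow> (\<forall>\<alpha>\<in>lie. \<forall>x\<in>mcarrier X. \<theta> (\<rho> \<alpha> x) = \<rho>' \<alpha> x)" (is "?l \<longleftrightarrow> ?r") for \<theta>
    proof
      assume l: ?l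
      show ?r
      proof (intro ballI)
        fix \<alpha> x assume *: "\<alpha> \<in> lie" "x \<in> mcarrier X"
        then show "\<theta> (\<rho> \<alpha> x) = \<rho>' \<alpha> x"
          using fun_cong[OF l, of "\<iota> (x, \<alpha>)"] adj_inverse[of "(x, \<alpha>)"] by (simp add: compose_def)
      qed
    next
      assume r: ?r
      show ?l
      proof (rule extensionalityI[of _ "\<iota> ` D"])
        fix y assume "y \<in> \<iota> ` D"
        then obtain x \<alpha> where *: "y = \<iota> (x, \<alpha>)" "\<alpha> \<in> lie" "x \<in> mcarrier X"
          by blast
        then show "compose (\<iota> ` D) \<theta> (?F \<rho>) y = ?F \<rho>' y"
          using r adj_inverse[of "(x, \<alpha>)"] by (simp add: compose_def)
      qed simp_all
    qed
    have "Comp ?V adj A A' \<theta> \<psi> = compose (\<iota> ` D) \<theta> \<psi>" for \<theta> \<psi>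
      unfolding adj_carrier[symmetric] by (simp add: Vect_def case_prod_unfold)
    then show ?thesis
      unfolding Vect_pairs_def slice_category_def by (simp add: P S)
  qed
  have ident: "Ident ?P (A, \<rho>) = Ident ?S (A, f)"
    and comp: "Comp ?P (A, \<rho>) (B, \<rho>') (C, \<rho>'') = Comp ?S (A, f) (B, f') (C, f'')"
    for A B C :: "('g, 'e, 'x) equivariant_bundle" and \<rho> \<rho>' \<rho>'' f f' f''
    by (simp_all add: Vect_pairs_def slice_category_def)
  have pair: "\<exists>A \<rho>. a = (A, \<rho>) \<and> equivariant_bundle G X t A \<and> equivariant_linear G X t A \<rho>" if "a \<in> Obj ?P"
    for a :: "('g, 'e, 'x) equivariant_bundle \<times> ('g tangent \<Rightarrow> 'x \<Rightarrow> 'e)"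
    using that by (cases a) (auto simp: objP)
  show ?thesis
    unfolding same_morphisms_def
  proof (intro conjI ballI)
    fix a assume a: "a \<in> Obj ?P"
    obtain A \<rho> where A: "a = (A, \<rho>)" "equivariant_bundle G X t A" "equivariant_linear G X t A \<rho>"
      using pair[OF a] by blast
    show "(case a of (A, \<rho>) \<Rightarrow> (A, ?F \<rho>)) \<in> Obj ?S" "(case case a of (A, \<rho>) \<Rightarrow> (A, ?F \<rho>) of (A, f) \<Rightarrow> (A, ?K f)) = a"
      unfolding A(1) prod.case objS using to_slice[OF A(2,3)] A(2) by blast+
    show "Ident ?P a = Ident ?S (case a of (A, \<rho>) \<Rightarrow> (A, ?F \<rho>))"
      unfolding A(1) prod.case by (rule ident)
    fix b assume b: "b \<in> Obj ?P"
    obtain B \<rho>' where B: "b = (B, \<rho>')" "equivariant_bundle G X t B" "equivariant_linear G X t B \<rho>'"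
      using pair[OF b] by blast
    show "Hom ?P a b = Hom ?S (case a of (A, \<rho>) \<Rightarrow> (A, ?F \<rho>)) (case b of (A, \<rho>) \<Rightarrow> (A, ?F \<rho>))"
      unfolding A(1) B(1) prod.case by (rule hom[OF A(2,3) B(2,3)])
    fix c assume c: "c \<in> Obj ?P"
    obtain C \<rho>'' where C: "c = (C, \<rho>'')"
      by (cases c)
    show "Comp ?P a b c = Comp ?S (case a of (A, \<rho>) \<Rightarrow> (A, ?F \<rho>)) (case b of (A, \<rho>) \<Rightarrow> (A, ?F \<rho>))
        (case c of (A, \<rho>) \<Rightarrow> (A, ?F \<rho>))"
      unfolding A(1) B(1) C prod.case by (rule comp)
  next
    fix b assume b: "b \<in> Obj ?S"
    obtain A f where A: "b = (A, f)" "equivariant_bundle G X t A" "f \<in> Hom ?V adj A"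
      using b by (cases b) (simp add: objS)
    show "(case b of (A, f) \<Rightarrow> (A, ?K f)) \<in> Obj ?P" "(case case b of (A, f) \<Rightarrow> (A, ?K f) of (A, \<rho>) \<Rightarrow> (A, ?F \<rho>)) = b"
      unfolding A(1) prod.case objP using from_slice[OF A(2,3)] A(2) by blast+
  qed
qed

end

end

theorem theoremA:
  fixes G :: "'g lie_group"
    and X :: "'x manifold"
    and t :: "'g \<times> 'x \<Rightarrow> 'x"
    and \<iota> :: "'x \<times> 'g tangent \<Rightarrow> 'e"
    and C1 :: "(('g tangent, 'e, 'x) equivariant_bundle, 'e \<Rightarrow> 'e) category"
    and C2 :: "(('g, 'e, 'x) equivariant_bundle \<times> ('g tangent \<Rightarrow> 'x \<Rightarrow> 'e), 'e \<Rightarrow> 'e) category"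
    and C3 :: "(('g, 'e, 'x) equivariant_bundle \<times> ('e \<Rightarrow> 'e), 'e \<Rightarrow> 'e) category"
  assumes "is_lie_group G"
    and "smooth_manifold X"
    and "lie_action G X t"
    and "inj_on \<iota> (mcarrier X \<times> lie_algebra G)"
    and "C1 = Vect_aff G X t"
    and "C2 = Vect_pairs G X t"
    and "C3 = slice_category (image_equivariant_bundle \<iota> G (adjoint_bundle G X t)) (Vect G X t)"
  shows "is_category C1 \<and> is_category C2 \<and> is_category C3 \<and>
    isomorphic_categories C1 C2 \<and> isomorphic_categories C2 C3 \<and> isomorphic_categories C1 C3"
proof -
  have 1: "is_category C1"
    unfolding assms(5) by (rule is_category_Vect_aff[OF assms(1-3)])
  \<comment> \<open>Only the existence of the maps on objects matters from here on, so their
    explicit forms are hidden before composing.\<close>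
  have "\<exists>F K. same_morphisms C1 C2 F K"
    unfolding assms(5,6) by (intro exI, rule Vect_aff_pairs[OF assms(1-3)])
  then obtain F K where 12: "same_morphisms C1 C2 F K"
    by blast
  have "\<exists>F K. same_morphisms C2 C3 F K"
    unfolding assms(6,7) by (intro exI, rule pairs_slice[OF assms(1-4)])
  then obtain F' K' where 23: "same_morphisms C2 C3 F' K'"
    by blast
  note 13 = same_morphisms_trans[OF 12 23]
  show ?thesis
    using 1 same_morphisms_is_category[OF 12 1] same_morphisms_is_category[OF 13 1]
      same_morphisms_isomorphic[OF 12] same_morphisms_isomorphic[OF 23] same_morphisms_isomorphic[OF 13]
    by blast
qed

end
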